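(* Let $p>1$ and $r\ge1$ be integers and $K=\frac p2+\frac1{p+1}$. Then on $Y_{II}(r,p;K)$ the complete Einstein–Kähler metric $\mathcal{E}_{II}$ is equivalent to the Bergman metric $\mathcal{B}_{II}$: there exist constants $a\ge b>0$ such that $$b\le\frac{\mathcal{B}_{II}}{\mathcal{E}_{II}}\le a$$ at every point of $Y_{II}(r,p;K)$ and for every nonzero tangent vector.
   Context: $R_{II}(p)$ is the classical symmetric domain of the second type: the set of complex symmetric $p\times p$ matrices $Z$ with $I-Z\overline Z$ positive definite. Its coordinates are $z=(z_{11},z_{12},\dots,z_{1p},z_{22},\dots,z_{2p},\dots,z_{pp})$, where the diagonal entries of $Z$ are $z_{kk}$ and the off-diagonal entries (in positions $(k,l)$ and $(l,k)$, $k<l$) are $\frac1{\sqrt2}z_{kl}$. For $K>0$, $$Y_{II}(r,p;K)=\{(Z,w): w\in\mathbb{C}^r,\ Z\in R_{II}(p),\ |w|^2<\det(I-Z\overline Z)^{1/K}\},$$ a bounded pseudoconvex domain of dimension $N=\frac{p(p+1)}2+r$ with coordinates $(z,w)=(z_1,\dots,z_N)$. When $K=\frac p2+\frac1{p+1}$, the complete Einstein–Kähler metric of $Y_{II}(r,p;K)$ is $\mathcal{E}_{II}=\sum_{\alpha,\beta}\frac{\partial^2 g}{\partial z_\alpha\partial\overline z_\beta}dz_\alpha\overline{dz_\beta}$ with $$g=\log\Big[\frac1{1-X}\det(I-Z\overline Z)^{-\frac1K}K^{\frac{r-N}{1+N}}\Big],\qquad X=|w|^2\det(I-Z\overline Z)^{-1/K}.$$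 The Bergman metric is $\mathcal{B}_{II}=\sum_{\alpha,\beta}\frac{\partial^2\log K_{II}}{\partial z_\alpha\partial\overline z_\beta}dz_\alpha\overline{dz_\beta}$, where $K_{II}$ is the Bergman kernel function of $Y_{II}(r,p;K)$ on the diagonal. Both $\mathcal{E}_{II}$ and $\mathcal{B}_{II}$ are regarded as Hermitian quadratic forms (squared lengths) evaluated on tangent vectors. *)

theory Defs
  imports "HOL-Analysis.Analysis" "HOL-Library.Uprod"
begin

section \<open>Several complex variables: holomorphy, Bergman kernel, complex Hessians\<close>

definition holomorphic_cn :: "(complex^'n \<Rightarrow> complex) \<Rightarrow> (complex^'n) set \<Rightarrow> bool" where
  "holomorphic_cn f D \<longleftrightarrow>
     (\<forall>z\<in>D. \<exists>f'. (f has_derivative f') (at z) \<and> (\<forall>c v. f' (c *s v) = c * f' v))"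

definition bergman_space :: "(complex^'n) set \<Rightarrow> (complex^'n \<Rightarrow> complex) set" where
  "bergman_space D =
     {f. holomorphic_cn f D \<and> set_integrable lborel D (\<lambda>z. (cmod (f z))\<^sup>2)}"

text \<open>
  The Bergman kernel is the reproducing kernel of the Bergman space. It is normalised to
  vanish off \<open>D \<times> D\<close>, since elements of \<^const>\<open>bergman_space\<close> are arbitrary outside \<open>D\<close>
  and the kernel would otherwise not be unique as a total function.
\<close>

definition is_bergman_kernel ::
    "(complex^'n) set \<Rightarrow> (complex^'n \<Rightarrow> complex^'n \<Rightarrow> complex) \<Rightarrow> bool" where
  "is_bergman_kernel D k \<longleftrightarrow>
     (\<forall>u\<in>D. (\<lambda>z. k z u) \<in> bergman_space D \<and>
        (\<forall>f\<in>bergman_space D. f u = (LINT z:D|lborel. f z * cnj (k z u)))) \<and>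
     (\<forall>z u. z \<notin> D \<or> u \<notin> D \<longrightarrow> k z u = 0)"

definition bergman_kernel ::
    "(complex^'n) set \<Rightarrow> complex^'n \<Rightarrow> complex^'n \<Rightarrow> complex" where
  "bergman_kernel D = (THE k. is_bergman_kernel D k)"

definition dir_deriv :: "complex^'n \<Rightarrow> (complex^'n \<Rightarrow> complex) \<Rightarrow> complex^'n \<Rightarrow> complex" where
  "dir_deriv v f z = vector_derivative (\<lambda>t::real. f (z + t *\<^sub>R v)) (at 0)"

text \<open>Wirtinger derivatives in the coordinate \<open>z $ \<alpha> = x + \<i> y\<close>.\<close>

definition d_z :: "'n \<Rightarrow> (complex^'n \<Rightarrow> complex) \<Rightarrow> complex^'n \<Rightarrow> complex" where
  "d_z \<alpha> f z = (dir_deriv (axis \<alpha> 1) f z - \<i> * dir_deriv (axis \<alpha> \<i>) f z) / 2"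

definition d_zbar :: "'n \<Rightarrow> (complex^'n \<Rightarrow> complex) \<Rightarrow> complex^'n \<Rightarrow> complex" where
  "d_zbar \<alpha> f z = (dir_deriv (axis \<alpha> 1) f z + \<i> * dir_deriv (axis \<alpha> \<i>) f z) / 2"

text \<open>
  The squared length of the tangent vector \<open>v\<close> at \<open>z\<close> in the metric with potential \<open>g\<close>.
  For a real \<open>C\<^sup>2\<close> potential the Hermitian form is real-valued, so \<^const>\<open>Re\<close> only adjusts the type.
\<close>

definition potential_metric :: "(complex^'n \<Rightarrow> real) \<Rightarrow> complex^'n \<Rightarrow> complex^'n \<Rightarrow> real" where
  "potential_metric g z v =
     Re (\<Sum>\<alpha>\<in>UNIV. \<Sum>\<beta>\<in>UNIV.
       d_z \<alpha> (d_zbar \<beta> (\<lambda>u. complex_of_real (g u))) z * v $ \<alpha> * cnj (v $ \<beta>))"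

definition bergman_metric :: "(complex^'n) set \<Rightarrow> complex^'n \<Rightarrow> complex^'n \<Rightarrow> real" where
  "bergman_metric D = potential_metric (\<lambda>z. ln (Re (bergman_kernel D z z)))"

section \<open>The symmetric domain of the second type and the domain \<open>Y\<^sub>I\<^sub>I(r,p;K)\<close>\<close>

definition conj_mat :: "complex^'n^'m \<Rightarrow> complex^'n^'m" where
  "conj_mat A = (\<chi> i j. cnj (A $ i $ j))"

definition pos_def :: "complex^'n^'n \<Rightarrow> bool" where
  "pos_def A \<longleftrightarrow>
     (\<forall>x. x \<noteq> 0 \<longrightarrow>
        (let q = \<Sum>i\<in>UNIV. \<Sum>j\<in>UNIV. cnj (x $ i) * A $ i $ j * x $ j in q \<in> \<real> \<and> Re q > 0))"

definition R_II :: "(complex^'p^'p) set" where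
  "R_II = {Z. transpose Z = Z \<and> pos_def (mat 1 - Z ** conj_mat Z)}"

text \<open>
  Here \<open>p = CARD('p)\<close> and \<open>r = CARD('r)\<close>. The independent entries \<open>z\<^sub>k\<^sub>l\<close>, \<open>k \<le> l\<close>, of a
  symmetric matrix are indexed by the unordered pairs \<^term>\<open>Upair k l\<close> (with \<open>k = l\<close>
  allowed), and the components of \<open>w\<close> by \<open>'r\<close>; so a point of \<open>\<complex>\<^sup>N\<close> has type
  \<^typ>\<open>complex^('p uprod + 'r)\<close>.
\<close>

instance uprod :: (finite) finite
  by standard simp

definition dimN :: "nat \<Rightarrow> nat \<Rightarrow> nat" where
  "dimN r p = p * (p + 1) div 2 + r"

lemma dimN_eq_CARD: "dimN CARD('r::finite) CARD('p::finite) = CARD('p uprod + 'r)"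
  by (simp add: dimN_def card_UNIV_uprod card_UNIV_sum)

definition Zpart :: "complex^('p::finite uprod + 'r::finite) \<Rightarrow> complex^'p^'p" where
  "Zpart z = (\<chi> k l. if k = l then z $ Inl (Upair k k)
                     else complex_of_real (1 / sqrt 2) * z $ Inl (Upair k l))"

definition wpart :: "complex^('p::finite uprod + 'r::finite) \<Rightarrow> complex^'r" where
  "wpart z = (\<chi> j. z $ Inr j)"

text \<open>\<open>I - Z Z\<^sup>-\<close> is Hermitian (\<open>Z\<close> being symmetric), so its determinant is real.\<close>

definition detZ :: "complex^('p::finite uprod + 'r::finite) \<Rightarrow> real" where
  "detZ z = Re (det (mat 1 - Zpart z ** conj_mat (Zpart z)))"

definition Y_II :: "real \<Rightarrow> (complex^('p::finite uprod + 'r::finite)) set" where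
  "Y_II K = {z. Zpart z \<in> R_II \<and> (norm (wpart z))\<^sup>2 < detZ z powr (1 / K)}"

definition X_II :: "real \<Rightarrow> complex^('p::finite uprod + 'r::finite) \<Rightarrow> real" where
  "X_II K z = (norm (wpart z))\<^sup>2 * detZ z powr (- 1 / K)"

definition g_II :: "real \<Rightarrow> complex^('p::finite uprod + 'r::finite) \<Rightarrow> real" where
  "g_II K z =
     ln (1 / (1 - X_II K z) * detZ z powr (- 1 / K) *
         K powr ((real CARD('r) - real (dimN CARD('r) CARD('p))) /
                 (1 + real (dimN CARD('r) CARD('p)))))"

text \<open>
  The complete Einstein--Kaehler metric of \<^term>\<open>Y_II K\<close> for the critical value
  \<open>K = p/2 + 1/(p+1)\<close>, given by its explicit potential.
\<close>

definition E_II ::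
    "real \<Rightarrow> complex^('p::finite uprod + 'r::finite) \<Rightarrow> complex^('p uprod + 'r) \<Rightarrow> real" where
  "E_II K = potential_metric (g_II K)"

definition B_II ::
    "real \<Rightarrow> complex^('p::finite uprod + 'r::finite) \<Rightarrow> complex^('p uprod + 'r) \<Rightarrow> real" where
  "B_II K = bergman_metric (Y_II K)"

end

theory Submission
  imports Defs "HOL-Complex_Analysis.Cauchy_Integral_Formula"
begin

text \<open>
  Put \<open>h = - ln det(I - Z Z\<^sup>*) / K\<close>, so that \<open>X = |w|\<^sup>2 exp h\<close>. The automorphisms of \<open>R\<^sub>I\<^sub>I\<close> lift to
  \<open>Y\<^sub>I\<^sub>I\<close>, preserve \<open>X\<close> and move every point into the fibre \<open>Z = 0\<close>. Averaging over rotations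
  reduces the reproducing property at a point of this fibre to Cauchy's formula in one variable, so
  that there the kernel is \<open>F(|w|\<^sup>2)\<close> with \<open>F(x) = \<Sum> c\<^sub>m x\<^sup>m\<close>, where \<open>1/c\<^sub>m\<close> is the integral of
  \<open>|\<langle>w,e\<rangle>|\<^sup>2\<^sup>m\<close> over \<open>Y\<^sub>I\<^sub>I\<close> for a unit vector \<open>e\<close>. Hence the Bergman metric has the potential
  \<open>(K(p+1)+r) h + ln F(X)\<close>, while the Einstein--Kaehler metric has \<open>h - ln(1-X)\<close>. As \<open>Y\<^sub>I\<^sub>I\<close>
  lies between two ellipsoids, \<open>c\<^sub>m\<close> is comparable to \<open>binomial(m+N, N)\<close>, which makes
  \<open>(ln F)'\<close> and \<open>(x (ln F)')'\<close> comparable to \<open>1/(1-x)\<close> and \<open>1/(1-x)\<^sup>2\<close>. The Levi form of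
  \<open>C h + G(X)\<close> is a sum of nonnegative terms with the coefficients \<open>C\<close>, \<open>G'\<close> and \<open>(x G')'\<close>, so
  the two metrics can be compared term by term.
\<close>

section \<open>Change of variables on \<open>\<complex>\<^sup>n\<close>\<close>

text \<open>Only two-sided bounds on the coefficients of \<open>F\<close> are used, never a closed
  form. They pass to \<open>F\<close> and \<open>F'\<close> at once, but \<open>(ln F)''\<close> is
  a difference of terms of equal size, in which they would be lost. Reading
  \<open>x (x (ln F)')'\<close> as a variance, hence as a minimum of second moments, preserves them;
  accordingly the Levi form is regrouped so that \<open>G''\<close> occurs only in
  \<open>(x G')' = G' + x G''\<close>. The reproducing property is tested directly on each function
  of the Bergman space, so completeness of a system of monomials never has to be shown. The exponent
  \<open>K (p + 1) + r\<close> is a Jacobian. With D the denominator of a Moebius map in Z, the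
  lifted automorphism multiplies w by \<open>det D ^ (-1/K)\<close>; this root has a global branch
  because contractive matrices form a convex set. The complex Jacobian is
  \<open>det D ^ (-(p+1))\<close> times \<open>det D ^ (-r/K)\<close>, and
  \<open>|det D|^2 = exp (- K h)\<close> at the point sent to \<open>Z = 0\<close>. Of the two
  ellipsoids the inner one relies on \<open>K >= 1\<close>, and both stretch only the Z directions,
  which makes the comparison of moments uniform in m.\<close>

text \<open>
  The library proves the change of variables theorem only for \<open>real^'m\<close> with a well-ordered
  index type; \<open>'n bit0\<close> is such a type and has twice as many elements as \<open>'n\<close>.
\<close>

definition cbasis :: "'n::finite bit0 \<Rightarrow> complex^'n" where
  "cbasis = (SOME f. bij_betw f UNIV Basis)"

lemma bij_cbasis: "bij_betw (cbasis :: 'n::finite bit0 \<Rightarrow> complex^'n) UNIV Basis"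
proof -
  have "card (UNIV :: 'n bit0 set) = card (Basis :: (complex^'n) set)"
    by (simp add: DIM_cart)
  then have "\<exists>f. bij_betw f (UNIV :: 'n bit0 set) (Basis :: (complex^'n) set)"
    by (intro finite_same_card_bij) auto
  then show ?thesis unfolding cbasis_def by (rule someI_ex)
qed

lemma cbasis_in [simp]: "cbasis i \<in> Basis"
  using bij_cbasis by (auto simp: bij_betw_def)

lemma cbasis_inner: "cbasis i \<bullet> cbasis j = (if i = j then 1 else 0)"
  using bij_cbasis by (auto simp: bij_betw_def inner_Basis inj_on_def)

definition flat :: "complex^'n::finite \<Rightarrow> real^('n bit0)" where
  "flat x = (\<chi> i. x \<bullet> cbasis i)"

definition unflat :: "real^('n::finite bit0) \<Rightarrow> complex^'n" where
  "unflat y = (\<Sum>i\<in>UNIV. (y $ i) *\<^sub>R cbasis i)"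

lemma linear_flat: "linear flat"
  by (rule linearI) (auto simp: flat_def vec_eq_iff inner_add_left)

lemma linear_unflat: "linear unflat"
  by (rule linearI) (auto simp: unflat_def sum.distrib scaleR_left_distrib scaleR_sum_right)

lemma flat_unflat [simp]: "flat (unflat y) = y"
  by (simp add: flat_def unflat_def vec_eq_iff inner_sum_left cbasis_inner if_distrib cong: if_cong)

lemma unflat_flat [simp]: "unflat (flat x) = x"
proof -
  have "unflat (flat x) = (\<Sum>b\<in>Basis. (x \<bullet> b) *\<^sub>R b)"
    unfolding unflat_def flat_def
    by (simp add: sum.reindex_bij_betw[OF bij_cbasis, of "\<lambda>b. (x \<bullet> b) *\<^sub>R b", symmetric])
  then show ?thesis by (simp add: euclidean_representation)
qed

lemma unflat_inner_cbasis: "unflat y \<bullet> cbasis i = y $ i"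
  by (metis flat_def flat_unflat vec_lambda_beta)

lemma inner_unflat: "unflat x \<bullet> unflat y = x \<bullet> y"
  unfolding unflat_def[of y] inner_sum_right inner_scaleR_right unflat_inner_cbasis
  by (simp add: inner_vec_def mult.commute)

lemma measurable_unflat [measurable]: "unflat \<in> borel_measurable borel"
  by (intro borel_measurable_continuous_onI linear_continuous_on)
     (simp add: linear_unflat flip: linear_conv_bounded_linear)

lemma measurable_flat [measurable]: "flat \<in> borel_measurable borel"
  by (intro borel_measurable_continuous_onI linear_continuous_on)
     (simp add: linear_flat flip: linear_conv_bounded_linear)

text \<open>\<open>flat\<close> only renumbers coordinates along an orthonormal basis, so both
  measures give a box the product of its side lengths; Lebesgue measure is determined by its values
  on boxes.\<close>

lemma lborel_unflat: "(lborel :: (complex^'n::finite) measure) = distr lborel borel unflat"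
proof (rule lborel_eqI)
  fix l u :: "complex^'n"
  assume le: "\<And>b. b \<in> Basis \<Longrightarrow> l \<bullet> b \<le> u \<bullet> b"
  have "unflat -` box l u = box (flat l) (flat u)"
  proof -
    have "(\<forall>i\<in>Basis. l \<bullet> i < x \<bullet> i \<and> x \<bullet> i < u \<bullet> i) \<longleftrightarrow>
        (\<forall>i. l \<bullet> cbasis i < x \<bullet> cbasis i \<and> x \<bullet> cbasis i < u \<bullet> cbasis i)" for x :: "complex^'n"
      using bij_betw_imp_surj_on[OF bij_cbasis] by (metis (no_types, lifting) cbasis_in imageE)
    then show ?thesis
      unfolding set_eq_iff vimage_eq mem_box_cart unfolding mem_box
      by (simp add: unflat_inner_cbasis flat_def)
  qed
  then have "emeasure (distr lborel borel unflat) (box l u) = emeasure lborel (box (flat l) (flat u))"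
    by (simp add: emeasure_distr)
  also have "\<dots> = (\<Prod>b\<in>Basis. (flat u - flat l) \<bullet> b)"
    by (rule emeasure_lborel_box) (use le[OF cbasis_in] in \<open>auto simp: flat_def Basis_vec_def inner_axis\<close>)
  also have "(\<Prod>b\<in>Basis. (flat u - flat l) \<bullet> b) = (\<Prod>i\<in>UNIV. (u - l) \<bullet> cbasis i)"
  proof -
    have inj: "inj (\<lambda>i::'n bit0. axis i (1::real))"
      by (auto simp: inj_on_def axis_eq_axis)
    have B: "(Basis :: (real^('n bit0)) set) = range (\<lambda>i. axis i 1)"
      by (auto simp: Basis_vec_def)
    show ?thesis
      unfolding B prod.reindex[OF inj] by (simp add: inner_axis flat_def inner_diff_left)
  qed
  also have "(\<Prod>i\<in>UNIV. (u - l) \<bullet> cbasis i) = (\<Prod>b\<in>Basis. (u - l) \<bullet> b)"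
    by (rule prod.reindex_bij_betw[OF bij_cbasis])
  finally show "emeasure (distr lborel borel unflat) (box l u) = (\<Prod>b\<in>Basis. (u - l) \<bullet> b)" .
qed simp

lemma nn_integral_unflat:
  assumes [measurable]: "f \<in> borel_measurable borel"
  shows "(\<integral>\<^sup>+x. f x \<partial>(lborel :: (complex^'n::finite) measure)) = (\<integral>\<^sup>+y. f (unflat y) \<partial>lborel)"
  by (subst lborel_unflat, subst nn_integral_distr) auto

text \<open>The absolute Jacobian of L as a real-linear map. For a complex-linear L it is the
  squared modulus of the complex determinant.\<close>

definition adet :: "(complex^'n::finite \<Rightarrow> complex^'n) \<Rightarrow> real" where
  "adet L = \<bar>det (matrix (flat \<circ> L \<circ> unflat))\<bar>"

lemma adet_nonneg: "adet L \<ge> 0"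
  by (simp add: adet_def)

lemma adet_comp:
  assumes "linear L" "linear M"
  shows "adet (L \<circ> M) = adet L * adet M"
proof -
  have "flat \<circ> (L \<circ> M) \<circ> unflat = (flat \<circ> L \<circ> unflat) \<circ> (flat \<circ> M \<circ> unflat)"
    by (auto simp: fun_eq_iff)
  moreover have "linear (flat \<circ> L \<circ> unflat)" "linear (flat \<circ> M \<circ> unflat)"
    using assms by (auto intro!: linear_compose linear_flat linear_unflat)
  ultimately show ?thesis
    by (simp add: adet_def matrix_compose det_mul abs_mult)
qed

lemma adet_id: "adet (\<lambda>x. x) = 1"
proof -
  have "flat \<circ> (\<lambda>x. x) \<circ> unflat = id" by (auto simp: fun_eq_iff)
  then show ?thesis unfolding adet_def by (metis abs_one matrix_id)
qed

lemma adet_isometry: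
  fixes L :: "complex^'n::finite \<Rightarrow> complex^'n"
  assumes "linear L" "\<And>x. norm (L x) = norm x"
  shows "adet L = 1"
proof -
  have n: "norm (unflat y) = norm y" for y :: "real^('n bit0)"
    by (simp add: norm_eq_sqrt_inner inner_unflat)
  have f: "norm (flat x) = norm x" for x :: "complex^'n"
    by (metis n unflat_flat)
  have "orthogonal_transformation (flat \<circ> L \<circ> unflat)"
    unfolding orthogonal_transformation
    using assms by (auto intro!: linear_compose linear_flat linear_unflat simp: n f)
  then show ?thesis by (simp add: adet_def)
qed

lemma adet_pos:
  fixes L :: "complex^'n::finite \<Rightarrow> complex^'n"
  assumes "linear L" "linear M" "L \<circ> M = (\<lambda>x. x)"
  shows "adet L > 0"
proof -
  have "adet L * adet M = 1" using assms adet_comp adet_id by metis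
  then have "adet L \<noteq> 0" by auto
  then show ?thesis using adet_nonneg[of L] by simp
qed

lemma adet_real_diagonal:
  fixes c :: "'n::finite \<Rightarrow> real"
  shows "adet (\<lambda>z. \<chi> i. of_real (c i) * z $ i) = (\<Prod>i\<in>UNIV. (c i)\<^sup>2)"
proof -
  let ?L = "\<lambda>z::complex^'n. \<chi> i. of_real (c i) * z $ i"
  \<comment> \<open>\<open>cbasis\<close> is an unspecified enumeration, so the diagonal entry is
    recovered from the basis vector itself and not from its index.\<close>
  define d where "d b = (THE r. \<exists>i. (b = axis i 1 \<or> b = axis i \<i>) \<and> r = c i)" for b :: "complex^'n"
  have d: "d (axis i 1) = c i" "d (axis i \<i>) = c i" for i
    unfolding d_def by (rule the_equality; auto simp: axis_eq_axis)+
  have Basis_eq: "(Basis :: (complex^'n) set) = range (\<lambda>i. axis i 1) \<union> range (\<lambda>i. axis i \<i>)"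
    by (auto simp: Basis_vec_def Basis_complex_def)
  have Lb: "?L b = d b *\<^sub>R b" if "b \<in> Basis" for b
    using that unfolding Basis_eq by (elim UnE imageE; simp only: d) (auto simp: vec_eq_iff axis_def complex_eq_iff)
  have M: "matrix (flat \<circ> ?L \<circ> unflat) $ i $ j = (if i = j then d (cbasis j) else 0)" for i j :: "'n bit0"
  proof -
    have "unflat (axis j 1) = (cbasis j :: complex^'n)"
      by (simp add: unflat_def axis_def if_distrib[of "\<lambda>x. x *\<^sub>R _"] cong: if_cong)
    then show ?thesis
      by (simp add: matrix_def Lb flat_def cbasis_inner)
  qed
  have "det (matrix (flat \<circ> ?L \<circ> unflat)) = (\<Prod>i\<in>UNIV. d (cbasis i :: complex^'n))"
    by (subst det_diagonal) (auto simp: M)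
  also have "\<dots> = (\<Prod>b\<in>Basis. d b)"
    by (rule prod.reindex_bij_betw[OF bij_cbasis])
  also have "\<dots> = (\<Prod>i\<in>UNIV. c i) * (\<Prod>i\<in>UNIV. c i)"
    unfolding Basis_eq
    by (subst prod.union_disjoint)
       (auto simp: axis_eq_axis prod.reindex inj_on_def d)
  finally show ?thesis
    by (simp add: adet_def prod_power_distrib power2_eq_square abs_mult prod.distrib)
qed

text \<open>Polar form of each entry: the phases together are an isometry, which leaves the case of
  real entries. A zero entry gets the phase 1, so that the phases stay unimodular.\<close>

lemma adet_diagonal:
  fixes c :: "'n::finite \<Rightarrow> complex"
  shows "adet (\<lambda>z. \<chi> i. c i * z $ i) = (\<Prod>i\<in>UNIV. (cmod (c i))\<^sup>2)"
proof -
  define u where "u i = (if c i = 0 then 1 else c i / cmod (c i))" for i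
  have u: "cmod (u i) = 1" "c i = of_real (cmod (c i)) * u i" for i
    by (auto simp: u_def norm_divide)
  let ?U = "\<lambda>z::complex^'n. \<chi> i. u i * z $ i"
  let ?R = "\<lambda>z::complex^'n. \<chi> i. of_real (cmod (c i)) * z $ i"
  have lin: "linear (\<lambda>z::complex^'n. \<chi> i. a i * z $ i)" for a
    by (rule linearI) (auto simp: vec_eq_iff algebra_simps)
  have "(\<lambda>z. \<chi> i. c i * z $ i) = ?R \<circ> ?U"
    by (auto simp: fun_eq_iff vec_eq_iff) (metis mult.assoc u(2))
  moreover have "adet ?U = 1"
    by (rule adet_isometry[OF lin]) (simp add: norm_vec_def norm_mult u)
  ultimately show ?thesis
    by (simp add: adet_comp[OF lin lin] adet_real_diagonal)
qed

text \<open>The statement is an equality of two measures: the image under g of Lebesgue measure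
  weighted by the Jacobian, and Lebesgue measure restricted to \<open>D'\<close>. They are compared
  on bounded Borel subsets of \<open>D'\<close> through the volume of an injective differentiable
  image.\<close>

theorem nn_integral_change_of_variables:
  fixes g :: "complex^'n::finite \<Rightarrow> complex^'n" and f :: "complex^'n \<Rightarrow> ennreal"
  assumes D: "open D" "open D'" "bij_betw g D D'"
    and der: "\<And>x. x \<in> D \<Longrightarrow> (g has_derivative g' x) (at x)"
    and a: "continuous_on D a" "\<And>x. x \<in> D \<Longrightarrow> adet (g' x) = a x"
    and f: "f \<in> borel_measurable borel"
  shows "(\<integral>\<^sup>+y. f y * indicator D' y \<partial>lborel) = (\<integral>\<^sup>+x. f (g x) * a x * indicator D x \<partial>lborel)"
proof -
  note f[measurable]
  have [measurable]: "D \<in> sets borel" "D' \<in> sets borel" using D by auto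
  have cg: "continuous_on D g"
    using der D(1) by (meson continuous_at_imp_continuous_on has_derivative_continuous)
  have inj: "inj_on g D" and im: "g ` D = D'" using D(3) by (auto simp: bij_betw_def)
  define g0 where "g0 x = (if x \<in> D then g x else 0)" for x
  define a0 where "a0 x = (if x \<in> D then a x else 0)" for x
  have g0[measurable]: "g0 \<in> borel_measurable borel"
    unfolding g0_def by (intro borel_measurable_continuous_on_if) (auto simp: D cg)
  have a0[measurable]: "a0 \<in> borel_measurable borel"
    unfolding a0_def by (intro borel_measurable_continuous_on_if) (auto simp: D a)
  have a0_nonneg: "a0 x \<ge> 0" for x
    using adet_nonneg a(2)[of x] by (metis a0_def order_refl)
  define M1 where "M1 = distr (density lborel (\<lambda>x. ennreal (a0 x))) borel g0"
  define M2 :: "(complex^'n) measure" where "M2 = density lborel (indicator D')"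
  \<comment> \<open>Boundedness makes the volume finite, as the theorem on images of differentiable
    maps requires.\<close>
  have bdd: "emeasure M1 B = emeasure M2 B"
    if B[measurable]: "B \<in> sets borel" "bounded B" "B \<subseteq> D'" for B
  proof -
    define A where "A = g0 -` B \<inter> D"
    have A[measurable]: "A \<in> sets borel"
      unfolding A_def by (auto intro!: sets.Int simp: measurable_sets_borel[OF g0] D)
    have gA: "g ` A = B" 
    proof
      show "g ` A \<subseteq> B" by (auto simp: A_def g0_def)
      show "B \<subseteq> g ` A"
      proof
        fix y assume "y \<in> B"
        then obtain x where "x \<in> D" "y = g x" using im \<open>B \<subseteq> D'\<close> by blast
        then show "y \<in> g ` A" using \<open>y \<in> B\<close> by (auto simp: A_def g0_def)
      qed
    qed
    define S where "S = flat ` A"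
    have fl: "flat ` C = unflat -` C" for C :: "(complex^'n) set"
    proof (intro set_eqI iffI)
      show "y \<in> flat ` C" if "y \<in> unflat -` C" for y
        using that by (metis flat_unflat imageI vimageD)
    qed auto
    have S: "S = unflat -` A" unfolding S_def by (rule fl)
    have [measurable]: "S \<in> sets borel" unfolding S by (rule measurable_sets_borel[OF measurable_unflat A])
    define G where "G = flat \<circ> g \<circ> unflat"
    have GS: "G ` S = unflat -` B"
      unfolding fl[symmetric] gA[symmetric] S_def G_def by (simp add: image_comp o_def)
    have GSm[measurable]: "G ` S \<in> sets borel" unfolding GS by (rule measurable_sets_borel[OF measurable_unflat B(1)])
    have em: "emeasure lborel (G ` S) = emeasure lborel B"
      unfolding GS by (subst lborel_unflat, subst emeasure_distr) auto
    have fin: "emeasure lborel B < \<infinity>" using emeasure_bounded_finite[OF \<open>bounded B\<close>] by simp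
    have lm: "G ` S \<in> lmeasurable"
      using fin em by (intro fmeasurableI) auto
    have "((\<lambda>x. \<bar>det (matrix (flat \<circ> g' (unflat x) \<circ> unflat))\<bar>) has_integral (measure lebesgue (G ` S))) S \<longleftrightarrow>
        G ` S \<in> lmeasurable \<and> measure lebesgue (G ` S) = measure lebesgue (G ` S)"
    proof (rule has_measure_differentiable_image[symmetric])
      show "S \<in> sets lebesgue" by simp
      show "(G has_derivative flat \<circ> g' (unflat x) \<circ> unflat) (at x within S)" if "x \<in> S" for x
      proof -
        have "unflat x \<in> D" using that by (auto simp: S A_def)
        then have 1: "(g has_derivative g' (unflat x)) (at (unflat x))" by (rule der)
        have 2: "(unflat has_derivative unflat) (at x)"
          by (rule linear_imp_has_derivative[OF linear_unflat])
        have 3: "(flat has_derivative flat) (at (g (unflat x)))"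
          by (rule linear_imp_has_derivative[OF linear_flat])
        have "(flat \<circ> (g \<circ> unflat) has_derivative flat \<circ> (g' (unflat x) \<circ> unflat)) (at x)"
          by (rule diff_chain_at[OF diff_chain_at[OF 2 1]]) (simp add: 3)
        then show ?thesis
          unfolding G_def by (simp add: o_assoc has_derivative_at_withinI)
      qed
      show "inj_on G S"
      proof (rule inj_onI)
        fix x y assume "x \<in> S" "y \<in> S" "G x = G y"
        then have "unflat x \<in> D" "unflat y \<in> D" "g (unflat x) = g (unflat y)"
          by (auto simp: G_def S A_def) (metis unflat_flat)
        then show "x = y" using inj by (metis flat_unflat inj_onD)
      qed
    qed
    then have hi: "((\<lambda>x. adet (g' (unflat x))) has_integral (measure lebesgue (G ` S))) S"
      using lm by (simp add: adet_def)
    have "emeasure M2 B = (\<integral>\<^sup>+x. indicator D' x * indicator B x \<partial>lborel)"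
      unfolding M2_def by (rule emeasure_density) auto
    also have "\<dots> = (\<integral>\<^sup>+x. indicator B x \<partial>lborel)"
      using \<open>B \<subseteq> D'\<close> by (intro nn_integral_cong) (auto split: split_indicator)
    also have "\<dots> = emeasure lborel B"
      by (rule nn_integral_indicator) simp
    also have "\<dots> = ennreal (measure lebesgue (G ` S))"
      using fin unfolding em[symmetric]
      by (subst emeasure_eq_ennreal_measure) (auto simp: top.not_eq_extremum)
    also have "\<dots> = (\<integral>\<^sup>+x. indicator S x * adet (g' (unflat x)) \<partial>lborel)"
      by (rule nn_integral_has_integral_lebesgue[symmetric], rule adet_nonneg, rule hi)
    also have "\<dots> = (\<integral>\<^sup>+x. ennreal (a0 (unflat x)) * indicator A (unflat x) \<partial>lborel)"
      by (rule nn_integral_cong) (auto simp: S A_def a0_def a indicator_def)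
    also have "\<dots> = (\<integral>\<^sup>+x. ennreal (a0 x) * indicator A x \<partial>lborel)"
      by (rule nn_integral_unflat[symmetric]) auto
    also have "\<dots> = (\<integral>\<^sup>+x. ennreal (a0 x) * indicator (g0 -` B) x \<partial>lborel)"
      by (rule nn_integral_cong) (auto simp: A_def a0_def indicator_def)
    also have "\<dots> = emeasure M1 B"
      unfolding M1_def
      by (subst emeasure_distr, simp, simp, subst emeasure_density) (auto simp: measurable_sets_borel[OF g0])
    finally show ?thesis by simp
  qed
  have eq: "M1 = M2"
  proof (rule measure_eqI)
    show "sets M1 = sets M2" by (simp add: M1_def M2_def)
    fix B assume "B \<in> sets M1"
    then have B[measurable]: "B \<in> sets borel" by (simp add: M1_def)
    have null: "emeasure M1 (B - D') = 0" "emeasure M2 (B - D') = 0"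
    proof -
      have "emeasure M1 (B - D') = (\<integral>\<^sup>+x. ennreal (a0 x) * indicator (g0 -` (B - D')) x \<partial>lborel)"
        unfolding M1_def
        by (subst emeasure_distr, simp, simp, subst emeasure_density) (auto simp: measurable_sets_borel[OF g0])
      also have "\<dots> = (\<integral>\<^sup>+x. 0 \<partial>(lborel :: (complex^'n) measure))"
        by (intro nn_integral_cong) (use im in \<open>auto simp: a0_def g0_def indicator_def\<close>)
      finally show "emeasure M1 (B - D') = 0" by simp
      have "emeasure M2 (B - D') = (\<integral>\<^sup>+x. indicator D' x * indicator (B - D') x \<partial>lborel)"
        unfolding M2_def by (rule emeasure_density) auto
      also have "\<dots> = (\<integral>\<^sup>+x. 0 \<partial>(lborel :: (complex^'n) measure))"
        by (intro nn_integral_cong) (auto split: split_indicator)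
      finally have "emeasure M2 (B - D') = (\<integral>\<^sup>+x. 0 \<partial>(lborel :: (complex^'n) measure))" .
      then show "emeasure M2 (B - D') = 0" by simp
    qed
    \<comment> \<open>Bounded sets exhaust the part inside \<open>D'\<close>; outside
      \<open>D'\<close> both measures vanish, because g maps D into \<open>D'\<close>.\<close>
    define C where "C n = B \<inter> D' \<inter> ball 0 (real n)" for n
    have C[measurable]: "C n \<in> sets borel" for n by (simp add: C_def)
    have inc: "incseq C" by (auto simp: C_def incseq_def)
    have UC: "(\<Union>n. C n) = B \<inter> D'" by (auto simp: C_def intro: reals_Archimedean2)
    have Ceq: "emeasure M1 (C n) = emeasure M2 (C n)" for n
      by (rule bdd) (auto simp: C_def intro: bounded_subset[OF bounded_ball])
    have "emeasure M1 (\<Union>n. C n) = (SUP n. emeasure M1 (C n))"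
      using inc by (intro SUP_emeasure_incseq[symmetric]) (auto simp: M1_def C)
    also have "\<dots> = (SUP n. emeasure M2 (C n))" by (simp add: Ceq)
    also have "\<dots> = emeasure M2 (\<Union>n. C n)"
      using inc by (intro SUP_emeasure_incseq) (auto simp: M2_def C)
    finally have i: "emeasure M1 (B \<inter> D') = emeasure M2 (B \<inter> D')" by (simp add: UC)
    have "emeasure M (B \<inter> D') + emeasure M (B - D') = emeasure M B" if "sets M = sets borel" for M
      by (subst plus_emeasure) (auto simp: that intro!: arg_cong[where f = "emeasure M"])
    then show "emeasure M1 B = emeasure M2 B"
      using i null by (metis M1_def M2_def sets_density sets_distr sets_lborel)
  qed
  have "(\<integral>\<^sup>+y. f y * indicator D' y \<partial>lborel) = (\<integral>\<^sup>+y. f y \<partial>M2)"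
    unfolding M2_def by (subst nn_integral_density) (auto simp: mult.commute)
  also have "\<dots> = (\<integral>\<^sup>+x. f (g0 x) \<partial>(density lborel (\<lambda>x. ennreal (a0 x))))"
    unfolding eq[symmetric] M1_def by (subst nn_integral_distr) auto
  also have "\<dots> = (\<integral>\<^sup>+x. ennreal (a0 x) * f (g0 x) \<partial>lborel)"
    by (subst nn_integral_density) auto
  also have "\<dots> = (\<integral>\<^sup>+x. f (g x) * a x * indicator D x \<partial>lborel)"
    by (intro nn_integral_cong) (auto simp: a0_def g0_def indicator_def mult.commute)
  finally show ?thesis .
qed

section \<open>Complex matrices\<close>

definition herm :: "complex^'n::finite \<Rightarrow> complex^'n \<Rightarrow> complex" where
  "herm x y = (\<Sum>i\<in>UNIV. x $ i * cnj (y $ i))"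

definition adj :: "complex^'n^'m \<Rightarrow> complex^'m^'n" where
  "adj A = transpose (conj_mat A)"

lemma conj_mat_nth [simp]: "conj_mat A $ i $ j = cnj (A $ i $ j)"
  by (simp add: conj_mat_def)

lemma adj_nth [simp]: "adj A $ i $ j = cnj (A $ j $ i)"
  by (simp add: adj_def transpose_def)

lemma conj_mat_mult: "conj_mat (A ** B) = conj_mat A ** conj_mat B"
  by (simp add: vec_eq_iff matrix_matrix_mult_def cnj_sum)

lemma conj_mat_conj [simp]: "conj_mat (conj_mat A) = A"
  by (simp add: vec_eq_iff)

lemma conj_mat_one [simp]: "conj_mat (mat 1) = mat 1"
  by (simp add: vec_eq_iff mat_def)

lemma conj_mat_add: "conj_mat (A + B) = conj_mat A + conj_mat B"
  by (simp add: vec_eq_iff)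

lemma conj_mat_diff: "conj_mat (A - B) = conj_mat A - conj_mat B"
  by (simp add: vec_eq_iff)

lemma conj_mat_minus: "conj_mat (- A) = - conj_mat A"
  by (simp add: vec_eq_iff)

lemma conj_mat_transpose: "conj_mat (transpose A) = transpose (conj_mat A)"
  by (simp add: vec_eq_iff transpose_def)

lemma det_conj_mat: "det (conj_mat A) = cnj (det A)"
  by (simp add: det_def cnj_sum cnj_prod)

lemma adj_mult: "adj (A ** B) = adj B ** adj A"
  by (simp add: adj_def conj_mat_mult matrix_transpose_mul)

lemma adj_adj [simp]: "adj (adj A) = A"
  by (simp add: vec_eq_iff)

lemma adj_one [simp]: "adj (mat 1) = mat 1"
  by (simp add: vec_eq_iff mat_def)

lemma det_adj: "det (adj A) = cnj (det A)"
  by (simp add: adj_def det_conj_mat)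

lemma adj_symmetric: "transpose Z = Z \<Longrightarrow> adj Z = conj_mat Z"
  by (simp add: adj_def conj_mat_transpose[symmetric])

lemma herm_self: "herm x x = of_real ((norm x)\<^sup>2)"
  unfolding herm_def norm_vec_def L2_set_def
  by (simp add: sum_nonneg complex_norm_square del: of_real_power)

lemma Re_herm: "Re (herm x y) = x \<bullet> y"
  by (simp add: herm_def inner_vec_def inner_complex_def)

lemma herm_commute: "herm y x = cnj (herm x y)"
  by (simp add: herm_def mult.commute)

lemma herm_diff_left: "herm (x - y) z = herm x z - herm y z"
  by (simp add: herm_def left_diff_distrib sum_subtractf)

lemma herm_add_left: "herm (x + y) z = herm x z + herm y z"
  by (simp add: herm_def distrib_right sum.distrib)

lemma herm_scale_left: "herm (c *s x) y = c * herm x y"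
  by (simp add: herm_def sum_distrib_left mult.assoc)

lemma herm_scale_right: "herm x (c *s y) = cnj c * herm x y"
  by (simp add: herm_def sum_distrib_left mult.left_commute)

lemma herm_adj: "herm (A *v x) y = herm x (adj A *v y)"
proof -
  have "herm (A *v x) y = (\<Sum>i\<in>UNIV. \<Sum>j\<in>UNIV. A $ i $ j * x $ j * cnj (y $ i))"
    by (simp add: herm_def matrix_vector_mult_def sum_distrib_right)
  also have "\<dots> = (\<Sum>j\<in>UNIV. \<Sum>i\<in>UNIV. A $ i $ j * x $ j * cnj (y $ i))"
    by (rule sum.swap)
  also have "\<dots> = herm x (adj A *v y)"
    by (simp add: herm_def matrix_vector_mult_def sum_distrib_left mult_ac)
  finally show ?thesis .
qed

text \<open>Multiplying x by a suitable phase makes the Hermitian product real and nonnegative,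
  where it is the real inner product and obeys the real Cauchy-Schwarz inequality.\<close>

lemma norm_herm_le: "cmod (herm x y) \<le> norm x * norm y"
proof (cases "herm x y = 0")
  case False
  define u where "u = cnj (herm x y) / cmod (herm x y)"
  have u: "cmod u = 1" using False by (simp add: u_def norm_divide)
  have nu: "norm (u *s x) = norm x"
    by (simp add: norm_vec_def norm_mult u)
  have "herm (u *s x) y = cmod (herm x y)"
    using False by (simp add: herm_scale_left u_def complex_norm_square[symmetric] power2_eq_square mult.commute)
  then have "cmod (herm x y) = (u *s x) \<bullet> y"
    by (metis Re_complex_of_real Re_herm)
  also have "\<dots> \<le> norm x * norm y" using norm_cauchy_schwarz[of "u *s x" y] nu by simp
  finally show ?thesis .
qed simp

text \<open>The norm of the matrix type is the Frobenius norm. This turns the traces in the Levi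
  form into squares.\<close>

lemma trace_adj_self: "trace (A ** adj A) = of_real ((norm A)\<^sup>2)"
proof -
  have "(norm A)\<^sup>2 = (\<Sum>i\<in>UNIV. \<Sum>j\<in>UNIV. (cmod (A $ i $ j))\<^sup>2)"
    unfolding norm_vec_def L2_set_def by (simp add: sum_nonneg)
  then show ?thesis
    by (simp add: trace_def matrix_matrix_mult_def complex_norm_square del: of_real_power)
qed

lemma norm_matrix_vector_le: "norm (A *v x) \<le> norm A * norm (x :: complex^'n::finite)"
proof -
  have "(norm (A *v x))\<^sup>2 = (\<Sum>i\<in>UNIV. (cmod ((A *v x) $ i))\<^sup>2)"
    unfolding norm_vec_def L2_set_def by (simp add: sum_nonneg)
  also have "\<dots> \<le> (\<Sum>i\<in>UNIV. (norm (A $ i) * norm x)\<^sup>2)"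
  proof (intro sum_mono power_mono)
    fix i
    have "(A *v x) $ i = herm (A $ i) (\<chi> j. cnj (x $ j))"
      by (simp add: matrix_vector_mult_def herm_def)
    moreover have "norm (\<chi> j. cnj (x $ j)) = norm x" by (simp add: norm_vec_def)
    ultimately show "cmod ((A *v x) $ i) \<le> norm (A $ i) * norm x"
      by (metis norm_herm_le)
  qed auto
  also have "\<dots> = (norm A * norm x)\<^sup>2"
    unfolding norm_vec_def[of A] L2_set_def
    by (simp add: sum_nonneg power_mult_distrib sum_distrib_right)
  finally show ?thesis by (rule power2_le_imp_le) simp
qed

lemma bounded_bilinear_matrix_mult:
  "bounded_bilinear ((**) :: complex^'n^'m \<Rightarrow> complex^'k^'n \<Rightarrow> complex^'k^'m)"
proof -
  have "bilinear ((**) :: complex^'n^'m \<Rightarrow> complex^'k^'n \<Rightarrow> complex^'k^'m)"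
    unfolding bilinear_def
    by (auto intro!: linearI simp: vec_eq_iff matrix_matrix_mult_def sum.distrib
        distrib_left distrib_right scaleR_sum_right)
  then show ?thesis by (simp add: bilinear_conv_bounded_bilinear)
qed

lemmas has_derivative_matrix_mult = bounded_bilinear.FDERIV[OF bounded_bilinear_matrix_mult]

lemma matrix_add_rdistrib: "(A + B) ** C = A ** C + B ** (C :: 'a::semiring_1^'n^'m)"
  by (simp add: vec_eq_iff matrix_matrix_mult_def distrib_right sum.distrib)

lemma matrix_sub_ldistrib: "A ** (B - C) = A ** B - A ** (C :: 'a::ring_1^'n^'m)"
  by (simp add: vec_eq_iff matrix_matrix_mult_def right_diff_distrib sum_subtractf)

lemma matrix_sub_rdistrib: "(A - B) ** C = A ** C - B ** (C :: 'a::ring_1^'n^'m)"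
  by (simp add: vec_eq_iff matrix_matrix_mult_def left_diff_distrib sum_subtractf)

lemma matrix_minus_left: "(- A) ** C = - (A ** (C :: 'a::ring_1^'n^'m))"
  by (simp add: vec_eq_iff matrix_matrix_mult_def sum_negf)

lemma matrix_minus_right: "A ** (- C) = - (A ** (C :: 'a::ring_1^'n^'m))"
  by (simp add: vec_eq_iff matrix_matrix_mult_def sum_negf)

lemma transpose_add: "transpose (A + B) = transpose A + transpose B"
  by (simp add: vec_eq_iff transpose_def)

lemma transpose_diff: "transpose (A - B) = transpose A - transpose B"
  by (simp add: vec_eq_iff transpose_def)

lemma transpose_minus: "transpose (- A) = - transpose A"
  by (simp add: vec_eq_iff transpose_def)

lemmas matrix_ring = matrix_add_ldistrib matrix_add_rdistrib matrix_sub_ldistrib matrix_sub_rdistrib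
  matrix_minus_left matrix_minus_right matrix_mul_assoc

subsection \<open>Contractions\<close>

text \<open>Operator norm below 1. In this form openness, convexity and invariance under Moebius
  maps are statements about vectors.\<close>

definition contr :: "complex^'n::finite^'n \<Rightarrow> bool" where
  "contr Z \<longleftrightarrow> (\<forall>x. x \<noteq> 0 \<longrightarrow> norm (Z *v x) < norm x)"

lemma norm_conj_mat_mult: "norm (conj_mat Z *v x) = norm (Z *v (\<chi> j. cnj (x $ j)))"
proof -
  have "(conj_mat Z *v x) $ i = cnj ((Z *v (\<chi> j. cnj (x $ j))) $ i)" for i
    by (simp add: matrix_vector_mult_def cnj_sum)
  then show ?thesis by (simp add: norm_vec_def)
qed

lemma contr_conj: "contr Z \<Longrightarrow> contr (conj_mat Z)"
proof (unfold contr_def, intro allI impI)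
  fix x :: "complex^'a"
  assume Z: "\<forall>x. x \<noteq> 0 \<longrightarrow> norm (Z *v x) < norm x" and "x \<noteq> 0"
  then have "(\<chi> j. cnj (x $ j)) \<noteq> 0" by (auto simp: vec_eq_iff)
  then have "norm (Z *v (\<chi> j. cnj (x $ j))) < norm (\<chi> j. cnj (x $ j))" using Z by blast
  moreover have "norm (\<chi> j. cnj (x $ j)) = norm x" by (simp add: norm_vec_def)
  ultimately show "norm (conj_mat Z *v x) < norm x" by (simp add: norm_conj_mat_mult)
qed

lemma herm_one_minus:
  assumes "transpose Z = Z"
  shows "herm ((mat 1 - Z ** conj_mat Z) *v x) x = of_real ((norm x)\<^sup>2 - (norm (conj_mat Z *v x))\<^sup>2)"
proof -
  have "herm ((Z ** conj_mat Z) *v x) x = herm (conj_mat Z *v x) (conj_mat Z *v x)"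
    by (metis adj_symmetric assms herm_adj matrix_vector_mul_assoc)
  then show ?thesis
    by (simp add: matrix_vector_mult_diff_rdistrib herm_diff_left herm_self)
qed

text \<open>The quadratic form of \<open>I - Z conj(Z)\<close> at x is
  \<open>|x|^2 - |conj(Z) x|^2\<close>, so positivity means that \<open>conj(Z)\<close> is
  contractive; conjugating the vectors gives the same for Z.\<close>

lemma R_II_iff: "Z \<in> R_II \<longleftrightarrow> transpose Z = Z \<and> contr Z"
proof -
  have q: "(\<Sum>i\<in>UNIV. \<Sum>j\<in>UNIV. cnj (x $ i) * A $ i $ j * x $ j) = herm (A *v x) x"
    for A :: "complex^'a^'a" and x
    by (simp add: herm_def matrix_vector_mult_def sum_distrib_right sum_distrib_left mult_ac)
  have "pos_def (mat 1 - Z ** conj_mat Z) \<longleftrightarrow> contr Z" if "transpose Z = Z"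
  proof -
    have "pos_def (mat 1 - Z ** conj_mat Z) \<longleftrightarrow> (\<forall>x. x \<noteq> 0 \<longrightarrow> (norm (conj_mat Z *v x))\<^sup>2 < (norm x)\<^sup>2)"
      unfolding pos_def_def q Let_def herm_one_minus[OF that] by (simp del: of_real_diff)
    also have "\<dots> \<longleftrightarrow> contr (conj_mat Z)"
      unfolding contr_def by (metis norm_ge_zero power_less_imp_less_base power_strict_mono zero_less_numeral)
    also have "\<dots> \<longleftrightarrow> contr Z" using contr_conj[of Z] contr_conj[of "conj_mat Z"] by auto
    finally show ?thesis .
  qed
  then show ?thesis by (auto simp: R_II_def)
qed

lemma contr_le: "contr Z \<Longrightarrow> norm (Z *v x) \<le> norm x"
  by (cases "x = 0") (auto simp: contr_def less_imp_le)

lemma det_nonzero_iff_ker: "det A \<noteq> 0 \<longleftrightarrow> (\<forall>x. A *v x = 0 \<longrightarrow> x = (0 :: 'a::field^'n))"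
  by (metis invertible_det_nz invertible_left_inverse matrix_left_invertible_ker)

text \<open>Gram--Schmidt for the inner product \<open>x\<^sup>* M y\<close>.\<close>

lemma posdef_factor:
  fixes M :: "complex^'n::finite^'n"
  assumes M: "adj M = M" and pos: "\<And>x. x \<noteq> 0 \<Longrightarrow> Re (herm (M *v x) x) > 0"
  obtains A :: "complex^'n^'n" where "A ** M ** adj A = mat 1"
proof -
  define B where "B x y = herm (M *v x) y" for x y
  have Bsym: "B y x = cnj (B x y)" for x y
    unfolding B_def by (metis M herm_adj herm_commute)
  have Bscale: "B (c *s x) y = c * B x y" "B x (c *s y) = cnj c * B x y" for c x y
    unfolding B_def by (simp_all add: vector_scalar_commute herm_scale_left herm_scale_right)
  have ex: "\<exists>a. \<forall>i\<in>S. \<forall>j\<in>S. B (a i) (a j) = (if i = j then 1 else 0)" if "finite S" for S :: "'n set"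
    using that
  proof (induction S rule: finite_induct)
    case (insert k S)
    then obtain a where a: "\<forall>i\<in>S. \<forall>j\<in>S. B (a i) (a j) = (if i = j then 1 else 0)" by blast
    \<comment> \<open>The row of R with the new index k is zero, so \<open>R ** M\<close> is
      singular; a kernel vector is orthogonal, for the form B, to all vectors already
      chosen.\<close>
    define R where "R = ((\<chi> j l. if j \<in> S then cnj (a j $ l) else 0) :: complex^'n^'n)"
    have "row k R = 0" using insert by (simp add: R_def row_def vec_eq_iff)
    then have "det (R ** M) = 0" by (simp add: det_mul det_zero_row(2))
    then obtain x where x: "(R ** M) *v x = 0" "x \<noteq> 0" using det_nonzero_iff_ker by blast
    have Bx: "B x (a j) = 0" if "j \<in> S" for j
    proof -
      have "(R *v (M *v x)) $ j = 0" using x by (simp add: matrix_vector_mul_assoc)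
      then show ?thesis using that
        unfolding matrix_vector_mult_def[of R]
        by (simp add: B_def herm_def R_def mult.commute)
    qed
    define c where "c = Re (B x x)"
    have c: "c > 0" using pos[OF x(2)] by (simp add: c_def B_def)
    have Bxx: "B x x = of_real c"
      using Bsym[of x x] by (simp add: c_def complex_eq_iff)
    define y where "y = of_real (1 / sqrt c) *s x"
    have yy: "B y y = 1"
      using c by (simp add: y_def Bscale Bxx field_simps flip: of_real_mult)
    have ya: "B y (a j) = 0" "B (a j) y = 0" if "j \<in> S" for j
      using Bx[OF that] Bsym[of x "a j"] by (simp_all add: y_def Bscale)
    show ?case
      by (rule exI[of _ "a(k := y)"]) (use a yy ya insert(2) in auto)
  qed (auto)
  obtain a :: "'n \<Rightarrow> complex^'n" where a: "\<forall>i j. B (a i) (a j) = (if i = j then 1 else 0)"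
    using ex[OF finite[of UNIV]] by auto
  define A where "A = ((\<chi> i k. cnj (a i $ k)) :: complex^'n^'n)"
  have "(A ** M ** adj A) $ i $ j = B (a j) (a i)" for i j
    unfolding A_def B_def herm_def matrix_mul_assoc[symmetric]
    by (simp add: matrix_matrix_mult_def matrix_vector_mult_def mult.commute)
  then have "A ** M ** adj A = mat 1" using a by (simp add: vec_eq_iff mat_def)
  then show ?thesis by (rule that)
qed

lemma one_minus_factor:
  fixes Z :: "complex^'n::finite^'n"
  assumes "transpose Z = Z" "contr Z"
  obtains A :: "complex^'n^'n" where "A ** (mat 1 - Z ** conj_mat Z) ** adj A = mat 1"
proof (rule posdef_factor[of "mat 1 - Z ** conj_mat Z"])
  have "adj (A - B) = adj A - adj B" for A B :: "complex^'n^'n" by (simp add: vec_eq_iff)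
  moreover have "adj (conj_mat Z) = Z"
    using adj_symmetric[OF assms(1)] by (metis adj_adj)
  ultimately show "adj (mat 1 - Z ** conj_mat Z) = mat 1 - Z ** conj_mat Z"
    by (simp add: adj_mult adj_symmetric[OF assms(1)])
  show "Re (herm ((mat 1 - Z ** conj_mat Z) *v x) x) > 0" if "x \<noteq> 0" for x
  proof -
    have "norm (conj_mat Z *v x) < norm x" using contr_conj[OF assms(2)] that by (simp add: contr_def)
    then have "(norm (conj_mat Z *v x))\<^sup>2 < (norm x)\<^sup>2" by (simp add: power_strict_mono)
    then show ?thesis by (simp only: herm_one_minus[OF assms(1)] Re_complex_of_real)
  qed
qed blast

subsection \<open>The derivatives of the determinant and of the inverse\<close>

text \<open>In the Leibniz formula a permutation other than the identity moves at least two indices.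
  After differentiating one factor another off-diagonal entry of the identity remains, so only the
  identity permutation contributes.\<close>

lemma det_has_derivative_one: "(det has_derivative trace) (at (mat 1 :: complex^'n::finite^'n))"
proof -
  let ?P = "{p. p permutes (UNIV :: 'n set)}"
  have "(det has_derivative
      (\<lambda>X. \<Sum>p\<in>?P. of_int (sign p) * (\<Sum>i\<in>UNIV. X $ i $ p i * (\<Prod>j\<in>UNIV - {i}. (mat 1 :: complex^'n^'n) $ j $ p j))))
      (at (mat 1 :: complex^'n^'n))"
    unfolding det_def[abs_def]
    by (intro has_derivative_sum has_derivative_mult_right has_derivative_prod
        bounded_linear_imp_has_derivative)
       (intro bounded_linear_compose[OF bounded_linear_vec_nth bounded_linear_vec_nth])
  moreover have "(\<Sum>p\<in>?P. of_int (sign p) * (\<Sum>i\<in>UNIV. X $ i $ p i * (\<Prod>j\<in>UNIV - {i}. (mat 1 :: complex^'n^'n) $ j $ p j)))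
      = trace X" for X
  proof -
    have 0: "of_int (sign p) * (\<Sum>i\<in>UNIV. X $ i $ p i * (\<Prod>j\<in>UNIV - {i}. (mat 1 :: complex^'n^'n) $ j $ p j)) = 0"
      if p: "p \<in> ?P - {id}" for p
    proof -
      obtain k where k: "p k \<noteq> k" using p by (auto simp: fun_eq_iff)
      have inj: "inj p" using p by (auto simp: permutes_inj)
      have z: "(\<Prod>j\<in>UNIV - {i}. (mat 1 :: complex^'n^'n) $ j $ p j) = 0" for i
      proof -
        have "\<exists>j. j \<noteq> i \<and> p j \<noteq> j"
        proof (cases "k = i")
          case True
          then show ?thesis using k inj by (metis injD)
        qed (use k in auto)
        then obtain j where "j \<in> UNIV - {i}" "p j \<noteq> j" by auto
        then show ?thesis by (intro prod_zero) (auto simp: mat_def intro!: bexI[of _ j])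
      qed
      show ?thesis unfolding z by simp
    qed
    have "(\<Sum>p\<in>?P. of_int (sign p) * (\<Sum>i\<in>UNIV. X $ i $ p i * (\<Prod>j\<in>UNIV - {i}. (mat 1 :: complex^'n^'n) $ j $ p j)))
        = (\<Sum>p\<in>{id}. of_int (sign p) * (\<Sum>i\<in>UNIV. X $ i $ p i * (\<Prod>j\<in>UNIV - {i}. (mat 1 :: complex^'n^'n) $ j $ p j)))"
      by (rule sum.mono_neutral_right) (use 0 in \<open>auto simp: permutes_id finite_permutations\<close>)
    also have "\<dots> = trace X" by (simp add: trace_def mat_def)
    finally show ?thesis .
  qed
  ultimately show ?thesis by (simp add: fun_eq_iff[symmetric])
qed

lemma det_has_derivative:
  fixes A B :: "complex^'n::finite^'n"
  assumes "A ** B = mat 1"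
  shows "(det has_derivative (\<lambda>X. det A * trace (B ** X))) (at A)"
proof -
  have BA: "B ** A = mat 1" using assms by (simp add: matrix_left_right_inverse)
  have lin: "((\<lambda>X. B ** X) has_derivative (\<lambda>X. B ** X)) (at A)"
    by (intro bounded_linear_imp_has_derivative bounded_bilinear.bounded_linear_right bounded_bilinear_matrix_mult)
  have "((\<lambda>X. det (B ** X)) has_derivative (\<lambda>X. trace (B ** X))) (at A)"
    using has_derivative_compose[OF lin, of det trace] det_has_derivative_one by (simp add: BA)
  then have "((\<lambda>X. det A * det (B ** X)) has_derivative (\<lambda>X. det A * trace (B ** X))) (at A)"
    by (rule has_derivative_mult_right)
  moreover have "det A * det (B ** X) = det X" for X
    using assms by (metis det_I det_mul mult.assoc mult_1)
  ultimately show ?thesis by simp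
qed

lemma matrix_inv_mult:
  fixes A :: "complex^'n::finite^'n"
  assumes "det A \<noteq> 0"
  shows "A ** matrix_inv A = mat 1" "matrix_inv A ** A = mat 1"
proof -
  obtain B where "A ** B = mat 1 \<and> B ** A = mat 1"
    using assms invertible_det_nz[of A] by (auto simp: invertible_def)
  then have "A ** matrix_inv A = mat 1 \<and> matrix_inv A ** A = mat 1"
    unfolding matrix_inv_def by (rule someI)
  then show "A ** matrix_inv A = mat 1" "matrix_inv A ** A = mat 1" by auto
qed

lemma matrix_inv_unique:
  fixes A B :: "complex^'n::finite^'n"
  assumes "A ** B = mat 1"
  shows "matrix_inv A = B"
proof -
  have "det A \<noteq> 0" using assms by (metis det_I det_mul mult_zero_left one_neq_zero)
  then show ?thesis
    using assms matrix_inv_mult by (metis matrix_mul_assoc matrix_mul_lid matrix_mul_rid)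
qed

text \<open>With V the inverse of Y, B that of A and \<open>H = Y - A\<close>, the identity
  \<open>V - B = - V H B\<close> used twice leaves the remainder \<open>V H B H B\<close>, which is
  quadratic in H as soon as V is bounded near A.\<close>

lemma matrix_inv_has_derivative:
  fixes A :: "complex^'n::finite^'n"
  assumes "det A \<noteq> 0"
  shows "(matrix_inv has_derivative (\<lambda>X. - (matrix_inv A ** X ** matrix_inv A))) (at A)"
proof -
  interpret m: bounded_bilinear "(**) :: complex^'n^'n \<Rightarrow> complex^'n^'n \<Rightarrow> complex^'n^'n"
    by (rule bounded_bilinear_matrix_mult)
  obtain C where "0 < C \<and> (\<forall>(A :: complex^'n^'n) (B :: complex^'n^'n). norm (A ** B) \<le> norm A * norm B * C)"
    using m.pos_bounded ..
  then have C: "C > 0" "\<And>(A :: complex^'n^'n) (B :: complex^'n^'n). norm (A ** B) \<le> norm A * norm B * C"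
    by auto
  define B where "B = matrix_inv A"
  have AB: "A ** B = mat 1" "B ** A = mat 1" unfolding B_def using assms by (auto simp: matrix_inv_mult)
  have cont: "continuous (at A) det"
    using det_has_derivative[OF AB(1)] has_derivative_continuous by blast
  have "\<forall>\<^sub>F Y in at A. det Y \<noteq> 0"
    using cont assms by (intro tendsto_imp_eventually_ne[of det "det A"]) (auto simp: continuous_within)
  \<comment> \<open>Chosen so that \<open>norm H * norm B * C^2 <= 1/2\<close>, which gives
    \<open>norm V <= 2 * norm B\<close>. C bounds the matrix product, and the added 1 keeps the
    denominator positive.\<close>
  moreover define e0 where "e0 = 1 / (2 * C\<^sup>2 * (norm B + 1))"
  have e0: "e0 > 0" using C by (simp add: e0_def add_nonneg_pos)
  ultimately obtain e1 where e1: "e1 > 0" "\<And>Y. Y \<noteq> A \<Longrightarrow> dist Y A < e1 \<Longrightarrow> det Y \<noteq> 0"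
    by (auto simp: eventually_at)
  define e where "e = min e0 e1"
  have e: "e > 0" "e \<le> e0" "e \<le> e1" using e0 e1 by (auto simp: e_def)
  have main: "norm (matrix_inv Y - B + B ** (Y - A) ** B) \<le> (C^4 * 2 * norm B ^ 3) * (norm (Y - A))\<^sup>2"
    if Y: "Y \<noteq> A" "dist Y A < e" for Y
  proof -
    define V where "V = matrix_inv Y"
    define H where "H = Y - A"
    have dY: "det Y \<noteq> 0" using e1 e Y by auto
    have V: "V ** Y = mat 1" unfolding V_def using dY by (simp add: matrix_inv_mult)
    have VB: "V - B = - (V ** H ** B)"
      unfolding H_def using V AB by (simp add: matrix_ring) (simp add: matrix_mul_assoc[symmetric] AB)
    have nn: "norm (V ** H ** B) \<le> norm V * norm H * norm B * C\<^sup>2"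
    proof -
      have "norm (V ** H ** B) \<le> norm (V ** H) * norm B * C" by (rule C)
      also have "\<dots> \<le> (norm V * norm H * C) * norm B * C"
        using C by (intro mult_right_mono) auto
      finally show ?thesis by (simp add: power2_eq_square mult_ac)
    qed
    have small: "norm H * norm B * C\<^sup>2 \<le> 1/2"
    proof -
      have "norm H \<le> e0" using Y e by (simp add: H_def dist_norm)
      then have "norm H * norm B * C\<^sup>2 \<le> e0 * (norm B + 1) * C\<^sup>2"
        using C e0 by (intro mult_right_mono mult_mono) auto
      also have "\<dots> = 1/2"
      proof -
        have "norm B + 1 > 0" by (simp add: add_nonneg_pos)
        then show ?thesis unfolding e0_def using C(1) by (simp only: field_simps) simp
      qed
      finally show ?thesis .
    qed
    have V2: "norm V \<le> 2 * norm B"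
    proof -
      have "norm V \<le> norm B + norm (V - B)" by (metis add.commute diff_add_cancel norm_triangle_ineq)
      also have "norm (V - B) \<le> norm V * (norm H * norm B * C\<^sup>2)" using nn VB by (simp add: mult_ac)
      also have "\<dots> \<le> norm V * (1/2)" by (intro mult_left_mono small) auto
      finally show ?thesis by simp
    qed
    have "V - B + B ** H ** B = V ** H ** B ** H ** B"
    proof -
      have "B - V = V ** H ** B" using VB by (simp add: algebra_simps)
      then have "V ** H ** B ** H ** B = (B - V) ** H ** B" by simp
      also have "\<dots> = B ** H ** B - V ** H ** B" by (simp add: matrix_ring)
      also have "\<dots> = V - B + B ** H ** B" using VB by (simp add: algebra_simps)
      finally show ?thesis by simp
    qed
    then have "norm (V - B + B ** H ** B) = norm (V ** H ** (B ** H ** B))"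
      by (simp add: matrix_mul_assoc)
    also have "\<dots> \<le> norm (V ** H) * norm (B ** H ** B) * C" by (rule C)
    also have "\<dots> \<le> (norm V * norm H * C) * ((norm B * norm H * C) * norm B * C) * C"
    proof -
      have "norm (B ** H ** B) \<le> norm (B ** H) * norm B * C" by (rule C)
      also have "\<dots> \<le> (norm B * norm H * C) * norm B * C" using C by (intro mult_right_mono) auto
      finally show ?thesis using C by (intro mult_right_mono mult_mono) auto
    qed
    also have "\<dots> \<le> ((2 * norm B) * norm H * C) * ((norm B * norm H * C) * norm B * C) * C"
      using C V2 by (intro mult_right_mono) auto
    also have "\<dots> = (C^4 * 2 * norm B ^ 3) * (norm H)\<^sup>2"
      by (simp add: power2_eq_square power3_eq_cube power4_eq_xxxx)
    finally show ?thesis by (simp add: V_def H_def)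
  qed
  show ?thesis unfolding B_def[symmetric]
  proof (rule has_derivativeI_sandwich[where e = e])
    show "bounded_linear (\<lambda>X. - (B ** X ** B))"
      by (intro bounded_linear_minus bounded_linear_compose[OF m.bounded_linear_left m.bounded_linear_right])
    show "((\<lambda>Y. (C^4 * 2 * norm B ^ 3) * norm (Y - A)) \<longlongrightarrow> 0) (at A)"
      by (auto intro!: tendsto_eq_intros)
    fix Y assume "Y \<noteq> A" "dist Y A < e"
    then show "norm (matrix_inv Y - matrix_inv A - - (B ** (Y - A) ** B)) / norm (Y - A)
        \<le> (C^4 * 2 * norm B ^ 3) * norm (Y - A)"
      using main[of Y] by (simp add: divide_le_eq power2_eq_square B_def mult_ac)
  qed (use e in auto)
qed

subsection \<open>Generation of the general linear group\<close>

text \<open>Gaussian elimination as an induction principle for the general linear group. The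
  induction is over the set K of indices outside which A is already diagonal. It serves to evaluate
  multiplicative functions of a matrix.\<close>

lemma det_nonzero_induct:
  fixes A :: "'a::field^'n::finite^'n"
  assumes mult: "\<And>A B. P A \<Longrightarrow> P B \<Longrightarrow> P (A ** B)"
    and diag: "\<And>A. (\<And>i j. i \<noteq> j \<Longrightarrow> A $ i $ j = 0) \<Longrightarrow> det A \<noteq> 0 \<Longrightarrow> P A"
    and col: "\<And>k u. u k = 0 \<Longrightarrow> P (\<chi> i j. (if i = j then 1 else 0) + (if j = k then u i else 0))"
    and row: "\<And>k u. u k = 0 \<Longrightarrow> P (\<chi> i j. (if i = j then 1 else 0) + (if i = k then u j else 0))"
    and A: "det A \<noteq> 0"
  shows "P A"
proof -
  have gen: "P A" if "finite K" "det A \<noteq> 0" "\<And>i j. i \<noteq> j \<Longrightarrow> i \<notin> K \<or> j \<notin> K \<Longrightarrow> A $ i $ j = 0" for K and A :: "'a^'n^'n"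
    using that
  proof (induction K arbitrary: A rule: finite_induct)
    case empty
    then show ?case by (intro diag) auto
  next
    case (insert k K)
    define C where "C k u = ((\<chi> i j. (if i = j then 1 else 0) + (if j = k then u i else 0)) :: 'a^'n^'n)" for k u
    define R where "R k u = ((\<chi> i j. (if i = j then 1 else 0) + (if i = k then u j else 0)) :: 'a^'n^'n)" for k u
    have CM: "(C k u ** B) $ i $ j = B $ i $ j + u i * B $ k $ j" for k u B i j
      by (simp add: C_def matrix_matrix_mult_def distrib_right sum.distrib if_distrib[of "\<lambda>x. x * _"] cong: if_cong)
    have MR: "(B ** R k u) $ i $ j = B $ i $ j + B $ i $ k * u j" for k u B i j
      by (simp add: R_def matrix_matrix_mult_def distrib_left sum.distrib if_distrib[of "\<lambda>x. _ * x"] cong: if_cong)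
    have MC: "(B ** C k u) $ i $ j = B $ i $ j + (if j = k then (\<Sum>l\<in>UNIV. B $ i $ l * u l) else 0)" for k u B i j
      by (simp add: C_def matrix_matrix_mult_def distrib_left sum.distrib if_distrib[of "\<lambda>x. _ * x"] cong: if_cong)
    \<comment> \<open>A nonzero pivot is split off by one column and one row transvection; B
      contains the Schur complement.\<close>
    have pivot: "P A" if kk: "A $ k $ k \<noteq> 0" and dA: "det A \<noteq> 0"
      and pat: "\<And>i j. i \<noteq> j \<Longrightarrow> i \<notin> insert k K \<or> j \<notin> insert k K \<Longrightarrow> A $ i $ j = 0" for A :: "'a^'n^'n"
    proof -
      define u where "u i = (if i = k then 0 else A $ i $ k / A $ k $ k)" for i
      define v where "v j = (if j = k then 0 else A $ k $ j / A $ k $ k)" for j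
      define B :: "'a^'n^'n" where "B = (\<chi> i j. if i = k \<or> j = k then (if i = j then A $ k $ k else 0)
          else A $ i $ j - A $ i $ k * A $ k $ j / A $ k $ k)"
      have "(C k u ** B ** R k v) $ i $ j = A $ i $ j" for i j
        using kk by (cases "i = k"; cases "j = k") (auto simp: CM MR B_def u_def v_def)
      then have AB: "A = C k u ** B ** R k v" by (simp add: vec_eq_iff)
      then have "det B \<noteq> 0" using dA by (auto simp: det_mul)
      moreover have B0: "B $ i $ j = 0" if "i \<noteq> j" "i \<notin> K \<or> j \<notin> K" for i j
        using that pat[of i j] pat[of i k] pat[of k j] by (auto simp: B_def)
      ultimately have "P B" by (intro insert.IH) 
      moreover have "P (C k u)" "P (R k v)" unfolding C_def R_def by (auto intro!: col row simp: u_def v_def)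
      ultimately show ?thesis unfolding AB by (intro mult)
    qed
    show ?case
    proof (cases "A $ k $ k = 0")
      case False
      then show ?thesis using insert.prems by (intro pivot) auto
    next
      case True
      have "row k A \<noteq> 0" using insert.prems(1) det_zero_row(2) by blast
      then obtain l where l: "A $ k $ l \<noteq> 0" by (auto simp: row_def vec_eq_iff)
      then have lk: "l \<noteq> k" "l \<in> K" using True insert.prems(2)[of k l] by auto
      \<comment> \<open>A zero pivot is repaired by adding column l, which has a nonzero entry in
        row k, to column k.\<close>
      define u where "u i = (if i = l then (1::'a) else 0)" for i
      define A' where "A' = A ** C k u"
      have A': "A' $ i $ j = A $ i $ j + (if j = k then A $ i $ l else 0)" for i j
        unfolding A'_def MC u_def by (simp add: if_distrib[of "\<lambda>x. _ * x"] cong: if_cong)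
      have CC: "C k u ** C k (\<lambda>i. - u i) = mat 1"
        using lk by (simp add: vec_eq_iff CM mat_def) (auto simp: C_def u_def)
      have AA': "A = A' ** C k (\<lambda>i. - u i)"
        unfolding A'_def by (simp add: matrix_mul_assoc[symmetric] CC)
      then have "det A' \<noteq> 0" using insert.prems(1) by (metis det_mul mult_zero_left)
      then have "P A'"
      proof (rule pivot[rotated])
        show "A' $ k $ k \<noteq> 0" using True l by (simp add: A')
        show "A' $ i $ j = 0" if "i \<noteq> j" "i \<notin> insert k K \<or> j \<notin> insert k K" for i j
          using that lk insert.prems(2)[of i j] insert.prems(2)[of i l] by (auto simp: A')
      qed
      moreover have "P (C k (\<lambda>i. - u i))" unfolding C_def by (rule col) (use lk in \<open>simp add: u_def\<close>)
      ultimately show ?thesis unfolding AA' by (rule mult)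
    qed
  qed
  show ?thesis by (rule gen[of UNIV A]) (use A in auto)
qed

section \<open>Coordinates on \<open>\<complex>\<^sup>N\<close>\<close>

text \<open>An arbitrary ordering of each unordered pair. Symmetry of the matrices makes the entries
  read with it independent of the choice.\<close>

definition up1 :: "'a uprod \<Rightarrow> 'a" where "up1 a = (SOME k. \<exists>l. a = Upair k l)"
definition up2 :: "'a uprod \<Rightarrow> 'a" where "up2 a = (SOME l. a = Upair (up1 a) l)"

lemma Upair_up: "Upair (up1 a) (up2 a) = a"
proof -
  have "\<exists>k l. a = Upair k l" by (metis uprod_exhaust)
  then have "\<exists>l. a = Upair (up1 a) l" unfolding up1_def by (rule someI_ex)
  then have "a = Upair (up1 a) (up2 a)" unfolding up2_def by (rule someI_ex)
  then show ?thesis by simp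
qed

lemma Upair_swap: "Upair k l = Upair l k"
  by (simp add: Upair_inject)

lemma Upair_eq_cases: "Upair k l = a \<Longrightarrow> (k = up1 a \<and> l = up2 a) \<or> (k = up2 a \<and> l = up1 a)"
  using Upair_up[of a] by (metis Upair_inject)

text \<open>Inverse of the pair \<open>Zpart\<close>, \<open>wpart\<close> when Z is symmetric; the
  factor \<open>sqrt 2\<close> undoes the normalisation of the off-diagonal coordinates.\<close>

definition mk :: "complex^'p^'p \<Rightarrow> complex^'r \<Rightarrow> complex^('p::finite uprod + 'r::finite)" where
  "mk Z w = (\<chi> i. case i of
      Inl a \<Rightarrow> (if up1 a = up2 a then 1 else of_real (sqrt 2)) * Z $ up1 a $ up2 a
    | Inr j \<Rightarrow> w $ j)"

lemma Zpart_nth: "Zpart z $ k $ l = (if k = l then 1 else of_real (1 / sqrt 2)) * z $ Inl (Upair k l)"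
  by (simp add: Zpart_def)

lemma wpart_nth [simp]: "wpart z $ j = z $ Inr j"
  by (simp add: wpart_def)

lemma transpose_Zpart [simp]: "transpose (Zpart z) = Zpart z"
  by (simp add: vec_eq_iff transpose_def Zpart_nth Upair_swap eq_commute)

lemma wpart_mk [simp]: "wpart (mk Z w) = w"
  by (simp add: vec_eq_iff mk_def)

lemma Zpart_mk [simp]:
  assumes "transpose Z = Z"
  shows "Zpart (mk Z w) = Z"
proof -
  have sym: "Z $ k $ l = Z $ l $ k" for k l
    using assms by (metis transpose_def vec_lambda_beta)
  have "Zpart (mk Z w) $ k $ l = Z $ k $ l" for k l
    using Upair_eq_cases[of k l "Upair k l"] sym
    by (auto simp: Zpart_nth mk_def simp flip: of_real_mult mult.assoc)
  then show ?thesis by (simp add: vec_eq_iff)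
qed

lemma mk_parts [simp]: "mk (Zpart z) (wpart z) = z"
proof -
  have "mk (Zpart z) (wpart z) $ i = z $ i" for i
  proof (cases i)
    case (Inl a)
    then show ?thesis
      using Upair_up[of a] by (auto simp: mk_def Zpart_nth simp flip: of_real_mult mult.assoc)
  qed (simp add: mk_def)
  then show ?thesis by (simp add: vec_eq_iff)
qed

lemma parts_eqI: "Zpart z = Zpart z' \<Longrightarrow> wpart z = wpart z' \<Longrightarrow> z = z'"
  by (metis mk_parts)

lemma mat_mult_nth [simp]: "(mat c ** A) $ i $ j = c * (A :: 'a::semiring_1^'n::finite^'m::finite) $ i $ j"
  by (simp add: matrix_matrix_mult_def mat_def if_distrib[of "\<lambda>x. x * _"] cong: if_cong)

lemma mat_one_nth: "(mat 1 :: 'a::zero_neq_one^'n^'n) $ i $ j = (if i = j then 1 else 0)"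
  by (simp add: mat_def)

lemma matrix_scaleR_left: "(r *\<^sub>R A) ** B = r *\<^sub>R (A ** (B :: complex^'n::finite^'m::finite))"
  and matrix_scaleR_right: "A ** (r *\<^sub>R B) = r *\<^sub>R (A ** (B :: complex^'n::finite^'m::finite))"
  by (simp_all add: vec_eq_iff matrix_matrix_mult_def scaleR_sum_right)

lemma Zpart_add: "Zpart (x + y) = Zpart x + Zpart y"
  and Zpart_diff: "Zpart (x - y) = Zpart x - Zpart y"
  and Zpart_scaleR: "Zpart (r *\<^sub>R x) = r *\<^sub>R Zpart x"
  and Zpart_zero [simp]: "Zpart 0 = 0"
  and Zpart_scale: "Zpart (c *s x) = mat c ** Zpart x"
  by (auto simp: vec_eq_iff Zpart_nth algebra_simps)

lemma wpart_add: "wpart (x + y) = wpart x + wpart y"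
  and wpart_diff: "wpart (x - y) = wpart x - wpart y"
  and wpart_scaleR: "wpart (r *\<^sub>R x) = r *\<^sub>R wpart x"
  and wpart_zero [simp]: "wpart 0 = 0"
  and wpart_scale: "wpart (c *s x) = c *s wpart x"
  by (auto simp: vec_eq_iff)

lemma linear_Zpart: "linear Zpart"
  by (rule linearI) (simp_all add: Zpart_add Zpart_scaleR)

lemma linear_wpart: "linear wpart"
  by (rule linearI) (simp_all add: wpart_add wpart_scaleR)

lemma bounded_linear_Zpart: "bounded_linear Zpart"
  using linear_Zpart by (simp add: linear_conv_bounded_linear)

lemma bounded_linear_wpart: "bounded_linear wpart"
  using linear_wpart by (simp add: linear_conv_bounded_linear)

lemma mk_add: "mk (Z + Z') (w + w') = mk Z w + mk Z' w'"
  and mk_scaleR: "mk (r *\<^sub>R Z) (r *\<^sub>R w) = r *\<^sub>R mk Z w"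
  and mk_scale: "mk (mat c ** Z) (c *s w) = c *s mk Z w"
  by (auto simp: vec_eq_iff mk_def algebra_simps split: sum.split)

lemma mk_zero [simp]: "mk 0 0 = 0"
  by (simp add: vec_eq_iff mk_def split: sum.split)

lemma bounded_linear_mk: "bounded_linear (\<lambda>x. mk (fst x) (snd x))"
  unfolding linear_conv_bounded_linear[symmetric]
  by (rule linearI) (simp_all add: mk_add mk_scaleR)

lemma bounded_linear_conj_mat: "bounded_linear (conj_mat :: complex^'n::finite^'m::finite \<Rightarrow> _)"
  unfolding linear_conv_bounded_linear[symmetric]
  by (rule linearI) (simp_all add: vec_eq_iff)

lemma bounded_linear_trace: "bounded_linear (trace :: complex^'n::finite^'n \<Rightarrow> complex)"
  unfolding linear_conv_bounded_linear[symmetric]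
  by (rule linearI) (simp_all add: trace_def sum.distrib scaleR_sum_right)

lemma fiber_Upair:
  "{x. (case x of (k, l) \<Rightarrow> Upair k l) = a} = {(up1 a, up2 a), (up2 a, up1 a)}"
  using Upair_up[of a] by (auto dest: Upair_eq_cases simp: Upair_swap[of "up2 a"])

text \<open>Each off-diagonal coordinate occurs twice in the matrix, and the factor
  \<open>1 / sqrt 2\<close> compensates exactly for this: the coordinates are isometric for the
  Frobenius norm.\<close>

lemma norm_parts: "(norm z)\<^sup>2 = (norm (Zpart z))\<^sup>2 + (norm (wpart z))\<^sup>2"
proof -
  have "(norm (Zpart z))\<^sup>2 = (\<Sum>k\<in>UNIV. \<Sum>l\<in>UNIV. (cmod (Zpart z $ k $ l))\<^sup>2)"
    unfolding norm_vec_def L2_set_def by (simp add: sum_nonneg)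
  also have "\<dots> = (\<Sum>(k, l)\<in>UNIV. (cmod (Zpart z $ k $ l))\<^sup>2)"
    by (simp add: sum.cartesian_product)
  also have "\<dots> = (\<Sum>a\<in>UNIV. \<Sum>x\<in>{x \<in> UNIV. (case x of (k, l) \<Rightarrow> Upair k l) = a}.
      (case x of (k, l) \<Rightarrow> (cmod (Zpart z $ k $ l))\<^sup>2))"
    by (rule sum.group[symmetric]) auto
  also have "\<dots> = (\<Sum>a\<in>UNIV. (cmod (z $ Inl a))\<^sup>2)"
  proof (rule sum.cong[OF refl])
    fix a
    show "(\<Sum>x\<in>{x \<in> UNIV. (case x of (k, l) \<Rightarrow> Upair k l) = a}.
        (case x of (k, l) \<Rightarrow> (cmod (Zpart z $ k $ l))\<^sup>2)) = (cmod (z $ Inl a))\<^sup>2"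
    proof (cases "up1 a = up2 a")
      case True
      then show ?thesis using Upair_up[of a] by (simp add: fiber_Upair Zpart_nth)
    next
      case False
      then show ?thesis using Upair_up[of a]
        by (simp add: fiber_Upair Zpart_nth norm_mult norm_divide power_mult_distrib power_divide Upair_swap[of "up2 a"])
    qed
  qed
  finally have Z: "(norm (Zpart z))\<^sup>2 = (\<Sum>a\<in>UNIV. (cmod (z $ Inl a))\<^sup>2)" .
  have "(norm z)\<^sup>2 = (\<Sum>i\<in>UNIV. (cmod (z $ i))\<^sup>2)"
    unfolding norm_vec_def L2_set_def by (simp add: sum_nonneg)
  also have "\<dots> = (\<Sum>a\<in>UNIV. (cmod (z $ Inl a))\<^sup>2) + (\<Sum>j\<in>UNIV. (cmod (z $ Inr j))\<^sup>2)"
    unfolding UNIV_sum by (subst sum.union_disjoint) (auto simp: sum.reindex)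
  also have "(\<Sum>j\<in>UNIV. (cmod (z $ Inr j))\<^sup>2) = (norm (wpart z))\<^sup>2"
    unfolding norm_vec_def L2_set_def by (simp add: sum_nonneg)
  finally show ?thesis using Z by simp
qed

subsection \<open>The Jacobian of a congruence\<close>

text \<open>The action of the general linear group on symmetric matrices, with a scaling of w. Up to
  a shear, every derivative of an automorphism constructed below has this form.\<close>

definition cong_map :: "complex^'p^'p \<Rightarrow> complex \<Rightarrow>
    complex^('p::finite uprod + 'r::finite) \<Rightarrow> complex^('p uprod + 'r)" where
  "cong_map T c z = mk (T ** Zpart z ** transpose T) (c *s wpart z)"

lemma Zpart_cong_map: "Zpart (cong_map T c z) = T ** Zpart z ** transpose T"
  unfolding cong_map_def by (rule Zpart_mk) (simp add: matrix_transpose_mul matrix_mul_assoc)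

lemma wpart_cong_map: "wpart (cong_map T c z) = c *s wpart z"
  by (simp add: cong_map_def)

lemma scaleR_scale_commute: "c *s (r *\<^sub>R x) = r *\<^sub>R (c *s (x :: complex^'n))"
  by (simp add: vec_eq_iff)

lemma linear_cong_map: "linear (cong_map T c)"
  by (rule linearI; rule parts_eqI)
     (simp_all add: Zpart_cong_map wpart_cong_map Zpart_add wpart_add Zpart_scaleR wpart_scaleR
        matrix_ring matrix_scaleR_left matrix_scaleR_right vec.scale_right_distrib scaleR_scale_commute)

lemma cong_map_mult: "cong_map (T ** T') (c * c') = cong_map T c \<circ> cong_map T' c'"
  by (rule ext, rule parts_eqI)
     (simp_all add: Zpart_cong_map wpart_cong_map matrix_transpose_mul matrix_mul_assoc vector_smult_assoc)

text \<open>Grouping the ordered pairs by their unordered pair counts off-diagonal pairs twice and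
  diagonal ones once. All ordered pairs give the exponent \<open>2 p\<close>, and the missing
  diagonal factors supply the remaining 2.\<close>

lemma prod_uprod_square:
  fixes d :: "'p::finite \<Rightarrow> real"
  shows "(\<Prod>a\<in>UNIV. (d (up1 a) * d (up2 a))\<^sup>2) = (\<Prod>k\<in>UNIV. d k) ^ (2 * (CARD('p) + 1))"
proof -
  define f where "f a = d (up1 a) * d (up2 a)" for a
  have f: "d k * d l = f (Upair k l)" for k l
    using Upair_eq_cases[of k l "Upair k l"] by (auto simp: f_def mult.commute)
  have "(\<Prod>a\<in>UNIV. \<Prod>x\<in>{x \<in> UNIV. (case x of (k, l) \<Rightarrow> Upair k l) = a}. (case x of (k, l) \<Rightarrow> d k * d l))
      = (\<Prod>(k, l)\<in>UNIV. d k * d l)"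
    by (rule prod.group) auto
  also have "\<dots> = (\<Prod>k\<in>UNIV. \<Prod>l\<in>UNIV. d k * d l)"
    by (simp add: prod.cartesian_product)
  also have "\<dots> = (\<Prod>k\<in>UNIV. d k) ^ (2 * CARD('p))"
    by (simp add: prod.distrib power_mult power2_eq_square power_mult_distrib prod_power_distrib[symmetric])
  finally have 1: "(\<Prod>a\<in>UNIV. \<Prod>x\<in>{x \<in> UNIV. (case x of (k, l) \<Rightarrow> Upair k l) = a}. (case x of (k, l) \<Rightarrow> d k * d l))
      = (\<Prod>k\<in>UNIV. d k) ^ (2 * CARD('p))" .
  have fib: "(\<Prod>x\<in>{x \<in> UNIV. (case x of (k, l) \<Rightarrow> Upair k l) = a}. (case x of (k, l) \<Rightarrow> d k * d l))
      = (if up1 a = up2 a then f a else (f a)\<^sup>2)" for a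
    by (auto simp: fiber_Upair f_def power2_eq_square)
  have "(\<Prod>a\<in>UNIV. (f a)\<^sup>2) = (\<Prod>a\<in>UNIV. (if up1 a = up2 a then f a else (f a)\<^sup>2) * (if up1 a = up2 a then f a else 1))"
    by (rule prod.cong) (auto simp: power2_eq_square)
  also have "\<dots> = (\<Prod>k\<in>UNIV. d k) ^ (2 * CARD('p)) * (\<Prod>a\<in>UNIV. (if up1 a = up2 a then f a else 1))"
    using 1 unfolding fib by (simp add: prod.distrib)
  also have "(\<Prod>a\<in>UNIV. (if up1 a = up2 a then f a else 1)) = (\<Prod>a\<in>range (\<lambda>k. Upair k k). f a)"
  proof -
    have "{a. up1 a = up2 a} = range (\<lambda>k::'p. Upair k k)"
    proof (intro set_eqI iffI)
      fix a :: "'p uprod"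
      show "a \<in> range (\<lambda>k. Upair k k)" if "a \<in> {a. up1 a = up2 a}"
        using that Upair_up[of a] by (metis (mono_tags, lifting) mem_Collect_eq range_eqI)
      show "a \<in> {a. up1 a = up2 a}" if "a \<in> range (\<lambda>k. Upair k k)"
        using that Upair_up[of a] by (auto simp: Upair_inject dest: Upair_eq_cases)
    qed
    then show ?thesis
      by (simp add: prod.If_cases)
  qed
  also have "\<dots> = (\<Prod>k\<in>UNIV. f (Upair k k))"
    by (subst prod.reindex) (auto simp: inj_on_def Upair_inject)
  also have "\<dots> = (\<Prod>k\<in>UNIV. d k)\<^sup>2"
    by (simp add: f[symmetric] prod.distrib power2_eq_square)
  finally show ?thesis unfolding f_def by (simp flip: power_add)
qed

lemma adet_cong_map_diagonal:
  fixes A :: "complex^'p::finite^'p"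
  assumes "\<And>i j. i \<noteq> j \<Longrightarrow> A $ i $ j = 0"
  shows "adet (cong_map A c :: complex^('p uprod + 'r::finite) \<Rightarrow> _)
     = cmod (det A) ^ (2 * (CARD('p) + 1)) * cmod c ^ (2 * CARD('r))"
proof -
  define d where "d k = A $ k $ k" for k
  have AA: "A $ i $ j = (if i = j then d i else 0)" for i j using assms by (auto simp: d_def)
  define e where "e i = (case i of Inl a \<Rightarrow> d (up1 a) * d (up2 a) | Inr j \<Rightarrow> c)" for i :: "'p uprod + 'r"
  have "cong_map A c z = (\<chi> i. e i * z $ i)" for z :: "complex^('p uprod + 'r)"
  proof (rule parts_eqI)
    have "(A ** Zpart z ** transpose A) $ k $ l = d k * Zpart z $ k $ l * d l" for k l
      by (simp add: matrix_matrix_mult_def transpose_def AA if_distrib[of "\<lambda>x. x * _"] if_distrib[of "\<lambda>x. _ * x"] cong: if_cong)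
    moreover have "d k * d l = d (up1 (Upair k l)) * d (up2 (Upair k l))" for k l
      using Upair_eq_cases[of k l "Upair k l"] by (auto simp: mult.commute)
    ultimately show "Zpart (cong_map A c z) = Zpart (\<chi> i. e i * z $ i)"
      by (simp add: vec_eq_iff Zpart_cong_map Zpart_nth e_def)
    show "wpart (cong_map A c z) = wpart (\<chi> i. e i * z $ i)"
      by (simp add: vec_eq_iff wpart_cong_map e_def)
  qed
  then have "adet (cong_map A c :: complex^('p uprod + 'r) \<Rightarrow> _) = (\<Prod>i\<in>UNIV. (cmod (e i))\<^sup>2)"
    by (subst adet_diagonal[symmetric]) (rule arg_cong[where f = adet], rule ext, simp)
  also have "\<dots> = (\<Prod>a\<in>UNIV. (cmod (d (up1 a)) * cmod (d (up2 a)))\<^sup>2) * (\<Prod>j\<in>(UNIV::'r set). (cmod c)\<^sup>2)"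
    unfolding UNIV_sum by (subst prod.union_disjoint) (auto simp: prod.reindex e_def norm_mult)
  also have "(\<Prod>a\<in>UNIV. (cmod (d (up1 a)) * cmod (d (up2 a)))\<^sup>2) = cmod (det A) ^ (2 * (CARD('p) + 1))"
  proof -
    have "det A = (\<Prod>k\<in>UNIV. d k)" using det_diagonal[of A] assms by (simp add: d_def)
    then show ?thesis using prod_uprod_square[of "\<lambda>k. cmod (d k)"] by (simp add: prod_norm)
  qed
  finally show ?thesis by (simp add: power_mult)
qed

text \<open>The Jacobian is multiplicative in T, so its value on diagonal matrices and on
  transvections determines it on the whole group.\<close>

lemma adet_cong_map:
  fixes T :: "complex^'p::finite^'p"
  assumes "det T \<noteq> 0"
  shows "adet (cong_map T c :: complex^('p uprod + 'r::finite) \<Rightarrow> _)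
     = cmod (det T) ^ (2 * (CARD('p) + 1)) * cmod c ^ (2 * CARD('r))"
proof -
  define \<chi>' where "\<chi>' T = adet (cong_map T 1 :: complex^('p uprod + 'r) \<Rightarrow> _)" for T
  have mult: "\<chi>' (A ** B) = \<chi>' A * \<chi>' B" for A B
  proof -
    have "(cong_map (A ** B) (1 * 1) :: complex^('p uprod + 'r) \<Rightarrow> _) = cong_map A 1 \<circ> cong_map B 1"
      by (rule cong_map_mult)
    then show ?thesis unfolding \<chi>'_def by (simp add: adet_comp linear_cong_map)
  qed
  have diag: "\<chi>' A = cmod (det A) ^ (2 * (CARD('p) + 1))" if "\<And>i j. i \<noteq> j \<Longrightarrow> A $ i $ j = 0" for A
    unfolding \<chi>'_def using adet_cong_map_diagonal[OF that, of 1] by simp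
  have one: "\<chi>' (mat 1) = 1" using diag[of "mat 1"] by (simp add: mat_one_nth)
  \<comment> \<open>A transvection is conjugate to its own square, so every multiplicative function is 1 on it.\<close>
  have trans: "\<chi>' U = cmod (det U) ^ (2 * (CARD('p) + 1))"
    if D: "\<And>i j. i \<noteq> j \<Longrightarrow> D $ i $ j = 0" "det D \<noteq> 0" "D ** U = U ** U ** D" and U: "U ** V = mat 1" for D U V
  proof -
    have "det U * det V = 1" using U by (metis det_I det_mul)
    then have dU: "det U \<noteq> 0" by auto
    have "det D * det U = det U * det U * det D" using D(3) by (metis det_mul)
    then have d1: "det U = 1" using dU D(2) by simp
    have "\<chi>' U * \<chi>' V = 1" using U mult one by metis
    then have cU: "\<chi>' U \<noteq> 0" by auto
    have "\<chi>' D * \<chi>' U = \<chi>' U * \<chi>' U * \<chi>' D" using D(3) mult by metis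
    moreover have "\<chi>' D \<noteq> 0" using diag[OF D(1)] D(2) by simp
    ultimately have "\<chi>' U = 1" using cU by simp
    then show ?thesis using d1 by simp
  qed
  have "\<chi>' T = cmod (det T) ^ (2 * (CARD('p) + 1))"
  proof (rule det_nonzero_induct[where A = T])
    fix A B :: "complex^'p^'p"
    assume "\<chi>' A = cmod (det A) ^ (2 * (CARD('p) + 1))" "\<chi>' B = cmod (det B) ^ (2 * (CARD('p) + 1))"
    then show "\<chi>' (A ** B) = cmod (det (A ** B)) ^ (2 * (CARD('p) + 1))"
      by (simp add: mult det_mul norm_mult power_mult_distrib)
  next
    fix k and u :: "'p \<Rightarrow> complex" assume u: "u k = 0"
    let ?C = "\<lambda>u. (\<chi> i j. (if i = j then 1 else 0) + (if j = k then u i else 0)) :: complex^'p^'p"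
    \<comment> \<open>Conjugation by D doubles every \<open>u i\<close> with
      \<open>i \<noteq> k\<close> and so turns the column transvection into its square.\<close>
    define D where "D = ((\<chi> i j. if i = j then (if i = k then 1 else 2) else 0) :: complex^'p^'p)"
    have CM: "(?C u ** B) $ i $ j = B $ i $ j + u i * B $ k $ j" for u B i j
      by (simp add: matrix_matrix_mult_def distrib_right sum.distrib if_distrib[of "\<lambda>x. x * _"] cong: if_cong)
    have DM: "(D ** B) $ i $ j = (if i = k then 1 else 2) * B $ i $ j" for B i j
      by (simp add: D_def matrix_matrix_mult_def if_distrib[of "\<lambda>x. x * _"] cong: if_cong)
    show "\<chi>' (?C u) = cmod (det (?C u)) ^ (2 * (CARD('p) + 1))"
    proof (rule trans[of D _ "?C (\<lambda>i. - u i)"])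
      show "det D \<noteq> 0" by (subst det_diagonal) (auto simp: D_def)
      show "D ** ?C u = ?C u ** ?C u ** D"
        unfolding matrix_mul_assoc[symmetric] vec_eq_iff CM DM using u by (auto simp: D_def)
      show "?C u ** ?C (\<lambda>i. - u i) = mat 1"
        unfolding vec_eq_iff CM using u by (auto simp: mat_def)
    qed (auto simp: D_def)
  next
    fix k and u :: "'p \<Rightarrow> complex" assume u: "u k = 0"
    let ?R = "\<lambda>u. (\<chi> i j. (if i = j then 1 else 0) + (if i = k then u j else 0)) :: complex^'p^'p"
    \<comment> \<open>Here the k-th row is doubled instead, with the same effect on a row
      transvection.\<close>
    define D where "D = ((\<chi> i j. if i = j then (if i = k then 2 else 1) else 0) :: complex^'p^'p)"
    have MR: "(B ** ?R u) $ i $ j = B $ i $ j + B $ i $ k * u j" for u B i j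
      by (simp add: matrix_matrix_mult_def distrib_left sum.distrib if_distrib[of "\<lambda>x. _ * x"] cong: if_cong)
    have MD: "(B ** D) $ i $ j = B $ i $ j * (if j = k then 2 else 1)" for B i j
      by (simp add: D_def matrix_matrix_mult_def if_distrib[of "\<lambda>x. _ * x"] cong: if_cong)
    show "\<chi>' (?R u) = cmod (det (?R u)) ^ (2 * (CARD('p) + 1))"
    proof (rule trans[of D _ "?R (\<lambda>i. - u i)"])
      show "det D \<noteq> 0" by (subst det_diagonal) (auto simp: D_def)
      show "D ** ?R u = ?R u ** ?R u ** D"
        unfolding vec_eq_iff MR MD using u by (auto simp: D_def)
      show "?R u ** ?R (\<lambda>i. - u i) = mat 1"
        unfolding vec_eq_iff MR using u by (auto simp: mat_def)
    qed (auto simp: D_def)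
  qed (use diag assms in auto)
  moreover have "adet (cong_map (mat 1) c :: complex^('p uprod + 'r) \<Rightarrow> _) = cmod c ^ (2 * CARD('r))"
    by (subst adet_cong_map_diagonal) (auto simp: mat_one_nth)
  moreover have "cong_map T c = cong_map T 1 \<circ> (cong_map (mat 1) c :: complex^('p uprod + 'r) \<Rightarrow> _)"
    using cong_map_mult[of T "mat 1" 1 c] by simp
  ultimately show ?thesis by (simp add: adet_comp linear_cong_map \<chi>'_def)
qed

text \<open>N depends on the Z coordinates only. Hence doubling w conjugates the shear into its
  square, and its Jacobian is a positive number equal to its own square.\<close>

lemma adet_shear:
  fixes N :: "complex^('p::finite uprod + 'r::finite) \<Rightarrow> complex^'r"
  assumes "linear N" and N: "\<And>z. N (mk 0 (wpart z)) = 0" 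
  shows "adet (\<lambda>z. z + mk 0 (N z)) = 1"
proof -
  define S where "S N z = z + mk 0 (N z)" for N and z :: "complex^('p uprod + 'r)"
  have Zmk0: "Zpart (mk 0 w) = 0" for w :: "complex^'r" by (rule Zpart_mk) (simp add: vec_eq_iff transpose_def)
  have lS: "linear (S N)" if "linear N" for N
  proof -
    have "linear (\<lambda>w::complex^'r. mk (0 :: complex^'p^'p) w)"
      by (rule linearI) (auto simp: vec_eq_iff mk_def split: sum.split)
    from linear_compose_add[OF linear_id linear_compose[OF that this]]
    show ?thesis by (simp add: S_def[abs_def] o_def)
  qed
  have N0: "N (mk 0 w) = 0" for w using N[of "mk 0 w"] by simp
  have SS: "S N \<circ> S N = S (\<lambda>z. 2 *\<^sub>R N z)"
  proof (rule ext)
    fix z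
    have "N (z + mk 0 (N z)) = N z" using linear_add[OF assms(1)] N0 by simp
    moreover have "mk (0 :: complex^'p^'p) (2 *\<^sub>R N z) = mk 0 (N z) + mk 0 (N z)"
      by (simp add: scaleR_2 flip: mk_add)
    ultimately show "(S N \<circ> S N) z = S (\<lambda>z. 2 *\<^sub>R N z) z" by (simp add: S_def)
  qed
  have l2: "linear (\<lambda>z. 2 *\<^sub>R N z)" using assms(1) by (rule linear_compose_scale_right)
  let ?D = "cong_map (mat 1) 2 :: complex^('p uprod + 'r) \<Rightarrow> _"
  have ND: "N (?D z) = N z" for z
  proof -
    have "?D z = z + mk 0 (wpart z)"
      by (rule parts_eqI) (simp_all add: Zpart_cong_map wpart_cong_map Zpart_add wpart_add Zmk0 vec_eq_iff)
    then show ?thesis using linear_add[OF assms(1)] N0 by simp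
  qed
  have conj: "?D \<circ> S N = S (\<lambda>z. 2 *\<^sub>R N z) \<circ> ?D"
    by (rule ext, rule parts_eqI)
       (simp_all add: S_def ND Zpart_cong_map wpart_cong_map Zpart_add wpart_add Zmk0 vec_eq_iff algebra_simps scaleR_2)
  have D: "adet ?D > 0" by (subst adet_cong_map) auto
  have "adet ?D * adet (S N) = adet (S N) * adet (S N) * adet ?D"
    using adet_comp[OF linear_cong_map lS[OF assms(1)], of "mat 1" 2]
      adet_comp[OF lS[OF l2] linear_cong_map, of "mat 1" 2] adet_comp[OF lS lS, OF assms(1) assms(1)]
    by (simp only: SS conj)
  moreover have "adet (S N) > 0"
  proof (rule adet_pos[OF lS lS])
    show "linear (\<lambda>z. - N z)" using assms(1) by (rule linear_compose_neg)
    show "S N \<circ> S (\<lambda>z. - N z) = (\<lambda>x. x)"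
    proof (rule ext)
      fix z
      have "N (mk 0 (- N z)) = 0" by (rule N0)
      then show "(S N \<circ> S (\<lambda>z. - N z)) z = z"
        using linear_add[OF assms(1)] linear_neg[OF assms(1)] N0 by (simp add: S_def flip: mk_add)
    qed
  qed (fact assms(1))
  ultimately show ?thesis using D by (simp add: S_def[abs_def])
qed

subsection \<open>The Levi form as a quarter of the real Hessian along a complex line\<close>

text \<open>Wirtinger derivatives are combinations of derivatives along
  \<open>axis \<alpha> 1\<close> and \<open>axis \<alpha> \<i>\<close>; expanding v in this real
  basis matches both sides. Afterwards all computations can be done with real derivatives.\<close>

lemma potential_metric_hessian:
  fixes g :: "complex^'n::finite \<Rightarrow> real"
  assumes S: "open S" "z \<in> S"
    and Dg: "\<And>u. u \<in> S \<Longrightarrow> (g has_derivative Dg u) (at u)"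
    and H: "\<And>v. ((\<lambda>u. Dg u v) has_derivative H v) (at z)"
  shows "potential_metric g z v = (H v v + H (\<i> *s v) (\<i> *s v)) / 4"
proof -
  have line: "((\<lambda>t::real. u + t *\<^sub>R w) has_derivative (\<lambda>t. t *\<^sub>R w)) (at 0)" for u w :: "complex^'n"
    by (auto intro!: derivative_eq_intros)
  have dd: "dir_deriv w f u = L w" if "(f has_derivative L) (at u)"
    for f :: "complex^'n \<Rightarrow> complex" and L u w
  proof -
    have "((\<lambda>t::real. f (u + t *\<^sub>R w)) has_derivative (\<lambda>t. L (t *\<^sub>R w))) (at 0)"
      using has_derivative_compose[OF line, of f L u w] that by simp
    moreover have "L (t *\<^sub>R w) = t *\<^sub>R L w" for t
      using has_derivative_bounded_linear[OF that] by (simp add: linear_simps)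
    ultimately show ?thesis
      unfolding dir_deriv_def by (intro vector_derivative_at) (simp add: has_vector_derivative_def)
  qed
  \<comment> \<open>The formula for the inner derivative holds on S only, which suffices because a
    directional derivative at z sees only nearby points.\<close>
  have dd_cong: "dir_deriv w f z = dir_deriv w f' z" if "\<And>u. u \<in> S \<Longrightarrow> f u = f' u"
    for f f' :: "complex^'n \<Rightarrow> complex" and w
  proof -
    have "(\<lambda>t::real. z + t *\<^sub>R w) \<midarrow>0\<rightarrow> z + 0 *\<^sub>R w"
      by (intro tendsto_intros)
    then have "\<forall>\<^sub>F t in at 0. z + t *\<^sub>R w \<in> S"
      using S by (intro topological_tendstoD) auto
    then have "\<forall>\<^sub>F t in nhds 0. f (z + t *\<^sub>R w) = f' (z + t *\<^sub>R w)"
      using S that by (auto simp: eventually_at_filter elim!: eventually_mono)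
    then show ?thesis unfolding dir_deriv_def
      by (intro vector_derivative_cong_eq) auto
  qed
  have zbar: "d_zbar \<beta> (\<lambda>u. complex_of_real (g u)) u
      = (of_real (Dg u (axis \<beta> 1)) + \<i> * of_real (Dg u (axis \<beta> \<i>))) / 2" if "u \<in> S" for u \<beta>
    unfolding d_zbar_def
    using dd[OF has_derivative_of_real[OF Dg[OF that]]] by simp
  let ?F = "\<lambda>\<beta> u. (of_real (Dg u (axis \<beta> 1)) + \<i> * of_real (Dg u (axis \<beta> \<i>))) / 2 :: complex"
  have "(?F \<beta> has_derivative (\<lambda>w. (of_real (H (axis \<beta> 1) w) + \<i> * of_real (H (axis \<beta> \<i>) w)) / 2)) (at z)" for \<beta>
    by (intro bounded_linear.has_derivative[OF bounded_linear_divide] has_derivative_add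
          has_derivative_mult_right has_derivative_of_real H)
  note dd_F = dd[OF this]
  have dz: "dir_deriv w (d_zbar \<beta> (\<lambda>u. complex_of_real (g u))) z
      = (of_real (H (axis \<beta> 1) w) + \<i> * of_real (H (axis \<beta> \<i>) w)) / 2" for w \<beta>
    by (rule trans[OF dd_cong[OF zbar] dd_F])
  have zz: "d_z \<alpha> (d_zbar \<beta> (\<lambda>u. complex_of_real (g u))) z =
      ((of_real (H (axis \<beta> 1) (axis \<alpha> 1)) + \<i> * of_real (H (axis \<beta> \<i>) (axis \<alpha> 1))) / 2
      - \<i> * ((of_real (H (axis \<beta> 1) (axis \<alpha> \<i>)) + \<i> * of_real (H (axis \<beta> \<i>) (axis \<alpha> \<i>))) / 2)) / 2" for \<alpha> \<beta>
    unfolding d_z_def dz ..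
  have linD: "linear (Dg u)" if "u \<in> S" for u
    using Dg[OF that] by (rule has_derivative_linear)
  have linH2: "linear (H v)" for v using H by (rule has_derivative_linear)
  \<comment> \<open>Linearity in the direction of the first derivative is inherited from
    \<open>Dg\<close> by uniqueness of derivatives.\<close>
  have linH1: "linear (\<lambda>v. H v w)" for w
  proof (rule linearI)
    fix x y :: "complex^'n" and r :: real
    have "((\<lambda>u. Dg u (x + y)) has_derivative (\<lambda>w. H x w + H y w)) (at z)"
      by (rule has_derivative_transform_within_open[OF has_derivative_add[OF H H] S])
         (simp add: linear_add[OF linD])
    then show "H (x + y) w = H x w + H y w" using H has_derivative_unique by metis
    have "((\<lambda>u. Dg u (r *\<^sub>R x)) has_derivative (\<lambda>w. r *\<^sub>R H x w)) (at z)"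
      by (rule has_derivative_transform_within_open[OF has_derivative_scaleR_right[OF H] S])
         (simp add: linear_cmul[OF linD])
    then show "H (r *\<^sub>R x) w = r *\<^sub>R H x w" using H has_derivative_unique by metis
  qed
  have expand: "v = (\<Sum>\<alpha>\<in>UNIV. Re (v $ \<alpha>) *\<^sub>R axis \<alpha> 1 + Im (v $ \<alpha>) *\<^sub>R axis \<alpha> \<i>)" for v :: "complex^'n"
  proof -
    have "(\<Sum>\<alpha>\<in>UNIV. Re (v $ \<alpha>) *\<^sub>R axis \<alpha> 1 + Im (v $ \<alpha>) *\<^sub>R axis \<alpha> \<i>) $ i
       = (\<Sum>\<alpha>\<in>UNIV. if \<alpha> = i then v $ \<alpha> else 0)" for i
      unfolding sum_component
      by (rule sum.cong) (auto simp: axis_def complex_eq_iff)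
    then show ?thesis by (simp add: vec_eq_iff)
  qed
  have H2: "H a v = (\<Sum>\<alpha>\<in>UNIV. Re (v $ \<alpha>) * H a (axis \<alpha> 1) + Im (v $ \<alpha>) * H a (axis \<alpha> \<i>))" for a v
    by (subst expand[of v]) (simp add: linear_sum[OF linH2] linear_add[OF linH2] linear_cmul[OF linH2])
  have H1: "H v a = (\<Sum>\<alpha>\<in>UNIV. Re (v $ \<alpha>) * H (axis \<alpha> 1) a + Im (v $ \<alpha>) * H (axis \<alpha> \<i>) a)" for a v
    by (subst expand[of v]) (simp add: linear_sum[OF linH1] linear_add[OF linH1] linear_cmul[OF linH1])
  have HH: "H v v = (\<Sum>\<alpha>\<in>UNIV. \<Sum>\<beta>\<in>UNIV.
      Re (v $ \<alpha>) * (Re (v $ \<beta>) * H (axis \<beta> 1) (axis \<alpha> 1) + Im (v $ \<beta>) * H (axis \<beta> \<i>) (axis \<alpha> 1))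
    + Im (v $ \<alpha>) * (Re (v $ \<beta>) * H (axis \<beta> 1) (axis \<alpha> \<i>) + Im (v $ \<beta>) * H (axis \<beta> \<i>) (axis \<alpha> \<i>)))" for v
    by (subst H2, subst (1 2) H1) (simp add: sum_distrib_left sum.distrib distrib_left)
  show ?thesis
    unfolding potential_metric_def zz HH Re_sum sum.distrib[symmetric] sum_divide_distrib
    by (intro sum.cong refl) (simp add: field_simps)
qed

section \<open>Geometry of \<open>Y\<^sub>I\<^sub>I\<close>\<close>

text \<open>Compactness of the unit sphere makes the strict inequality uniform; the gap
  \<open>1 - c\<close> is the radius used for openness.\<close>

lemma contr_coercive:
  fixes Z :: "complex^'n::finite^'n"
  assumes "contr Z"
  obtains c where "0 \<le> c" "c < 1" "\<And>x. norm (Z *v x) \<le> c * norm x"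
proof -
  have lin: "linear ((*v) Z)" 
    by (rule linearI) (simp_all add: vec_eq_iff matrix_vector_mult_def distrib_left sum.distrib scaleR_sum_right)
  have "compact (sphere (0 :: complex^'n) 1)" by simp
  moreover have "sphere (0 :: complex^'n) 1 \<noteq> {}" by simp
  moreover have "continuous_on (sphere 0 1) (\<lambda>x. norm (Z *v x))"
    by (intro continuous_on_norm linear_continuous_on) (simp add: lin flip: linear_conv_bounded_linear)
  ultimately obtain y where y: "y \<in> sphere 0 1" "\<And>x. x \<in> sphere 0 1 \<Longrightarrow> norm (Z *v x) \<le> norm (Z *v y)"
    using continuous_attains_sup[of "sphere 0 1" "\<lambda>x. norm (Z *v x)"] by blast
  have "y \<noteq> 0" "norm y = 1" using y(1) by auto
  then have "norm (Z *v y) < 1" using assms by (metis contr_def)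
  moreover have "norm (Z *v x) \<le> norm (Z *v y) * norm x" for x
  proof (cases "x = 0")
    case False
    have "norm (Z *v ((1 / norm x) *\<^sub>R x)) \<le> norm (Z *v y)" using False by (intro y(2)) simp
    then show ?thesis using False by (simp add: linear_cmul[OF lin] field_simps)
  qed simp
  ultimately show ?thesis by (intro that[of "norm (Z *v y)"]) auto
qed

lemma open_contr: "open {Z :: complex^'n::finite^'n. contr Z}"
  unfolding open_dist
proof (intro ballI, clarify)
  fix Z :: "complex^'n^'n" assume "contr Z"
  then obtain c where c: "0 \<le> c" "c < 1" "\<And>x. norm (Z *v x) \<le> c * norm x" using contr_coercive by blast
  have "contr Y" if "dist Y Z < 1 - c" for Y
    unfolding contr_def
  proof (intro allI impI)
    fix x :: "complex^'n" assume "x \<noteq> 0"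
    have "norm (Y *v x) = norm (Z *v x + (Y - Z) *v x)" by (simp add: matrix_vector_mult_diff_rdistrib)
    also have "\<dots> \<le> c * norm x + norm (Y - Z) * norm x"
      using norm_triangle_ineq norm_matrix_vector_le[of "Y - Z" x] c(3)[of x] by (smt (verit))
    also have "\<dots> = (c + norm (Y - Z)) * norm x" by (simp add: algebra_simps)
    also have "\<dots> < 1 * norm x" using that \<open>x \<noteq> 0\<close> by (intro mult_strict_right_mono) (auto simp: dist_norm)
    finally show "norm (Y *v x) < norm x" by simp
  qed
  then show "\<exists>e>0. \<forall>y. dist y Z < e \<longrightarrow> y \<in> Collect contr" using c by (intro exI[of _ "1 - c"]) auto
qed

text \<open>Needed for contractibility: it provides a continuous logarithm of the determinant of a
  Moebius denominator.\<close>

lemma convex_contr: "convex {Z :: complex^'n::finite^'n. contr Z}"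
proof (rule convexI)
  fix Z Y :: "complex^'n^'n" and u v :: real
  assume *: "Z \<in> {Z. contr Z}" "Y \<in> {Z. contr Z}" "0 \<le> u" "0 \<le> v" "u + v = 1"
  have "norm ((u *\<^sub>R Z + v *\<^sub>R Y) *v x) < norm x" if "x \<noteq> 0" for x
  proof -
    have "(u *\<^sub>R Z + v *\<^sub>R Y) *v x = u *\<^sub>R (Z *v x) + v *\<^sub>R (Y *v x)"
      by (simp add: vec_eq_iff matrix_vector_mult_def sum.distrib scaleR_sum_right algebra_simps)
    then have "norm ((u *\<^sub>R Z + v *\<^sub>R Y) *v x) \<le> u * norm (Z *v x) + v * norm (Y *v x)"
      using * by (metis abs_of_nonneg norm_scaleR norm_triangle_ineq)
    also have "\<dots> < u * norm x + v * norm x"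
    proof (cases "u = 0")
      case True
      then show ?thesis using * that by (auto simp: contr_def)
    next
      case False
      then have "u * norm (Z *v x) < u * norm x" using * that by (auto simp: contr_def)
      moreover have "v * norm (Y *v x) \<le> v * norm x" using * contr_le[of Y x] by (intro mult_left_mono) auto
      ultimately show ?thesis by simp
    qed
    also have "\<dots> = norm x" using * by (metis distrib_right mult_1)
    finally show ?thesis .
  qed
  then show "u *\<^sub>R Z + v *\<^sub>R Y \<in> {Z. contr Z}" by (simp add: contr_def)
qed

text \<open>The cylinder over the symmetric domain, with w free. There \<open>detZ\<close> is
  positive and h is smooth, and \<open>Y_II K\<close> is its part with \<open>X < 1\<close>.\<close>

definition dom0 :: "(complex^('p::finite uprod + 'r::finite)) set" where
  "dom0 = {z. contr (Zpart z)}"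

lemma dom0_vimage: "dom0 = Zpart -` {Z. contr Z}"
  by (auto simp: dom0_def)

lemma open_dom0: "open (dom0 :: (complex^('p::finite uprod + 'r::finite)) set)"
  unfolding dom0_vimage
  by (intro open_vimage open_contr linear_continuous_on bounded_linear_Zpart)

section \<open>The matrix \<open>I - Z conj(Z)\<close>, its determinant and the Levi form of the
  logarithm\<close>

definition MZ :: "complex^('p::finite uprod + 'r::finite) \<Rightarrow> complex^'p^'p" where
  "MZ z = mat 1 - Zpart z ** conj_mat (Zpart z)"

text \<open>Writing the inverse as \<open>adj A ** A\<close> shows that the determinant is real and
  positive, and lets traces against the inverse be rewritten as Frobenius norms.\<close>

lemma MZ_factor:
  fixes z :: "complex^('p::finite uprod + 'r::finite)"
  assumes "z \<in> dom0"
  obtains A :: "complex^'p^'p" where "A ** MZ z ** adj A = mat 1" "matrix_inv (MZ z) = adj A ** A"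
    "det A \<noteq> 0" "det (MZ z) = of_real (detZ z)" "detZ z = 1 / (cmod (det A))\<^sup>2"
proof -
  have "contr (Zpart z)" using assms by (simp add: dom0_def)
  then obtain A :: "complex^'p^'p" where A: "A ** MZ z ** adj A = mat 1"
    unfolding MZ_def by (rule one_minus_factor[OF transpose_Zpart])
  have "MZ z ** adj A ** A = mat 1"
    using A by (metis matrix_left_right_inverse matrix_mul_assoc)
  then have inv: "matrix_inv (MZ z) = adj A ** A"
    by (intro matrix_inv_unique) (simp add: matrix_mul_assoc)
  have d: "det A * det (MZ z) * cnj (det A) = 1"
    using A by (metis det_I det_adj det_mul)
  then have dA: "det A \<noteq> 0" by auto
  have "det (MZ z) = 1 / (det A * cnj (det A))" using d dA by (simp add: eq_divide_eq mult_ac)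
  also have "\<dots> = of_real (1 / (cmod (det A))\<^sup>2)" by (simp add: complex_norm_square del: of_real_power)
  finally have dM: "det (MZ z) = of_real (1 / (cmod (det A))\<^sup>2)" .
  then have dZ: "detZ z = 1 / (cmod (det A))\<^sup>2" by (simp add: detZ_def MZ_def)
  with dM have "det (MZ z) = of_real (detZ z)" by simp
  with A inv dA show ?thesis using dZ by (rule that)
qed

lemma detZ_pos: "z \<in> dom0 \<Longrightarrow> detZ z > 0"
  by (erule MZ_factor) simp

lemma det_MZ: "z \<in> dom0 \<Longrightarrow> det (MZ z) = of_real (detZ z)"
  by (erule MZ_factor)

lemma det_MZ_nonzero: "z \<in> dom0 \<Longrightarrow> det (MZ z) \<noteq> 0"
  using detZ_pos det_MZ by (metis less_irrefl of_real_eq_0_iff)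

lemma MZ_has_derivative:
  "(MZ has_derivative (\<lambda>v. - (Zpart v ** conj_mat (Zpart z) + Zpart z ** conj_mat (Zpart v)))) (at z)"
proof -
  have 1: "(Zpart has_derivative Zpart) (at z)"
    by (rule bounded_linear_imp_has_derivative[OF bounded_linear_Zpart])
  have 2: "((\<lambda>u. conj_mat (Zpart u)) has_derivative (\<lambda>v. conj_mat (Zpart v))) (at z)"
    by (rule bounded_linear.has_derivative[OF bounded_linear_conj_mat 1])
  show ?thesis unfolding MZ_def[abs_def]
    by (rule has_derivative_eq_rhs[OF has_derivative_diff[OF has_derivative_const has_derivative_matrix_mult[OF 1 2]]])
       (simp add: fun_eq_iff algebra_simps)
qed

lemma trace_adj: "trace (adj A) = cnj (trace A)"
  by (simp add: trace_def cnj_sum)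

lemma adj_inv_MZ:
  assumes "z \<in> dom0"
  shows "adj (matrix_inv (MZ z)) = matrix_inv (MZ z)"
  by (rule MZ_factor[OF assms]) (simp add: adj_mult)

text \<open>The differential of \<open>- ln (detZ z)\<close>, with the minus sign. The two terms of
  the derivative of \<open>MZ\<close> have conjugate traces, hence twice a real part.\<close>

definition dlog :: "complex^('p::finite uprod + 'r::finite) \<Rightarrow> complex^('p uprod + 'r) \<Rightarrow> real" where
  "dlog z v = 2 * Re (trace (matrix_inv (MZ z) ** Zpart v ** conj_mat (Zpart z)))"

definition d2log :: "complex^('p::finite uprod + 'r::finite) \<Rightarrow> complex^('p uprod + 'r) \<Rightarrow> complex^('p uprod + 'r) \<Rightarrow> real" where
  "d2log z v u = 2 * Re (trace (matrix_inv (MZ z) ** (Zpart u ** conj_mat (Zpart z) + Zpart z ** conj_mat (Zpart u))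
      ** matrix_inv (MZ z) ** Zpart v ** conj_mat (Zpart z) + matrix_inv (MZ z) ** Zpart v ** conj_mat (Zpart u)))"

lemma ln_detZ_has_derivative:
  assumes z: "z \<in> dom0"
  shows "((\<lambda>u. - ln (detZ u)) has_derivative dlog z) (at z)"
proof -
  let ?R = "matrix_inv (MZ z)"
  have "MZ z ** ?R = mat 1" using det_MZ_nonzero[OF z] by (rule matrix_inv_mult)
  from has_derivative_compose[OF MZ_has_derivative det_has_derivative[OF this]]
  have "((\<lambda>u. det (MZ u)) has_derivative (\<lambda>v. det (MZ z) * trace (?R ** - (Zpart v ** conj_mat (Zpart z) + Zpart z ** conj_mat (Zpart v))))) (at z)" .
  from bounded_linear.has_derivative[OF bounded_linear_Re this]
  have D: "(detZ has_derivative (\<lambda>v. Re (det (MZ z) * trace (?R ** - (Zpart v ** conj_mat (Zpart z) + Zpart z ** conj_mat (Zpart v)))))) (at z)"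
    by (simp add: detZ_def[abs_def] MZ_def)
  have eq: "Re (det (MZ z) * trace (?R ** - (Zpart v ** conj_mat (Zpart z) + Zpart z ** conj_mat (Zpart v)))) = - (detZ z * dlog z v)" for v
  proof -
    have "adj (?R ** Zpart v ** conj_mat (Zpart z)) = Zpart z ** conj_mat (Zpart v) ** ?R"
      by (simp add: adj_mult adj_inv_MZ[OF z] adj_symmetric matrix_mul_assoc)
         (metis adj_adj adj_symmetric transpose_Zpart)
    then have "cnj (trace (?R ** Zpart v ** conj_mat (Zpart z))) = trace (?R ** (Zpart z ** conj_mat (Zpart v)))"
      by (metis trace_adj trace_mul_sym)
    then have "Re (trace (?R ** Zpart z ** conj_mat (Zpart v))) = Re (trace (?R ** Zpart v ** conj_mat (Zpart z)))"
      by (metis complex_cnj(1) complex.sel(1) complex_surj matrix_mul_assoc cnj.simps(1))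
    moreover have "trace (- A) = - trace A" for A :: "complex^'a^'a" by (simp add: trace_def sum_negf)
    ultimately show ?thesis
      by (simp add: det_MZ[OF z] dlog_def matrix_ring trace_add trace_sub)
  qed
  have "((\<lambda>u. ln (detZ u)) has_derivative (\<lambda>v. inverse (detZ z) * - (detZ z * dlog z v))) (at z)"
    by (rule has_derivative_compose[OF D[unfolded eq], of ln "\<lambda>x. inverse (detZ z) * x"])
       (use DERIV_ln[OF detZ_pos[OF z]] in \<open>simp add: has_field_derivative_def\<close>)
  then have "((\<lambda>u. - ln (detZ u)) has_derivative (\<lambda>v. - (inverse (detZ z) * - (detZ z * dlog z v)))) (at z)"
    by (rule has_derivative_minus)
  then show ?thesis using detZ_pos[OF z] by (simp add: field_simps)
qed

lemma dlog_has_derivative: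
  assumes z: "z \<in> dom0"
  shows "((\<lambda>u. dlog u v) has_derivative d2log z v) (at z)"
proof -
  let ?R = "matrix_inv (MZ z)"
  let ?dM = "\<lambda>u. Zpart u ** conj_mat (Zpart z) + Zpart z ** conj_mat (Zpart u)"
  have 1: "((\<lambda>u. matrix_inv (MZ u)) has_derivative (\<lambda>u. ?R ** ?dM u ** ?R)) (at z)"
    using has_derivative_compose[OF MZ_has_derivative matrix_inv_has_derivative[OF det_MZ_nonzero[OF z]]]
    by (simp add: matrix_ring add.commute)
  have 2: "((\<lambda>u. conj_mat (Zpart u)) has_derivative (\<lambda>u. conj_mat (Zpart u))) (at z)"
    by (intro bounded_linear.has_derivative[OF bounded_linear_conj_mat] bounded_linear_imp_has_derivative bounded_linear_Zpart)
  have 3: "((\<lambda>u. matrix_inv (MZ u) ** Zpart v) has_derivative (\<lambda>u. ?R ** ?dM u ** ?R ** Zpart v)) (at z)"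
    by (rule bounded_linear.has_derivative[OF bounded_bilinear.bounded_linear_left[OF bounded_bilinear_matrix_mult] 1])
  have "((\<lambda>u. 2 * Re (trace (matrix_inv (MZ u) ** Zpart v ** conj_mat (Zpart u)))) has_derivative
      (\<lambda>u. 2 * Re (trace (?R ** Zpart v ** conj_mat (Zpart u) + ?R ** ?dM u ** ?R ** Zpart v ** conj_mat (Zpart z))))) (at z)"
    by (intro has_derivative_mult_right bounded_linear.has_derivative[OF bounded_linear_Re]
        bounded_linear.has_derivative[OF bounded_linear_trace] has_derivative_matrix_mult 2 3)
  then show ?thesis by (simp add: dlog_def[abs_def] d2log_def[abs_def] add.commute)
qed

text \<open>The Levi form of \<open>- ln (detZ z)\<close>, which up to a constant is the Bergman
  metric of the symmetric domain.\<close>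

definition levi_q :: "complex^('p::finite uprod + 'r::finite) \<Rightarrow> complex^('p uprod + 'r) \<Rightarrow> real" where
  "levi_q z v = (d2log z v v + d2log z (\<i> *s v) (\<i> *s v)) / 4"

lemma mat_commute: "A ** mat c = mat c ** (A :: complex^'n::finite^'n)"
  by (simp add: vec_eq_iff) (simp add: matrix_matrix_mult_def mat_def if_distrib[of "\<lambda>x. _ * x"] cong: if_cong)

lemma conj_mat_mat: "conj_mat (mat c) = mat (cnj c)"
  by (simp add: vec_eq_iff mat_def)

text \<open>The trace of the square of \<open>R V conj(Z)\<close> changes sign when v is replaced by
  \<open>\<i> *s v\<close> and cancels in the sum. The mixed terms survive; with
  \<open>R = adj A ** A\<close> and cyclicity of the trace they become squared norms.\<close>

lemma levi_q_eq:
  fixes z :: "complex^('p::finite uprod + 'r::finite)"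
  assumes z: "z \<in> dom0" and A: "matrix_inv (MZ z) = adj A ** A"
  shows "levi_q z v = (norm (A ** Zpart v ** conj_mat (Zpart z) ** adj A))\<^sup>2 + (norm (A ** Zpart v))\<^sup>2"
proof -
  define V where "V = Zpart v"
  define Z where "Z = Zpart z"
  define R where "R = matrix_inv (MZ z)"
  have aV: "adj V = conj_mat V" "adj (conj_mat Z) = Z" unfolding V_def Z_def
    by (simp_all add: adj_symmetric) (metis adj_adj adj_symmetric transpose_Zpart)
  have t: "trace (mat c ** B) = c * trace B" for c and B :: "complex^'p^'p"
    by (simp add: trace_def sum_distrib_left)
  have pull: "A ** (mat c ** B) = mat c ** (A ** B)" for c and A B :: "complex^'p^'p"
    unfolding matrix_mul_assoc mat_commute[of A] ..
  note pulls = pull[of R] pull[of V] pull[of Z] pull[of "conj_mat V"] pull[of "conj_mat Z"]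
  have mm: "mat a ** (mat b ** B) = mat (a * b) ** B" for a b :: complex and B :: "complex^'p^'p"
    by (simp add: vec_eq_iff)
  have e1: "d2log z v v = 2 * Re (trace (R ** V ** conj_mat Z ** R ** V ** conj_mat Z))
      + 2 * Re (trace (R ** Z ** conj_mat V ** R ** V ** conj_mat Z)) + 2 * Re (trace (R ** V ** conj_mat V))"
    by (simp add: d2log_def V_def[symmetric] Z_def[symmetric] R_def[symmetric] matrix_ring trace_add)
  define c where "c = trace (R ** V ** conj_mat Z ** R ** V ** conj_mat Z)"
  \<comment> \<open>The scalars a and b stand for the factors acquired by V and by its conjugate, so
    that \<open>a = \<i>\<close> and \<open>b = - \<i>\<close> give the second direction.\<close>
  have sc: "R ** (mat a ** V ** conj_mat Z + Z ** (mat b ** conj_mat V)) ** R ** (mat a ** V) ** conj_mat Z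
      = mat (a * a) ** (R ** V ** conj_mat Z ** R ** V ** conj_mat Z)
      + mat (a * b) ** (R ** Z ** conj_mat V ** R ** V ** conj_mat Z)" for a b
    by (simp only: matrix_add_ldistrib matrix_add_rdistrib matrix_mul_assoc[symmetric] pulls mm mult.commute)
  have e2: "d2log z (\<i> *s v) (\<i> *s v) = - 2 * Re c
      + 2 * Re (trace (R ** Z ** conj_mat V ** R ** V ** conj_mat Z)) + 2 * Re (trace (R ** V ** conj_mat V))"
  proof -
    have "R ** (mat \<i> ** V) ** (mat (- \<i>) ** conj_mat V) = R ** V ** conj_mat V"
      by (simp only: matrix_mul_assoc[symmetric] pulls mm) simp
    then show ?thesis
      using sc[of \<i> "- \<i>"]
      by (simp add: d2log_def V_def[symmetric] Z_def[symmetric] R_def[symmetric] Zpart_scale conj_mat_mult conj_mat_mat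
          trace_add t c_def)
  qed
  have "trace (R ** Z ** conj_mat V ** R ** V ** conj_mat Z)
      = trace ((A ** V ** conj_mat Z ** adj A) ** adj (A ** V ** conj_mat Z ** adj A))"
  proof -
    have "trace (R ** Z ** conj_mat V ** R ** V ** conj_mat Z)
       = trace (adj A ** (A ** Z ** conj_mat V ** adj A ** A ** V ** conj_mat Z))"
      by (simp add: R_def A matrix_mul_assoc)
    also have "\<dots> = trace ((A ** Z ** conj_mat V ** adj A) ** (A ** V ** conj_mat Z ** adj A))"
      by (subst trace_mul_sym) (simp add: matrix_mul_assoc)
    also have "\<dots> = trace ((A ** V ** conj_mat Z ** adj A) ** (A ** Z ** conj_mat V ** adj A))"
      by (rule trace_mul_sym)
    finally show ?thesis by (simp add: adj_mult aV matrix_mul_assoc)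
  qed
  then have 1: "trace (R ** Z ** conj_mat V ** R ** V ** conj_mat Z)
      = of_real ((norm (A ** V ** conj_mat Z ** adj A))\<^sup>2)"
    by (simp only: trace_adj_self)
  have "trace (R ** V ** conj_mat V) = trace ((A ** V) ** adj (A ** V))"
  proof -
    have "trace (R ** V ** conj_mat V) = trace (adj A ** (A ** V ** conj_mat V))"
      by (simp add: R_def A matrix_mul_assoc)
    also have "\<dots> = trace ((A ** V ** conj_mat V) ** adj A)" by (rule trace_mul_sym)
    finally show ?thesis by (simp add: adj_mult aV matrix_mul_assoc)
  qed
  then have 2: "trace (R ** V ** conj_mat V) = of_real ((norm (A ** V))\<^sup>2)"
    by (simp only: trace_adj_self)
  show ?thesis
    unfolding levi_q_def e1 e2 1 2 c_def[symmetric] by (simp add: V_def Z_def)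
qed

lemma levi_q_nonneg: "z \<in> dom0 \<Longrightarrow> levi_q z v \<ge> 0"
  by (rule MZ_factor, assumption) (simp add: levi_q_eq)

lemma levi_q_zero:
  fixes z :: "complex^('p::finite uprod + 'r::finite)"
  assumes "z \<in> dom0" "levi_q z v = 0"
  shows "Zpart v = 0"
proof -
  obtain A where A: "matrix_inv (MZ z) = adj A ** A" "det A \<noteq> 0" using MZ_factor[OF assms(1)] .
  have "(norm (A ** Zpart v))\<^sup>2 = 0"
    using assms(2) unfolding levi_q_eq[OF assms(1) A(1)] by (simp add: add_nonneg_eq_0_iff)
  then have "A ** Zpart v = 0" by simp
  then have "matrix_inv A ** (A ** Zpart v) = 0" by (simp add: vec_eq_iff matrix_matrix_mult_def)
  then show ?thesis using matrix_inv_mult[OF A(2)] by (simp add: matrix_mul_assoc)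
qed

subsection \<open>Potentials \<open>C h + G(X)\<close>\<close>

definition hfun :: "real \<Rightarrow> complex^('p::finite uprod + 'r::finite) \<Rightarrow> real" where
  "hfun K z = - ln (detZ z) / K"

lemma X_II_eq:
  assumes "z \<in> dom0"
  shows "X_II K z = (norm (wpart z))\<^sup>2 * exp (hfun K z)"
  using detZ_pos[OF assms] by (simp add: X_II_def hfun_def powr_def)

lemma Y_II_iff:
  assumes "K > 0"
  shows "z \<in> Y_II K \<longleftrightarrow> z \<in> dom0 \<and> X_II K z < 1"
proof (cases "z \<in> dom0")
  case True
  have "(norm (wpart z))\<^sup>2 < detZ z powr (1 / K) \<longleftrightarrow> (norm (wpart z))\<^sup>2 * detZ z powr (- 1 / K) < 1"
    using detZ_pos[OF True] by (simp add: powr_minus_divide divide_simps powr_minus[of _ "1/K", simplified])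
  then show ?thesis using True by (simp add: Y_II_def X_II_def R_II_iff dom0_def)
qed (simp add: Y_II_def R_II_iff dom0_def)

text \<open>The scalar in front of w is the (1,0) derivative of h along v, so this is the covariant
  derivative of w for the Hermitian weight \<open>exp h\<close>.\<close>

definition levi_om :: "real \<Rightarrow> complex^('p::finite uprod + 'r::finite) \<Rightarrow> complex^('p uprod + 'r) \<Rightarrow> complex^'r" where
  "levi_om K z v = wpart v + ((of_real (dlog z v) - \<i> * of_real (dlog z (\<i> *s v))) / (2 * of_real K)) *s wpart z"

text \<open>The Levi form of \<open>G(X)\<close> is \<open>G'\<close> times that of X plus
  \<open>G''\<close> times the squared modulus of the (1,0) derivative of X. For
  \<open>X = |w|^2 exp h\<close>, completing the square with \<open>om = levi_om K z v\<close> gives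
  the Levi form \<open>exp h (|om|^2 + |w|^2 Levi(h))\<close> and the (1,0) derivative
  \<open>exp h <om, w>\<close>.\<close>

lemma levi_form:
  fixes g :: "complex^('p::finite uprod + 'r::finite) \<Rightarrow> real"
  assumes S: "open S" "S \<subseteq> dom0" "z \<in> S" and K: "K > 0"
    and g: "\<And>u. u \<in> S \<Longrightarrow> g u = C * hfun K u + G (X_II K u) + c"
    and G1: "\<And>u. u \<in> S \<Longrightarrow> (G has_real_derivative G1 (X_II K u)) (at (X_II K u))"
    and G2: "(G1 has_real_derivative G2) (at (X_II K z))"
  shows "potential_metric g z v =
      C * (levi_q z v / K)
      + G1 (X_II K z) * (exp (hfun K z) * ((norm (levi_om K z v))\<^sup>2 + (norm (wpart z))\<^sup>2 * (levi_q z v / K)))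
      + G2 * ((exp (hfun K z))\<^sup>2 * (cmod (herm (levi_om K z v) (wpart z)))\<^sup>2)"
proof -
  define W where "W u = (norm (wpart u))\<^sup>2" for u :: "complex^('p uprod + 'r)"
  define DX where "DX u v = exp (hfun K u) * (2 * (wpart u \<bullet> wpart v) + W u * (dlog u v / K))" for u v :: "complex^('p uprod + 'r)"
  define Dg where "Dg u v = C * (dlog u v / K) + G1 (X_II K u) * DX u v" for u v
  have h': "(hfun K has_derivative (\<lambda>v. dlog u v / K)) (at u)" if "u \<in> dom0" for u :: "complex^('p uprod + 'r)"
    using bounded_linear.has_derivative[OF bounded_linear_divide ln_detZ_has_derivative[OF that], of K]
    by (simp add: hfun_def[abs_def])
  have e': "((\<lambda>u. exp (hfun K u)) has_derivative (\<lambda>v. exp (hfun K u) * (dlog u v / K))) (at u)" if "u \<in> dom0" for u :: "complex^('p uprod + 'r)"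
    using has_derivative_exp[OF h'[OF that]] by (simp add: mult.commute)
  have w': "(wpart has_derivative wpart) (at u)" for u :: "complex^('p uprod + 'r)"
    by (rule bounded_linear_imp_has_derivative[OF bounded_linear_wpart])
  have W': "(W has_derivative (\<lambda>v. 2 * (wpart u \<bullet> wpart v))) (at u)" for u
    unfolding W_def[abs_def] power2_norm_eq_inner
    by (rule has_derivative_eq_rhs[OF has_derivative_inner[OF w' w']]) (auto simp: inner_commute)
  have X': "(X_II K has_derivative DX u) (at u)" if "u \<in> dom0" for u
  proof -
    have "((\<lambda>u. W u * exp (hfun K u)) has_derivative DX u) (at u)"
      by (rule has_derivative_eq_rhs[OF has_derivative_mult[OF W' e'[OF that]]])
         (auto simp: DX_def fun_eq_iff algebra_simps)
    then show ?thesis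
      by (rule has_derivative_transform_within_open[OF _ open_dom0 that]) (simp add: X_II_eq W_def)
  qed
  have g': "(g has_derivative Dg u) (at u)" if "u \<in> S" for u
  proof -
    have u: "u \<in> dom0" using that S by auto
    have "((\<lambda>u. G (X_II K u)) has_derivative (\<lambda>v. G1 (X_II K u) * DX u v)) (at u)"
      using has_derivative_compose[OF X'[OF u] G1[OF that, unfolded has_field_derivative_def]] by (simp add: mult.commute)
    then have "((\<lambda>u. C * hfun K u + G (X_II K u) + c) has_derivative (\<lambda>v. C * (dlog u v / K) + G1 (X_II K u) * DX u v + 0)) (at u)"
      by (intro has_derivative_add has_derivative_mult_right h'[OF u] has_derivative_const)
    then have "((\<lambda>u. C * hfun K u + G (X_II K u) + c) has_derivative Dg u) (at u)"
      by (simp add: Dg_def[abs_def])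
    then show ?thesis
      by (rule has_derivative_transform_within_open[OF _ S(1) that]) (simp add: g)
  qed
  have z: "z \<in> dom0" using S by auto
  \<comment> \<open>The derivative of \<open>DX\<close> at z. \<open>H\<close> is then the real
    Hessian of g, to be evaluated on v and on \<open>\<i> *s v\<close>.\<close>
  define HX where "HX v u = exp (hfun K z) * (dlog z u / K) * (2 * (wpart z \<bullet> wpart v) + W z * (dlog z v / K))
      + exp (hfun K z) * (2 * (wpart u \<bullet> wpart v) + (2 * (wpart z \<bullet> wpart u) * (dlog z v / K) + W z * (d2log z v u / K)))" for v u
  define H where "H v u = C * (d2log z v u / K) + (G2 * DX z u * DX z v + G1 (X_II K z) * HX v u)" for v u
  have L': "((\<lambda>u. dlog u v / K) has_derivative (\<lambda>u. d2log z v u / K)) (at z)" for v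
    by (rule bounded_linear.has_derivative[OF bounded_linear_divide dlog_has_derivative[OF z]])
  have DX': "((\<lambda>u. DX u v) has_derivative HX v) (at z)" for v
  proof -
    have "((\<lambda>u. 2 * (wpart u \<bullet> wpart v) + W u * (dlog u v / K)) has_derivative
        (\<lambda>u. 2 * (wpart u \<bullet> wpart v) + (W z * (d2log z v u / K) + 2 * (wpart z \<bullet> wpart u) * (dlog z v / K)))) (at z)"
      by (intro has_derivative_add has_derivative_mult_right has_derivative_inner_left w' has_derivative_mult W' L')
    from has_derivative_mult[OF e'[OF z] this] show ?thesis
      unfolding DX_def[abs_def] by (rule has_derivative_eq_rhs) (auto simp: HX_def fun_eq_iff)
  qed
  have G1': "((\<lambda>u. G1 (X_II K u)) has_derivative (\<lambda>u. G2 * DX z u)) (at z)"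
    using has_derivative_compose[OF X'[OF z] G2[unfolded has_field_derivative_def]] by simp
  have Dg': "((\<lambda>u. Dg u v) has_derivative H v) (at z)" for v
    unfolding Dg_def[abs_def]
    by (rule has_derivative_eq_rhs[OF has_derivative_add[OF has_derivative_mult_right[OF L'] has_derivative_mult[OF G1' DX']]])
       (auto simp: H_def fun_eq_iff)
  have pm: "potential_metric g z v = (H v v + H (\<i> *s v) (\<i> *s v)) / 4"
    by (rule potential_metric_hessian[OF S(1,3) g' Dg'])
  define w where "w = wpart z"
  define dw where "dw = wpart v"
  define a b where "a = dlog z v / K" and "b = dlog z (\<i> *s v) / K"
  define \<eta> where "\<eta> = herm dw w"
  define s s' where "s = w \<bullet> dw" and "s' = w \<bullet> (\<i> *s dw)"
  have s: "s = Re \<eta>" "s' = - Im \<eta>"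
    using Re_herm[of dw w] Re_herm[of "\<i> *s dw" w]
    by (simp_all add: s_def s'_def \<eta>_def inner_commute[of w] herm_scale_left)
  define \<theta> where "\<theta> = (of_real a - \<i> * of_real b) / 2"
  have \<theta>: "Re \<theta> = a / 2" "Im \<theta> = - b / 2" by (simp_all add: \<theta>_def)
  have om: "levi_om K z v = dw + \<theta> *s w"
    by (simp add: levi_om_def dw_def w_def \<theta>_def a_def b_def diff_divide_distrib mult.commute)
  \<comment> \<open>Up to the factor \<open>exp h\<close>, the two numbers squared on the right are
    half the derivatives of X along v and \<open>\<i> *s v\<close>.\<close>
  have tau: "(cmod (herm (levi_om K z v) (wpart z)))\<^sup>2 = (s + W z * a / 2)\<^sup>2 + (s' + W z * b / 2)\<^sup>2"
    unfolding om w_def[symmetric] herm_add_left herm_scale_left herm_self \<eta>_def[symmetric] cmod_power2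
    by (simp add: s \<theta> W_def w_def power2_eq_square algebra_simps)
  have Om: "(norm (levi_om K z v))\<^sup>2 = (norm dw)\<^sup>2 + a * s + b * s' + (a\<^sup>2 + b\<^sup>2) / 4 * W z"
  proof -
    have 1: "dw \<bullet> (\<theta> *s w) = Re (cnj \<theta> * \<eta>)" using Re_herm[of dw "\<theta> *s w"] by (simp add: herm_scale_right \<eta>_def)
    have 2: "(norm (\<theta> *s w))\<^sup>2 = (cmod \<theta>)\<^sup>2 * W z"
    proof -
      have "of_real ((norm (\<theta> *s w))\<^sup>2) = (of_real ((cmod \<theta>)\<^sup>2 * W z) :: complex)"
        unfolding herm_self[symmetric] herm_scale_left herm_scale_right W_def w_def[symmetric] of_real_mult complex_norm_square
        by (simp add: herm_self mult.assoc)
      then show ?thesis by (simp only: of_real_eq_iff)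
    qed
    show ?thesis
      unfolding om power2_norm_eq_inner inner_add_left inner_add_right inner_commute[of "\<theta> *s w" dw] 1
      unfolding power2_norm_eq_inner[symmetric] 2 cmod_power2
      by (simp add: s \<theta> power2_eq_square field_simps)
  qed
  have wi: "wpart (\<i> *s v) = \<i> *s dw" by (simp add: wpart_scale dw_def)
  have ni: "(\<i> *s dw) \<bullet> (\<i> *s dw) = (norm dw)\<^sup>2"
    unfolding power2_norm_eq_inner[symmetric] by (simp add: norm_vec_def norm_mult)
  define E where "E = exp (hfun K z)"
  define q1 q2 where "q1 = d2log z v v" and "q2 = d2log z (\<i> *s v) (\<i> *s v)"
  have Hv: "H v v = C * (q1 / K) + (G2 * (E * (2 * s + W z * a))\<^sup>2 + G1 (X_II K z) *
      (E * a * (2 * s + W z * a) + E * (2 * (norm dw)\<^sup>2 + (2 * s * a + W z * (q1 / K)))))"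
    by (simp add: H_def DX_def HX_def E_def q1_def a_def s_def w_def dw_def dot_square_norm power2_eq_square)
  have Hiv: "H (\<i> *s v) (\<i> *s v) = C * (q2 / K) + (G2 * (E * (2 * s' + W z * b))\<^sup>2 + G1 (X_II K z) *
      (E * b * (2 * s' + W z * b) + E * (2 * (norm dw)\<^sup>2 + (2 * s' * b + W z * (q2 / K)))))"
    by (simp add: H_def DX_def HX_def E_def q2_def b_def s'_def w_def wi ni power2_eq_square)
  have q: "levi_q z v = (q1 + q2) / 4" by (simp add: levi_q_def q1_def q2_def)
  show ?thesis
    unfolding pm Hv Hiv tau Om q E_def[symmetric] W_def[symmetric]
    using K by (simp add: field_simps power2_eq_square)
qed

section \<open>Comparison of power series\<close>

definition psum :: "(nat \<Rightarrow> real) \<Rightarrow> real \<Rightarrow> real" where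
  "psum c x = (\<Sum>m. c m * x ^ m)"

text \<open>The Taylor coefficients of \<open>1 / (1 - x) ^ (N + 1)\<close>, the model
  series.\<close>

definition nbin :: "nat \<Rightarrow> nat \<Rightarrow> real" where
  "nbin N m = real ((m + N) choose m)"

lemma nbin_pos: "nbin N m > 0"
  by (simp add: nbin_def zero_less_binomial)

lemma nbin_Suc: "real (Suc m) * nbin N (Suc m) = real (m + N + 1) * nbin N m"
proof -
  have "Suc m * (Suc (m + N) choose Suc m) = Suc (m + N) * ((m + N) choose m)"
    by (rule Suc_times_binomial)
  then have "real (Suc m * (Suc (m + N) choose Suc m)) = real (Suc (m + N) * ((m + N) choose m))"
    by (rule arg_cong)
  then show ?thesis unfolding nbin_def add_Suc of_nat_mult by (simp only: Suc_eq_plus1)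
qed

lemma inverse_power_deriv:
  fixes x :: real
  assumes "\<bar>x\<bar> < 1"
  shows "((\<lambda>x. a / (1 - x) ^ Suc k) has_real_derivative a * real (Suc k) / (1 - x) ^ (k + 2)) (at x)"
proof -
  have "((\<lambda>x. a * inverse (1 - x) ^ Suc k) has_real_derivative a * (real (Suc k) * inverse (1 - x) ^ k * inverse (1 - x) ^ 2)) (at x)"
  proof -
    have "((\<lambda>x. inverse (1 - x)) has_real_derivative inverse (1 - x) ^ 2) (at x)"
      using assms by (auto intro!: derivative_eq_intros simp: power2_eq_square)
    from DERIV_cmult[OF DERIV_power[OF this, of "Suc k"], of a] show ?thesis
      by (simp only: diff_Suc_Suc diff_zero mult_ac)
  qed
  moreover have "a * (real (Suc k) * inverse (1 - x) ^ k * inverse (1 - x) ^ 2) = a * real (Suc k) / (1 - x) ^ (k + 2)"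
    by (simp add: power_add divide_inverse power_inverse power2_eq_square)
  ultimately show ?thesis by (simp only: divide_inverse power_inverse)
qed

text \<open>Binomial series with exponent \<open>- (N + 1)\<close>, after negating the upper index
  of the coefficients.\<close>

lemma nbin_sums:
  fixes x :: real
  assumes "\<bar>x\<bar> < 1"
  shows "(\<lambda>m. nbin N m * x ^ m) sums (1 / (1 - x) ^ (N + 1))"
proof -
  have "(\<lambda>n. ((- real (N + 1)) gchoose n) * (- x) ^ n) sums (1 + (- x)) powr (- real (N + 1))"
    using assms by (intro gen_binomial_real) auto
  moreover have "((- real (N + 1)) gchoose n) * (- x) ^ n = nbin N n * x ^ n" for n
  proof -
    have "((- real (N + 1)) gchoose n) = (- 1) ^ n * ((real n + real N) gchoose n)"
      by (subst gbinomial_negated_upper) (simp add: algebra_simps)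
    also have "(real n + real N) gchoose n = nbin N n"
      by (simp add: nbin_def binomial_gbinomial)
    finally have "((- real (N + 1)) gchoose n) * (- x) ^ n = nbin N n * ((- 1) ^ n * (- x) ^ n)" by simp
    also have "(- 1) ^ n * (- x) ^ n = x ^ n" by (simp flip: power_mult_distrib)
    finally show ?thesis .
  qed
  moreover have "(1 + (- x)) powr (- real (N + 1)) = 1 / (1 - x) ^ (N + 1)"
    using assms by (simp only: powr_minus_divide) (simp add: powr_realpow add.commute del: of_nat_add of_nat_Suc power_Suc)
  ultimately show ?thesis by simp
qed

lemma
  fixes c :: "nat \<Rightarrow> real"
  assumes conv: "\<And>x. \<bar>x\<bar> < 1 \<Longrightarrow> summable (\<lambda>m. c m * x ^ m)" and x: "\<bar>x\<bar> < 1"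
  shows psum_deriv: "(psum c has_real_derivative psum (diffs c) x) (at x)"
    and summable_diffs: "summable (\<lambda>m. diffs c m * x ^ m)"
    and theta_sums: "(\<lambda>m. real m * c m * x ^ m) sums (x * psum (diffs c) x)"
proof -
  show "(psum c has_real_derivative psum (diffs c) x) (at x)"
    unfolding psum_def[abs_def] using termdiffs_strong'[of 1 c x] assms by simp
  show s: "summable (\<lambda>m. diffs c m * x ^ m)"
    using termdiff_converges[of x 1 c] assms by simp
  have "(\<lambda>m. x * (diffs c m * x ^ m)) sums (x * psum (diffs c) x)"
    unfolding psum_def by (intro sums_mult summable_sums s)
  then have "(\<lambda>m. real (Suc m) * c (Suc m) * x ^ Suc m) sums (x * psum (diffs c) x)"
    by (simp add: diffs_def mult_ac)
  then show "(\<lambda>m. real m * c m * x ^ m) sums (x * psum (diffs c) x)"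
    by (subst (asm) sums_Suc_iff) simp
qed

text \<open>
  Writing \<open>F = psum c\<close>, the quantity \<open>x (ln F)'\<close> is the mean of \<open>m\<close> for the weights
  \<open>c m x\<^sup>m\<close>, and \<open>x (x (ln F)')'\<close> is the variance. The variance is the minimum over \<open>\<mu>\<close>
  of the mean square deviation from \<open>\<mu>\<close>, hence comparable for comparable weights.
\<close>

locale comparable_series =
  fixes c :: "nat \<Rightarrow> real" and N :: nat and \<alpha> \<beta> :: real
  assumes \<alpha>: "\<alpha> > 0" and lower: "\<And>m. \<alpha> * nbin N m \<le> c m" and upper: "\<And>m. c m \<le> \<beta> * nbin N m"
begin

lemma c_pos: "c m > 0"
  using lower[of m] \<alpha> nbin_pos[of N m] by (smt (verit) mult_pos_pos)

lemma \<beta>: "\<beta> > 0"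
  using c_pos[of 0] upper[of 0] nbin_pos[of N 0] by (smt (verit) zero_less_mult_pos2)

lemma summable_b: "\<bar>x\<bar> < 1 \<Longrightarrow> summable (\<lambda>m. nbin N m * x ^ m)"
  using nbin_sums sums_summable by blast

lemma summable_c:
  assumes "\<bar>x\<bar> < 1"
  shows "summable (\<lambda>m. c m * x ^ m)"
proof (rule summable_comparison_test)
  show "summable (\<lambda>m. \<beta> * (nbin N m * \<bar>x\<bar> ^ m))" using assms by (intro summable_mult summable_b) auto
  show "\<exists>N'. \<forall>n\<ge>N'. norm (c n * x ^ n) \<le> \<beta> * (nbin N n * \<bar>x\<bar> ^ n)"
    using upper c_pos less_imp_le[OF c_pos]
    by (auto simp: norm_mult norm_power abs_mult mult.assoc[symmetric] power_abs intro!: mult_right_mono)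
qed

lemma summable_dc: "\<bar>x\<bar> < 1 \<Longrightarrow> summable (\<lambda>m. diffs c m * x ^ m)"
  by (rule summable_diffs[OF summable_c])

lemma psum_pos: "0 \<le> x \<Longrightarrow> x < 1 \<Longrightarrow> psum c x > 0"
  unfolding psum_def
  using c_pos[of 0] less_imp_le[OF c_pos]
  by (intro suminf_pos2[of _ 0] summable_c) auto

lemma psum_b: "\<bar>x\<bar> < 1 \<Longrightarrow> psum (nbin N) x = 1 / (1 - x) ^ (N + 1)"
  unfolding psum_def using nbin_sums sums_unique by metis

lemma psum_db:
  assumes x: "\<bar>x\<bar> < 1"
  shows "psum (diffs (nbin N)) x = real (N + 1) / (1 - x) ^ (N + 2)"
proof (rule DERIV_unique)
  show "(psum (nbin N) has_real_derivative psum (diffs (nbin N)) x) (at x)"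
    by (rule psum_deriv[OF summable_b x])
  have "((\<lambda>x. 1 / (1 - x) ^ (N + 1)) has_real_derivative real (N + 1) / (1 - x) ^ (N + 2)) (at x)"
    using inverse_power_deriv[OF x, of 1 N] by simp
  then show "(psum (nbin N) has_real_derivative real (N + 1) / (1 - x) ^ (N + 2)) (at x)"
    by (rule has_field_derivative_transform_within_open[of _ _ _ "{-1<..<1}"]) (use x in \<open>auto simp: psum_b abs_less_iff\<close>)
qed

lemma psum_ddb:
  assumes x: "\<bar>x\<bar> < 1"
  shows "psum (diffs (diffs (nbin N))) x = real (N + 1) * real (N + 2) / (1 - x) ^ (N + 3)"
proof (rule DERIV_unique)
  show "(psum (diffs (nbin N)) has_real_derivative psum (diffs (diffs (nbin N))) x) (at x)"
    by (rule psum_deriv[OF summable_diffs[OF summable_b] x])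
  have "((\<lambda>x. real (N + 1) / (1 - x) ^ (N + 2)) has_real_derivative real (N + 1) * real (N + 2) / (1 - x) ^ (N + 3)) (at x)"
    using inverse_power_deriv[OF x, of "real (N + 1)" "N + 1"] by (simp add: numeral_3_eq_3)
  then show "(psum (diffs (nbin N)) has_real_derivative real (N + 1) * real (N + 2) / (1 - x) ^ (N + 3)) (at x)"
    by (rule has_field_derivative_transform_within_open[of _ _ _ "{-1<..<1}"]) (use x in \<open>auto simp: psum_db abs_less_iff\<close>)
qed

lemma psum_bounds:
  assumes "0 \<le> x" "x < 1"
  shows "\<alpha> / (1 - x) ^ (N + 1) \<le> psum c x" "psum c x \<le> \<beta> / (1 - x) ^ (N + 1)"
proof -
  have x: "\<bar>x\<bar> < 1" using assms by simp
  have "(\<Sum>m. \<alpha> * (nbin N m * x ^ m)) \<le> psum c x"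
    unfolding psum_def using lower assms x
    by (intro suminf_le summable_mult summable_b summable_c)
       (auto simp: mult.assoc[symmetric] intro!: mult_right_mono)
  then show "\<alpha> / (1 - x) ^ (N + 1) \<le> psum c x"
    using psum_b[OF x] suminf_mult[OF summable_b[OF x], of \<alpha>] by (simp add: psum_def)
  have "psum c x \<le> (\<Sum>m. \<beta> * (nbin N m * x ^ m))"
    unfolding psum_def using upper assms x
    by (intro suminf_le summable_mult summable_b summable_c)
       (auto simp: mult.assoc[symmetric] intro!: mult_right_mono)
  then show "psum c x \<le> \<beta> / (1 - x) ^ (N + 1)"
    using psum_b[OF x] suminf_mult[OF summable_b[OF x], of \<beta>] by (simp add: psum_def)
qed

lemma psum_diffs_bounds:
  assumes "0 \<le> x" "x < 1"
  shows "\<alpha> * real (N + 1) / (1 - x) ^ (N + 2) \<le> psum (diffs c) x"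
    "psum (diffs c) x \<le> \<beta> * real (N + 1) / (1 - x) ^ (N + 2)"
proof -
  have x: "\<bar>x\<bar> < 1" using assms by simp
  note sb = summable_diffs[OF summable_b x]
  have l: "\<alpha> * diffs (nbin N) m \<le> diffs c m" and u: "diffs c m \<le> \<beta> * diffs (nbin N) m" for m
    using mult_left_mono[OF lower[of "Suc m"], of "real (Suc m)"] mult_left_mono[OF upper[of "Suc m"], of "real (Suc m)"]
    by (simp_all add: diffs_def mult_ac)
  have "(\<Sum>m. \<alpha> * (diffs (nbin N) m * x ^ m)) \<le> psum (diffs c) x"
    unfolding psum_def using l assms x
    by (intro suminf_le summable_mult sb summable_dc)
       (auto simp: mult.assoc[symmetric] intro!: mult_right_mono)
  then show "\<alpha> * real (N + 1) / (1 - x) ^ (N + 2) \<le> psum (diffs c) x"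
    using psum_db[OF x] suminf_mult[OF sb, of \<alpha>] by (simp add: psum_def)
  have "psum (diffs c) x \<le> (\<Sum>m. \<beta> * (diffs (nbin N) m * x ^ m))"
    unfolding psum_def using u assms x
    by (intro suminf_le summable_mult sb summable_dc)
       (auto simp: mult.assoc[symmetric] intro!: mult_right_mono)
  then show "psum (diffs c) x \<le> \<beta> * real (N + 1) / (1 - x) ^ (N + 2)"
    using psum_db[OF x] suminf_mult[OF sb, of \<beta>] by (simp add: psum_def)
qed

section \<open>First and second derivative of the logarithm of the series\<close>

definition G1 :: "real \<Rightarrow> real" where "G1 x = psum (diffs c) x / psum c x"
definition G2 :: "real \<Rightarrow> real" where
  "G2 x = (psum (diffs (diffs c)) x * psum c x - (psum (diffs c) x)\<^sup>2) / (psum c x)\<^sup>2"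

lemma ln_psum_deriv:
  assumes "0 \<le> x" "x < 1"
  shows "((\<lambda>x. ln (psum c x)) has_real_derivative G1 x) (at x)"
proof -
  have x: "\<bar>x\<bar> < 1" using assms by simp
  show ?thesis
    using DERIV_chain2[OF DERIV_ln[OF psum_pos[OF assms]] psum_deriv[OF summable_c x]]
    by (simp add: G1_def field_simps)
qed

lemma G1_deriv:
  assumes "0 \<le> x" "x < 1"
  shows "(G1 has_real_derivative G2 x) (at x)"
proof -
  have x: "\<bar>x\<bar> < 1" using assms by simp
  show ?thesis
    unfolding G1_def[abs_def]
    using DERIV_divide[OF psum_deriv[OF summable_dc x] psum_deriv[OF summable_c x]] psum_pos[OF assms]
    by (simp add: G2_def power2_eq_square)
qed

lemma G1_bounds:
  assumes "0 \<le> x" "x < 1"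
  shows "\<alpha> / \<beta> * real (N + 1) * (1 / (1 - x)) \<le> G1 x" "G1 x \<le> \<beta> / \<alpha> * real (N + 1) * (1 / (1 - x))"
proof -
  \<comment> \<open>The common power of \<open>1 - x\<close> in the bounds for the series and its
    derivative; it cancels in the quotient and leaves a single factor
    \<open>1 / (1 - x)\<close>.\<close>
  define y where "y = (1 - x) ^ (N + 1)"
  have y: "y > 0" "1 - x > 0" "(1 - x) ^ (N + 2) = y * (1 - x)" using assms by (auto simp: y_def)
  note b = psum_bounds[OF assms, folded y_def] psum_diffs_bounds[OF assms, unfolded y(3)] psum_pos[OF assms]
  have d: "0 \<le> psum (diffs c) x"
    by (rule order_trans[OF _ b(3)]) (use y \<alpha> in simp)
  have "\<alpha> / \<beta> * real (N + 1) * (1 / (1 - x)) = (\<alpha> * real (N + 1) / (y * (1 - x))) / (\<beta> / y)"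
    using y \<beta> by (simp add: field_simps)
  also have "\<dots> \<le> G1 x"
    unfolding G1_def by (rule frac_le[OF d b(3) b(5) b(2)])
  finally show "\<alpha> / \<beta> * real (N + 1) * (1 / (1 - x)) \<le> G1 x" .
  have "G1 x \<le> (\<beta> * real (N + 1) / (y * (1 - x))) / (\<alpha> / y)"
    unfolding G1_def by (rule frac_le[OF _ b(4) _ b(1)]) (use y \<alpha> \<beta> in auto)
  also have "\<dots> = \<beta> / \<alpha> * real (N + 1) * (1 / (1 - x))"
    using y \<alpha> by (simp add: field_simps)
  finally show "G1 x \<le> \<beta> / \<alpha> * real (N + 1) * (1 / (1 - x))" .
qed

text \<open>Expands the square with \<open>m^2 = m + m (m - 1)\<close>: the factor m corresponds to
  \<open>x F'\<close> and the factor \<open>m (m - 1)\<close> to \<open>x^2 F''\<close>.\<close>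

lemma moment2_sums:
  fixes a :: "nat \<Rightarrow> real"
  assumes conv: "\<And>x. \<bar>x\<bar> < 1 \<Longrightarrow> summable (\<lambda>m. a m * x ^ m)" and x: "\<bar>x\<bar> < 1"
  shows "(\<lambda>m. (real m - \<mu>)\<^sup>2 * a m * x ^ m) sums
    (x * psum (diffs a) x + x\<^sup>2 * psum (diffs (diffs a)) x - 2 * \<mu> * (x * psum (diffs a) x) + \<mu>\<^sup>2 * psum a x)"
proof -
  have 0: "(\<lambda>m. a m * x ^ m) sums psum a x" unfolding psum_def by (rule summable_sums[OF conv[OF x]])
  have 1: "(\<lambda>m. real m * a m * x ^ m) sums (x * psum (diffs a) x)" by (rule theta_sums[OF conv x])
  have "(\<lambda>m. x * (real m * diffs a m * x ^ m)) sums (x * (x * psum (diffs (diffs a)) x))"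
    by (intro sums_mult theta_sums[OF summable_diffs[OF conv] x])
  then have "(\<lambda>m. real (Suc m) * (real (Suc m) - 1) * a (Suc m) * x ^ Suc m) sums (x\<^sup>2 * psum (diffs (diffs a)) x)"
    by (simp add: diffs_def power2_eq_square mult_ac)
  then have 2: "(\<lambda>m. real m * (real m - 1) * a m * x ^ m) sums (x\<^sup>2 * psum (diffs (diffs a)) x)"
    by (subst (asm) sums_Suc_iff) simp
  have "(\<lambda>m. real m * a m * x ^ m + real m * (real m - 1) * a m * x ^ m - 2 * \<mu> * (real m * a m * x ^ m) + \<mu>\<^sup>2 * (a m * x ^ m)) sums
      (x * psum (diffs a) x + x\<^sup>2 * psum (diffs (diffs a)) x - 2 * \<mu> * (x * psum (diffs a) x) + \<mu>\<^sup>2 * psum a x)"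
    by (intro sums_add sums_diff sums_mult 0 1 2)
  moreover have "(\<lambda>m. real m * a m * x ^ m + real m * (real m - 1) * a m * x ^ m - 2 * \<mu> * (real m * a m * x ^ m) + \<mu>\<^sup>2 * (a m * x ^ m))
      = (\<lambda>m. (real m - \<mu>)\<^sup>2 * a m * x ^ m)"
    by (simp add: fun_eq_iff power2_eq_square algebra_simps)
  ultimately show ?thesis by simp
qed

lemma variance_bounds:
  assumes "0 < x" "x < 1"
  shows "\<alpha> / \<beta> * real (N + 1) * (1 / (1 - x)\<^sup>2) \<le> G1 x + x * G2 x"
    "G1 x + x * G2 x \<le> \<beta> / \<alpha> * real (N + 1) * (1 / (1 - x)\<^sup>2)"
proof -
  have x: "\<bar>x\<bar> < 1" using assms by simp
  define A0 A1 A2 where "A0 = psum c x" and "A1 = x * psum (diffs c) x" and "A2 = A1 + x\<^sup>2 * psum (diffs (diffs c)) x"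
  define B0 B1 B2 where "B0 = psum (nbin N) x" and "B1 = x * psum (diffs (nbin N)) x"
    and "B2 = B1 + x\<^sup>2 * psum (diffs (diffs (nbin N))) x"
  have Ac: "(\<lambda>m. (real m - \<mu>)\<^sup>2 * c m * x ^ m) sums (A2 - 2 * \<mu> * A1 + \<mu>\<^sup>2 * A0)" for \<mu>
    using moment2_sums[OF summable_c x, of \<mu>] by (simp add: A0_def A1_def A2_def)
  have Bc: "(\<lambda>m. (real m - \<mu>)\<^sup>2 * nbin N m * x ^ m) sums (B2 - 2 * \<mu> * B1 + \<mu>\<^sup>2 * B0)" for \<mu>
    using moment2_sums[OF summable_b x, of \<mu>] by (simp add: B0_def B1_def B2_def)
  have A0: "A0 > 0" using psum_pos assms by (simp add: A0_def)
  define u where "u = 1 - x"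
  have u: "u > 0" "x = 1 - u" using assms by (auto simp: u_def)
  have B0: "B0 = 1 / u ^ (N + 1)" "B0 > 0" using psum_b[OF x] assms by (simp_all add: B0_def u_def)
  \<comment> \<open>For each fixed \<mu> the second moments about \<mu> have nonnegative terms and
    are compared term by term.\<close>
  have lo: "\<alpha> * (B2 - 2 * \<mu> * B1 + \<mu>\<^sup>2 * B0) \<le> A2 - 2 * \<mu> * A1 + \<mu>\<^sup>2 * A0" for \<mu>
  proof (rule sums_le[OF _ sums_mult[OF Bc] Ac])
    fix m
    have "\<alpha> * nbin N m * ((real m - \<mu>)\<^sup>2 * x ^ m) \<le> c m * ((real m - \<mu>)\<^sup>2 * x ^ m)"
      using assms by (intro mult_right_mono lower) auto
    then show "\<alpha> * ((real m - \<mu>)\<^sup>2 * nbin N m * x ^ m) \<le> (real m - \<mu>)\<^sup>2 * c m * x ^ m" by (simp add: mult_ac)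
  qed
  have hi: "A2 - 2 * \<mu> * A1 + \<mu>\<^sup>2 * A0 \<le> \<beta> * (B2 - 2 * \<mu> * B1 + \<mu>\<^sup>2 * B0)" for \<mu>
  proof (rule sums_le[OF _ Ac sums_mult[OF Bc]])
    fix m
    have "c m * ((real m - \<mu>)\<^sup>2 * x ^ m) \<le> \<beta> * nbin N m * ((real m - \<mu>)\<^sup>2 * x ^ m)"
      using assms by (intro mult_right_mono upper) auto
    then show "(real m - \<mu>)\<^sup>2 * c m * x ^ m \<le> \<beta> * ((real m - \<mu>)\<^sup>2 * nbin N m * x ^ m)" by (simp add: mult_ac)
  qed
  have complete: "P2 - 2 * \<mu> * P1 + \<mu>\<^sup>2 * P0 = (P2 - P1\<^sup>2 / P0) + P0 * (\<mu> - P1 / P0)\<^sup>2" if "P0 > 0" for P0 P1 P2 \<mu> :: real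
    using that by (simp add: power2_eq_square field_simps)
  have VA: "A2 - A1\<^sup>2 / A0 = A2 - 2 * (A1 / A0) * A1 + (A1 / A0)\<^sup>2 * A0"
    using complete[OF A0, of A2 "A1 / A0" A1] by simp
  have VB: "B2 - B1\<^sup>2 / B0 = B2 - 2 * (B1 / B0) * B1 + (B1 / B0)\<^sup>2 * B0"
    using complete[OF B0(2), of B2 "B1 / B0" B1] by simp
  \<comment> \<open>The variance of the model weights is at most their second moment about the mean
    \<open>A1 / A0\<close> of the weights c, and at this \<mu> the termwise bound produces the
    variance of c. The upper bound takes \<mu> to be the model mean \<open>B1 / B0\<close>.\<close>
  have 1: "\<alpha> * (B2 - B1\<^sup>2 / B0) \<le> A2 - A1\<^sup>2 / A0"
  proof -
    have "B2 - B1\<^sup>2 / B0 \<le> B2 - 2 * (A1 / A0) * B1 + (A1 / A0)\<^sup>2 * B0"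
      unfolding complete[OF B0(2)] using B0(2) by simp
    then have "\<alpha> * (B2 - B1\<^sup>2 / B0) \<le> \<alpha> * (B2 - 2 * (A1 / A0) * B1 + (A1 / A0)\<^sup>2 * B0)"
      using \<alpha> by (intro mult_left_mono) auto
    also have "\<dots> \<le> A2 - A1\<^sup>2 / A0" unfolding VA by (rule lo)
    finally show ?thesis .
  qed
  have 2: "A2 - A1\<^sup>2 / A0 \<le> \<beta> * (B2 - B1\<^sup>2 / B0)"
  proof -
    have "A2 - A1\<^sup>2 / A0 \<le> A2 - 2 * (B1 / B0) * A1 + (B1 / B0)\<^sup>2 * A0"
      unfolding complete[OF A0] using A0 by simp
    also have "\<dots> \<le> \<beta> * (B2 - B1\<^sup>2 / B0)" unfolding VB by (rule hi)
    finally show ?thesis .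
  qed
  \<comment> \<open>The variance of a negative binomial distribution, multiplied by its total mass
    \<open>B0\<close>.\<close>
  have VBx: "B2 - B1\<^sup>2 / B0 = x * real (N + 1) / u\<^sup>2 * B0"
  proof -
    have B1: "B1 = x * real (N + 1) / u * B0"
      using psum_db[OF x] u by (simp add: B1_def B0 u_def[symmetric])
    have B2: "B2 = B1 + x\<^sup>2 * (real (N + 1) * real (N + 2)) / u\<^sup>2 * B0"
      using psum_ddb[OF x] u by (simp add: B2_def B0 u_def[symmetric] power2_eq_square power3_eq_cube power_add)
    have "B2 - B1\<^sup>2 / B0 = B0 * (x * real (N + 1) / u + x\<^sup>2 * (real (N + 1) * real (N + 2)) / u\<^sup>2 - (x * real (N + 1) / u)\<^sup>2)"
    proof -
      have "(k * B0)\<^sup>2 / B0 = k\<^sup>2 * B0" for k using B0(2) by (simp add: power2_eq_square)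
      then show ?thesis unfolding B2 B1 by (simp only:) (simp only: algebra_simps)
    qed
    also have "x * real (N + 1) / u + x\<^sup>2 * (real (N + 1) * real (N + 2)) / u\<^sup>2 - (x * real (N + 1) / u)\<^sup>2 = x * real (N + 1) / u\<^sup>2"
      using u(1) unfolding u(2) by (simp add: power2_eq_square field_simps)
    finally show ?thesis by simp
  qed
  have Gx: "x * (G1 x + x * G2 x) = (A2 - A1\<^sup>2 / A0) / A0"
    using A0 unfolding G1_def G2_def A2_def A1_def A0_def[symmetric]
    by (simp add: power2_eq_square field_simps)
  have rAB: "\<alpha> * B0 \<le> A0" "A0 \<le> \<beta> * B0"
    using psum_bounds[of x] assms by (simp_all add: A0_def B0 u_def)
  have vpos: "x * real (N + 1) / u\<^sup>2 > 0" using assms u by simp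
  have "x * (\<alpha> / \<beta> * real (N + 1) * (1 / u\<^sup>2)) = \<alpha> * (x * real (N + 1) / u\<^sup>2 * B0) / (\<beta> * B0)"
    using B0(2) \<beta> u by (simp add: field_simps)
  also have "\<dots> \<le> (A2 - A1\<^sup>2 / A0) / A0"
  proof (rule frac_le[OF _ 1[unfolded VBx] A0 rAB(2)])
    have "0 \<le> \<alpha> * (x * real (N + 1) / u\<^sup>2 * B0)"
      by (rule mult_nonneg_nonneg[OF less_imp_le[OF \<alpha>] mult_nonneg_nonneg[OF less_imp_le[OF vpos] less_imp_le[OF B0(2)]]])
    then show "0 \<le> A2 - A1\<^sup>2 / A0" using 1[unfolded VBx] by linarith
  qed
  \<comment> \<open>The factor x can be cancelled because \<open>x > 0\<close>. The value 0 occurs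
    only for \<open>w = 0\<close>, where \<open>levi_compare\<close> makes no demand on the second
    derivative.\<close>
  finally have "x * (\<alpha> / \<beta> * real (N + 1) * (1 / u\<^sup>2)) \<le> x * (G1 x + x * G2 x)" by (simp only: Gx)
  then show "\<alpha> / \<beta> * real (N + 1) * (1 / (1 - x)\<^sup>2) \<le> G1 x + x * G2 x"
    using assms(1) by (simp only: mult_le_cancel_left_pos u_def)
  have "(A2 - A1\<^sup>2 / A0) / A0 \<le> \<beta> * (x * real (N + 1) / u\<^sup>2 * B0) / (\<alpha> * B0)"
    by (rule frac_le[OF mult_nonneg_nonneg[OF less_imp_le[OF \<beta>] mult_nonneg_nonneg[OF less_imp_le[OF vpos] less_imp_le[OF B0(2)]]]
          2[unfolded VBx] mult_pos_pos[OF \<alpha> B0(2)] rAB(1)])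
  also have "\<dots> = x * (\<beta> / \<alpha> * real (N + 1) * (1 / u\<^sup>2))"
    using B0(2) \<alpha> u by (simp add: field_simps)
  finally have "x * (G1 x + x * G2 x) \<le> x * (\<beta> / \<alpha> * real (N + 1) * (1 / u\<^sup>2))" by (simp only: Gx)
  then show "G1 x + x * G2 x \<le> \<beta> / \<alpha> * real (N + 1) * (1 / (1 - x)\<^sup>2)"
    using assms(1) by (simp only: mult_le_cancel_left_pos u_def)
qed

end

text \<open>Splits \<open>\<Omega>\<close> into the component \<open>t\<close> along \<open>w\<close> and the orthogonal rest.\<close>

lemma levi_compare:
  fixes C C' g1 g1' g2 g2' q W E \<Omega> \<tau> m M :: real
  assumes q: "q \<ge> 0" and W: "W \<ge> 0" and E: "E > 0" and \<tau>: "0 \<le> \<tau>" "\<tau> \<le> \<Omega> * W" and \<Omega>: "\<Omega> \<ge> 0"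
    and C: "m * C \<le> C'" and g1: "m * g1 \<le> g1'"
    and g2: "W > 0 \<Longrightarrow> m * (g1 + W * E * g2) \<le> g1' + W * E * g2'"
  shows "m * (C * q + g1 * (E * (\<Omega> + W * q)) + g2 * (E\<^sup>2 * \<tau>))
    \<le> C' * q + g1' * (E * (\<Omega> + W * q)) + g2' * (E\<^sup>2 * \<tau>)"
proof -
  have 1: "m * C * q \<le> C' * q" using C q by (rule mult_right_mono)
  have 2: "m * g1 * (E * (W * q)) \<le> g1' * (E * (W * q))" using g1 q W E by (intro mult_right_mono) auto
  have 3: "m * (g1 * E * \<Omega> + g2 * (E\<^sup>2 * \<tau>)) \<le> g1' * E * \<Omega> + g2' * (E\<^sup>2 * \<tau>)"
  proof (cases "W = 0")
    case True
    then have "\<tau> = 0" using \<tau> by simp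
    then show ?thesis using mult_right_mono[OF g1, of "E * \<Omega>"] E \<Omega> by (simp add: mult_ac)
  next
    case False
    then have W': "W > 0" using W by simp
    define t where "t = \<tau> / W"
    have t: "0 \<le> t" "t \<le> \<Omega>" "\<tau> = W * t" using \<tau> W' by (auto simp: t_def divide_le_eq mult.commute)
    have "m * g1 * (E * (\<Omega> - t)) \<le> g1' * (E * (\<Omega> - t))" using g1 E t by (intro mult_right_mono) auto
    \<comment> \<open>Along w the two coefficients combine to \<open>G' + x G''\<close>, since
      \<open>W * E\<close> is x.\<close>
    moreover have "m * (g1 + W * E * g2) * (E * t) \<le> (g1' + W * E * g2') * (E * t)"
      using g2[OF W'] E t by (intro mult_right_mono) auto
    ultimately show ?thesis unfolding t(3) by (simp add: power2_eq_square algebra_simps)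
  qed
  show ?thesis using 1 2 3 by (simp add: algebra_simps)
qed

section \<open>Moments of the unit ball\<close>

definition ball_moment :: "'n::finite \<Rightarrow> nat \<Rightarrow> ennreal" where
  "ball_moment j m = (\<integral>\<^sup>+z. indicator (ball 0 1) z * ennreal (cmod (z $ j) ^ (2 * m)) \<partial>(lborel :: (complex^'n) measure))"

lemma measurable_vec_nth [measurable]: "(\<lambda>z::complex^'n::finite. z $ j) \<in> borel_measurable borel"
  by (intro borel_measurable_continuous_onI continuous_intros)

lemma measurable_cmod_power [measurable]:
  "(\<lambda>z::complex^'n::finite. ennreal (cmod (z $ j) ^ m)) \<in> borel_measurable borel"
  by (intro measurable_compose[OF _ measurable_ennreal] borel_measurable_continuous_onI continuous_intros)

lemma ball_borel [measurable]: "ball (x :: 'a::metric_space) e \<in> sets borel"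
  by simp

lemma nn_integral_diagonal:
  fixes c :: "'n::finite \<Rightarrow> real" and f :: "complex^'n \<Rightarrow> ennreal"
  assumes c: "\<And>i. c i > 0" and f: "f \<in> borel_measurable borel"
  shows "(\<integral>\<^sup>+z. f z \<partial>lborel) = ennreal (\<Prod>i\<in>UNIV. (c i)\<^sup>2) * (\<integral>\<^sup>+z. f (\<chi> i. of_real (c i) * z $ i) \<partial>lborel)"
proof -
  let ?L = "\<lambda>z::complex^'n. \<chi> i. of_real (c i) * z $ i"
  have lin: "linear ?L" by (rule linearI) (auto simp: vec_eq_iff algebra_simps)
  have bij: "bij ?L"
  proof (rule o_bij)
    show "(\<lambda>z. \<chi> i. of_real (1 / c i) * z $ i) \<circ> ?L = id" "?L \<circ> (\<lambda>z. \<chi> i. of_real (1 / c i) * z $ i) = id"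
      using c by (auto simp: fun_eq_iff vec_eq_iff less_imp_neq[symmetric])
  qed
  have m: "?L \<in> borel_measurable borel"
    by (intro borel_measurable_continuous_onI linear_continuous_on) (simp add: lin flip: linear_conv_bounded_linear)
  have "(\<integral>\<^sup>+z. f z * indicator UNIV z \<partial>lborel) = (\<integral>\<^sup>+z. f (?L z) * ennreal (\<Prod>i\<in>UNIV. (c i)\<^sup>2) * indicator UNIV z \<partial>lborel)"
    by (rule nn_integral_change_of_variables[where g' = "\<lambda>_. ?L" and a = "\<lambda>_. \<Prod>i\<in>UNIV. (c i)\<^sup>2"])
       (use lin bij f in \<open>auto intro: linear_imp_has_derivative simp: adet_real_diagonal\<close>)
  also have "\<dots> = ennreal (\<Prod>i\<in>UNIV. (c i)\<^sup>2) * (\<integral>\<^sup>+z. f (?L z) \<partial>lborel)"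
    using f m by (subst nn_integral_cmult[symmetric]) (auto simp: mult.commute)
  finally show ?thesis by simp
qed

lemma norm_scaleR_coord: "(norm (\<chi> i. of_real (c i) * z $ i :: complex^'n::finite))\<^sup>2 = (\<Sum>i\<in>UNIV. (c i)\<^sup>2 * (cmod (z $ i))\<^sup>2)"
  unfolding norm_vec_def L2_set_def by (simp add: sum_nonneg norm_mult power_mult_distrib)

lemma norm_remove: "(norm (z :: complex^'n::finite))\<^sup>2 = (cmod (z $ j))\<^sup>2 + (\<Sum>i\<in>UNIV - {j}. (cmod (z $ i))\<^sup>2)"
  unfolding norm_vec_def L2_set_def by (simp add: sum_nonneg sum.remove[of UNIV j])

text \<open>Scaling by \<open>sqrt t\<close> contributes \<open>t\<close> for each complex dimension
  and \<open>t ^ m\<close> from the weight.\<close>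

lemma ball_moment_scaled:
  assumes t: "t > 0"
  shows "(\<integral>\<^sup>+z. indicator {z. (norm z)\<^sup>2 < t} z * ennreal (cmod (z $ j) ^ (2 * m)) \<partial>(lborel :: (complex^'n::finite) measure))
    = ennreal (t ^ (m + CARD('n))) * ball_moment j m"
proof -
  let ?f = "\<lambda>z::complex^'n. indicator {z. (norm z)\<^sup>2 < t} z * ennreal (cmod (z $ j) ^ (2 * m))"
  have [measurable]: "{z::complex^'n. (norm z)\<^sup>2 < t} \<in> sets borel" by measurable
  have L: "(\<chi> i. of_real (sqrt t) * z $ i) = sqrt t *\<^sub>R (z :: complex^'n)" for z
    by (simp add: vec_eq_iff complex_eq_iff)
  have "(\<integral>\<^sup>+z. ?f z \<partial>lborel) = ennreal (t ^ CARD('n)) * (\<integral>\<^sup>+z. ?f (sqrt t *\<^sub>R z) \<partial>lborel)"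
    using nn_integral_diagonal[of "\<lambda>_. sqrt t" ?f] t unfolding L by simp
  also have "(\<integral>\<^sup>+z. ?f (sqrt t *\<^sub>R z) \<partial>lborel) = (\<integral>\<^sup>+z. ennreal (t ^ m) * (indicator (ball 0 1) z * ennreal (cmod (z $ j) ^ (2 * m))) \<partial>lborel)"
  proof (rule nn_integral_cong)
    fix z :: "complex^'n"
    have "(norm (sqrt t *\<^sub>R z))\<^sup>2 < t \<longleftrightarrow> norm z < 1"
      using t by (simp add: power_mult_distrib abs_square_less_1)
    moreover have "cmod ((sqrt t *\<^sub>R z) $ j) ^ (2 * m) = t ^ m * cmod (z $ j) ^ (2 * m)"
      using t by (simp add: power_mult_distrib power_mult)
    ultimately show "?f (sqrt t *\<^sub>R z) = ennreal (t ^ m) * (indicator (ball 0 1) z * ennreal (cmod (z $ j) ^ (2 * m)))"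
      using t by (auto simp: indicator_def ennreal_mult)
  qed
  also have "\<dots> = ennreal (t ^ m) * ball_moment j m"
    unfolding ball_moment_def by (rule nn_integral_cmult) measurable
  finally show ?thesis
    using t by (simp add: power_add ennreal_mult' mult_ac)
qed

text \<open>On the unit ball \<open>1 - |z|^2\<close> is the length of the interval of those t with
  \<open>|z|^2 < t <= 1\<close>. Exchanging the integrals leaves scaled moments and the integral of
  \<open>t ^ (m + n)\<close> over the unit interval.\<close>

lemma ball_moment_layer:
  "(\<integral>\<^sup>+z. indicator (ball 0 1) z * ennreal (1 - (norm z)\<^sup>2) * ennreal (cmod (z $ j) ^ (2 * m)) \<partial>(lborel :: (complex^'n::finite) measure))
    = ennreal (1 / real (m + CARD('n) + 1)) * ball_moment j m"
proof -
  let ?e = "\<lambda>z::complex^'n. ennreal (cmod (z $ j) ^ (2 * m))"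
  let ?k = "\<lambda>(z::complex^'n) (t::real). indicator {z. (norm z)\<^sup>2 < t} z * indicator {0..1} t :: ennreal"
  have [measurable]: "(\<lambda>(z, t). indicator {z. (norm z)\<^sup>2 < t} z :: ennreal) \<in> borel_measurable (borel \<Otimes>\<^sub>M borel :: ((complex^'n) \<times> real) measure)"
  proof -
    have "{zt :: (complex^'n) \<times> real. (norm (fst zt))\<^sup>2 < snd zt} \<in> sets (borel \<Otimes>\<^sub>M borel)"
      unfolding borel_prod by (intro borel_open open_Collect_less continuous_intros)
    then have "(\<lambda>zt. indicator {zt :: (complex^'n) \<times> real. (norm (fst zt))\<^sup>2 < snd zt} zt :: ennreal) \<in> borel_measurable (borel \<Otimes>\<^sub>M borel)"
      by (rule borel_measurable_indicator)
    then show ?thesis by (simp add: case_prod_beta' indicator_def)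
  qed
  have lay: "(\<integral>\<^sup>+t. ?k z t \<partial>lborel) = indicator (ball 0 1) z * ennreal (1 - (norm z)\<^sup>2)" for z
  proof -
    have "(\<integral>\<^sup>+t. ?k z t \<partial>lborel) = (\<integral>\<^sup>+t. indicator {(norm z)\<^sup>2<..1} t \<partial>lborel)"
    proof (rule nn_integral_cong)
      fix t :: real
      have "0 \<le> t" if "(norm z)\<^sup>2 < t" using le_less_trans[OF zero_le_power2 that] by simp
      then show "?k z t = indicator {(norm z)\<^sup>2<..1} t" by (auto simp: indicator_def)
    qed
    also have "\<dots> = emeasure lborel {(norm z)\<^sup>2<..1}" by simp
    also have "\<dots> = indicator (ball 0 1) z * ennreal (1 - (norm z)\<^sup>2)"
    proof (cases "norm z < 1")
      case True
      then have "(norm z)\<^sup>2 \<le> 1" by (simp add: power_le_one)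
      then show ?thesis using True by simp
    next
      case False
      then have "(norm z)\<^sup>2 \<ge> 1" by (simp add: one_le_power)
      then show ?thesis using False by simp
    qed
    finally show ?thesis .
  qed
  have "(\<integral>\<^sup>+z. indicator (ball 0 1) z * ennreal (1 - (norm z)\<^sup>2) * ?e z \<partial>lborel) = (\<integral>\<^sup>+z. (\<integral>\<^sup>+t. ?k z t * ?e z \<partial>lborel) \<partial>lborel)"
    by (intro nn_integral_cong) (simp add: nn_integral_multc lay[symmetric])
  also have "\<dots> = (\<integral>\<^sup>+t. (\<integral>\<^sup>+z. ?k z t * ?e z \<partial>lborel) \<partial>lborel)"
    by (rule lborel_pair.Fubini') measurable
  also have "\<dots> = (\<integral>\<^sup>+t. ball_moment j m * (ennreal (t ^ (m + CARD('n))) * indicator {0..1} t) \<partial>lborel)"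
  proof (rule nn_integral_cong)
    fix t :: real
    show "(\<integral>\<^sup>+z. ?k z t * ?e z \<partial>lborel) = ball_moment j m * (ennreal (t ^ (m + CARD('n))) * indicator {0..1} t)"
    proof (cases "0 < t \<and> t \<le> 1")
      case True
      then have "(\<integral>\<^sup>+z. ?k z t * ?e z \<partial>lborel) = (\<integral>\<^sup>+z. indicator {z. (norm z)\<^sup>2 < t} z * ?e z \<partial>lborel)" by simp
      then show ?thesis using True ball_moment_scaled[of t j m] by (simp add: mult.commute)
    next
      case False
      then have k0: "?k z t = 0" for z using zero_le_power2[of "norm z"] by (auto simp: indicator_def simp del: zero_le_power2)
      have p0: "ennreal (t ^ (m + CARD('n))) * indicator {0..1} t = 0" using False by (auto simp: indicator_def power_0_left)
      show ?thesis unfolding k0 p0 by simp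
    qed
  qed
  also have "\<dots> = ball_moment j m * (\<integral>\<^sup>+t. ennreal (t ^ (m + CARD('n))) * indicator {0..1} t \<partial>lborel)"
    by (rule nn_integral_cmult) measurable
  also have "(\<integral>\<^sup>+t. ennreal (t ^ (m + CARD('n))) * indicator {0..1} t \<partial>lborel)
      = ennreal (1 ^ (m + CARD('n) + 1) / real (m + CARD('n) + 1) - 0 ^ (m + CARD('n) + 1) / real (m + CARD('n) + 1))"
    by (rule nn_integral_FTC_Icc)
       (auto intro!: derivative_eq_intros simp flip: has_real_derivative_iff_has_vector_derivative simp del: of_nat_Suc of_nat_add power_Suc)
  finally show ?thesis by (simp add: mult.commute)
qed

lemma AE_coord_nonzero: "AE z in (lborel :: (complex^'n::finite) measure). z $ j \<noteq> 0"
proof -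
  have "negligible {z::complex^'n. axis j 1 \<bullet> z = 0}"
    by (rule negligible_hyperplane) (simp add: axis_eq_0_iff)
  moreover have "{z::complex^'n. z $ j = 0} \<subseteq> {z. axis j 1 \<bullet> z = 0}"
    by (auto simp: inner_axis' )
  ultimately have "negligible {z::complex^'n. z $ j = 0}" by (rule negligible_subset)
  moreover have "{z::complex^'n. z $ j = 0} \<in> sets borel" by measurable
  ultimately have "{z::complex^'n. z $ j = 0} \<in> null_sets lborel"
    by (simp add: negligible_iff_null_sets null_sets_completion_iff)
  then show ?thesis by (intro AE_I'[of "{z. z $ j = 0}"]) auto
qed

text \<open>The weight \<open>|z j|^(2 m + 2)\<close> on the ellipsoids \<open>Q a z < 1\<close> is
  integrated over \<open>a >= 1\<close> in two ways. For fixed z the admissible a fill an interval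
  of length \<open>(1 - |z|^2) / |z j|^2\<close>, which lowers the exponent and leads to
  \<open>ball_moment_layer\<close>. For fixed a the ellipsoid is the ball with its j-th coordinate
  shrunk by \<open>sqrt a\<close>, which gives \<open>a ^ (- (m + 2))\<close> times the next moment,
  and the integral over a is \<open>1 / (m + 1)\<close>.\<close>

lemma ball_moment_Suc:
  "ennreal (1 / real (Suc m)) * ball_moment (j :: 'n::finite) (Suc m) = ennreal (1 / real (m + CARD('n) + 1)) * ball_moment j m"
proof -
  let ?e = "\<lambda>k (z::complex^'n). ennreal (cmod (z $ j) ^ (2 * k))"
  define Q where "Q a z = (norm z)\<^sup>2 + (a - 1) * (cmod (z $ j))\<^sup>2" for a and z :: "complex^'n"
  have [measurable]: "(\<lambda>(z, a). indicator {z. Q a z < 1} z :: ennreal) \<in> borel_measurable (borel \<Otimes>\<^sub>M borel :: ((complex^'n) \<times> real) measure)"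
  proof -
    have "{za :: (complex^'n) \<times> real. Q (snd za) (fst za) < 1} \<in> sets (borel \<Otimes>\<^sub>M borel)"
      unfolding Q_def borel_prod by (intro borel_open open_Collect_less continuous_intros)
    then have "(\<lambda>za. indicator {za :: (complex^'n) \<times> real. Q (snd za) (fst za) < 1} za :: ennreal) \<in> borel_measurable (borel \<Otimes>\<^sub>M borel)"
      by (rule borel_measurable_indicator)
    then show ?thesis by (simp add: case_prod_beta' indicator_def)
  qed
  have scaled: "(\<integral>\<^sup>+z. indicator {z. Q a z < 1} z * ?e (Suc m) z \<partial>lborel) = ennreal (1 / a ^ (m + 2)) * ball_moment j (Suc m)" if a: "a \<ge> 1" for a
  proof -
    define c where "c i = (if i = j then sqrt a else 1)" for i
    let ?L = "\<lambda>z::complex^'n. \<chi> i. of_real (c i) * z $ i"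
    have nL: "(norm (?L z))\<^sup>2 = Q a z" for z
    proof -
      have "(norm (?L z))\<^sup>2 = a * (cmod (z $ j))\<^sup>2 + (\<Sum>i\<in>UNIV - {j}. (cmod (z $ i))\<^sup>2)"
        using a unfolding norm_scaleR_coord by (simp add: sum.remove[of UNIV j] c_def)
      then show ?thesis unfolding Q_def norm_remove[of z j] by (simp add: algebra_simps)
    qed
    have pr: "(\<Prod>i\<in>UNIV. (c i)\<^sup>2) = a"
    proof -
      have "(c i)\<^sup>2 = (if i = j then a else 1)" for i using a by (simp add: c_def)
      then show ?thesis by simp
    qed
    have "ball_moment j (Suc m) = ennreal a * (\<integral>\<^sup>+z. indicator (ball 0 1) (?L z) * ?e (Suc m) (?L z) \<partial>lborel)"
      unfolding ball_moment_def
      by (subst nn_integral_diagonal[where c = c]) (use a in \<open>auto simp: c_def pr[unfolded c_def]\<close>)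
    also have "(\<integral>\<^sup>+z. indicator (ball 0 1) (?L z) * ?e (Suc m) (?L z) \<partial>lborel)
        = (\<integral>\<^sup>+z. ennreal (a ^ Suc m) * (indicator {z. Q a z < 1} z * ?e (Suc m) z) \<partial>lborel)"
    proof (rule nn_integral_cong)
      fix z
      have "norm (?L z) < 1 \<longleftrightarrow> Q a z < 1" unfolding nL[symmetric] by (simp add: abs_square_less_1)
      moreover have "cmod (?L z $ j) ^ (2 * Suc m) = a ^ Suc m * cmod (z $ j) ^ (2 * Suc m)"
      proof -
        have "sqrt a ^ (2 * Suc m) = a ^ Suc m" using a by (simp only: power_mult) simp
        moreover have "cmod (?L z $ j) = sqrt a * cmod (z $ j)" using a by (simp add: c_def norm_mult)
        ultimately show ?thesis by (simp only: power_mult_distrib)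
      qed
      ultimately show "indicator (ball 0 1) (?L z) * ?e (Suc m) (?L z) = ennreal (a ^ Suc m) * (indicator {z. Q a z < 1} z * ?e (Suc m) z)"
        using a by (auto simp: indicator_def ennreal_mult simp del: power_Suc)
    qed
    also have "\<dots> = ennreal (a ^ Suc m) * (\<integral>\<^sup>+z. indicator {z. Q a z < 1} z * ?e (Suc m) z \<partial>lborel)"
      by (rule nn_integral_cmult) (unfold Q_def, measurable)
    finally have "ennreal (1 / a ^ (m + 2)) * ball_moment j (Suc m) = 
       (ennreal (1 / a ^ (m + 2)) * ennreal a * ennreal (a ^ Suc m)) * (\<integral>\<^sup>+z. indicator {z. Q a z < 1} z * ?e (Suc m) z \<partial>lborel)"
      by (simp add: mult.assoc del: power_Suc)
    also have "ennreal (1 / a ^ (m + 2)) * ennreal a * ennreal (a ^ Suc m) = 1"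
    proof -
      have "1 / a ^ (m + 2) * a * a ^ Suc m = 1" using a by simp
      then show ?thesis using a by (simp add: ennreal_mult[symmetric] del: power_Suc)
    qed
    finally show ?thesis by simp
  qed
  have lay: "(\<integral>\<^sup>+a. indicator {z. Q a z < 1} z * indicator {1..} a * ?e (Suc m) z \<partial>lborel)
      = indicator (ball 0 1) z * ennreal (1 - (norm z)\<^sup>2) * ?e m z" if zj: "z $ j \<noteq> 0" for z
  proof -
    define s where "s = (cmod (z $ j))\<^sup>2"
    have s: "s > 0" using zj by (simp add: s_def)
    have "(\<integral>\<^sup>+a. indicator {z. Q a z < 1} z * indicator {1..} a \<partial>lborel) = (\<integral>\<^sup>+a. indicator {1..<1 + (1 - (norm z)\<^sup>2) / s} a \<partial>lborel)"
      using s by (intro nn_integral_cong) (auto simp: indicator_def Q_def s_def[symmetric] field_simps)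
    also have "\<dots> = emeasure lborel {1..<1 + (1 - (norm z)\<^sup>2) / s}" by simp
    also have "\<dots> = indicator (ball 0 1) z * ennreal ((1 - (norm z)\<^sup>2) / s)"
    proof (cases "norm z < 1")
      case True
      then have "(1 - (norm z)\<^sup>2) / s \<ge> 0" using s by (simp add: abs_square_le_1)
      then show ?thesis using True by simp
    next
      case False
      then have "(norm z)\<^sup>2 \<ge> 1" by (simp add: one_le_power)
      then have "(1 - (norm z)\<^sup>2) / s \<le> 0" using s by (simp add: divide_le_0_iff)
      then show ?thesis using False by (simp add: atLeastLessThan_empty)
    qed
    finally have 1: "(\<integral>\<^sup>+a. indicator {z. Q a z < 1} z * indicator {1..} a \<partial>lborel) = indicator (ball 0 1) z * ennreal ((1 - (norm z)\<^sup>2) / s)" .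
    have "(\<integral>\<^sup>+a. indicator {z. Q a z < 1} z * indicator {1..} a * ?e (Suc m) z \<partial>lborel)
       = indicator (ball 0 1) z * ennreal ((1 - (norm z)\<^sup>2) / s) * ?e (Suc m) z"
    proof -
      have [measurable]: "(\<lambda>a. indicator {z. Q a z < 1} z :: ennreal) \<in> borel_measurable borel"
      proof -
        have "(\<lambda>a. indicator {z. Q a z < 1} z :: ennreal) = indicator {a. Q a z < 1}" by (auto simp: indicator_def)
        then show ?thesis unfolding Q_def by simp
      qed
      show ?thesis by (subst nn_integral_multc) (simp_all add: 1)
    qed
    also have "\<dots> = indicator (ball 0 1) z * ennreal (1 - (norm z)\<^sup>2) * ?e m z"
    proof (cases "norm z < 1")
      case True
      have "(1 - (norm z)\<^sup>2) / s * cmod (z $ j) ^ (2 * Suc m) = (1 - (norm z)\<^sup>2) * cmod (z $ j) ^ (2 * m)"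
      proof -
        have "cmod (z $ j) ^ (2 * Suc m) = s * cmod (z $ j) ^ (2 * m)"
          unfolding s_def by (simp only: mult_Suc_right power_add)
        then show ?thesis using s by (simp only:) simp
      qed
      moreover have "1 - (norm z)\<^sup>2 \<ge> 0" using True by (simp add: abs_square_le_1)
      ultimately show ?thesis using True s by (simp add: ennreal_mult[symmetric] del: power_Suc mult_Suc_right)
    qed simp
    finally show ?thesis .
  qed
  have "ennreal (1 / real (m + CARD('n) + 1)) * ball_moment j m
     = (\<integral>\<^sup>+z. (\<integral>\<^sup>+a. indicator {z. Q a z < 1} z * indicator {1..} a * ?e (Suc m) z \<partial>lborel) \<partial>lborel)"
    unfolding ball_moment_layer[symmetric]
  \<comment> \<open>On the null set \<open>z $ j = 0\<close> the identity can fail: the interval of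
    admissible a is infinite there while its weight is zero.\<close>
  proof (rule nn_integral_cong_AE)
    show "AE z in (lborel :: (complex^'n) measure). indicator (ball 0 1) z * ennreal (1 - (norm z)\<^sup>2) * ?e m z
        = (\<integral>\<^sup>+a. indicator {z. Q a z < 1} z * indicator {1..} a * ?e (Suc m) z \<partial>lborel)"
      using AE_coord_nonzero[of j] by eventually_elim (rule lay[symmetric])
  qed
  also have "\<dots> = (\<integral>\<^sup>+a. (\<integral>\<^sup>+z. indicator {z. Q a z < 1} z * indicator {1..} a * ?e (Suc m) z \<partial>lborel) \<partial>lborel)"
    by (rule lborel_pair.Fubini') measurable
  also have "\<dots> = (\<integral>\<^sup>+a. ball_moment j (Suc m) * (ennreal (1 / a ^ (m + 2)) * indicator {1..} a) \<partial>lborel)"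
  proof (rule nn_integral_cong)
    fix a :: real
    show "(\<integral>\<^sup>+z. indicator {z. Q a z < 1} z * indicator {1..} a * ?e (Suc m) z \<partial>lborel)
       = ball_moment j (Suc m) * (ennreal (1 / a ^ (m + 2)) * indicator {1..} a)"
      using scaled[of a] by (cases "a \<ge> 1") (simp_all add: mult.commute)
  qed
  also have "\<dots> = ball_moment j (Suc m) * (\<integral>\<^sup>+a. ennreal (1 / a ^ (m + 2)) * indicator {1..} a \<partial>lborel)"
    by (rule nn_integral_cmult) measurable
  also have "(\<integral>\<^sup>+a. ennreal (1 / a ^ (m + 2)) * indicator {1..} a \<partial>lborel) = ennreal (0 - (- 1 / (real (Suc m) * 1 ^ Suc m)))"
  proof (rule nn_integral_FTC_atLeast[where F = "\<lambda>x. - 1 / (real (Suc m) * x ^ Suc m)" and T = 0])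
    show "((\<lambda>x. - 1 / (real (Suc m) * x ^ Suc m)) has_real_derivative 1 / x ^ (m + 2)) (at x)" if "1 \<le> x" for x :: real
    proof -
      have "((\<lambda>x. (- 1 / real (Suc m)) * inverse (x ^ Suc m)) has_real_derivative
          (- 1 / real (Suc m)) * - (inverse (x ^ Suc m) * (real (Suc m) * x ^ m) * inverse (x ^ Suc m))) (at x)"
      proof -
        have "((\<lambda>x. x ^ Suc m) has_real_derivative real (Suc m) * x ^ m) (at x)"
          using DERIV_pow[of "Suc m" x] by (simp only: diff_Suc_Suc diff_zero)
        then show ?thesis by (rule DERIV_cmult[OF DERIV_inverse']) (use that in simp)
      qed
      moreover have "(- 1 / real (Suc m)) * - (inverse (x ^ Suc m) * (real (Suc m) * x ^ m) * inverse (x ^ Suc m)) = 1 / x ^ (m + 2)"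
      proof -
        have "(- 1 / k) * - (inverse (x * y) * (k * y) * inverse (x * y)) = 1 / (y * x\<^sup>2)"
          if "x \<noteq> 0" "y \<noteq> 0" "k \<noteq> 0" for x y k :: real
          using that by (simp add: field_simps power2_eq_square)
        from this[of x "x ^ m" "real (Suc m)"] show ?thesis
          using that by (simp add: power_add power2_eq_square del: of_nat_Suc)
      qed
      moreover have "(- 1 / real (Suc m)) * inverse (x ^ Suc m) = - 1 / (real (Suc m) * x ^ Suc m)" for x :: real
        by (simp add: field_simps)
      ultimately show ?thesis by simp
    qed
    have "((\<lambda>x::real. - 1 / (real (Suc m) * x ^ Suc m)) \<longlongrightarrow> 0) at_top"
      by (intro tendsto_divide_0[OF tendsto_const] filterlim_at_top_imp_at_infinity
          filterlim_tendsto_pos_mult_at_top[OF tendsto_const] filterlim_pow_at_top filterlim_ident) auto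
    then show "((\<lambda>x::real. - 1 / (real (Suc m) * x ^ Suc m)) \<longlongrightarrow> 0) at_top" .
  qed auto
  finally show ?thesis by (simp add: mult.commute)
qed

section \<open>Automorphisms of \<open>Y\<^sub>I\<^sub>I\<close>\<close>

text \<open>
  \<open>mob_pair a b\<close> says that the block matrix with rows \<open>(a, b)\<close> and \<open>(conj b, conj a)\<close>
  lies in \<open>U(p,p) \<inter> Sp(2p)\<close>.
\<close>

definition mob_pair :: "complex^'p::finite^'p \<Rightarrow> complex^'p^'p \<Rightarrow> bool" where
  "mob_pair a b \<longleftrightarrow> adj a ** a - transpose b ** conj_mat b = mat 1 \<and>
     adj a ** b = transpose b ** conj_mat a \<and>
     a ** adj a - b ** adj b = mat 1 \<and> a ** transpose b = b ** transpose a"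

lemma adj_add: "adj (A + B) = adj A + adj B"
  and adj_minus: "adj (- A) = - adj A"
  and adj_conj: "adj (conj_mat A) = transpose A"
  and adj_transpose: "adj (transpose A) = conj_mat A"
  and conj_adj: "conj_mat (adj A) = transpose A"
  and transpose_adj: "transpose (adj A) = conj_mat A"
  and transpose_conj: "transpose (conj_mat A) = adj A"
  by (simp_all add: vec_eq_iff transpose_def)

text \<open>The new pair is the first block row of the inverse matrix, as pseudo-unitarity
  dictates.\<close>

lemma mob_pair_inverse: "mob_pair a b \<Longrightarrow> mob_pair (adj a) (- transpose b)"
  unfolding mob_pair_def
  by (simp add: adj_minus transpose_minus conj_mat_minus matrix_minus_left matrix_minus_right
      adj_transpose conj_adj transpose_adj conj_mat_transpose transpose_conj)

text \<open>The block matrix sends the stacked column of Z and the identity to that of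
  \<open>mob_num\<close> and \<open>mob_den\<close>; the quotient of the two is the Moebius
  map.\<close>

definition mob_den :: "complex^'p::finite^'p \<Rightarrow> complex^'p^'p \<Rightarrow> complex^'p^'p \<Rightarrow> complex^'p^'p" where
  "mob_den a b Z = conj_mat b ** Z + conj_mat a"

definition mob_num :: "complex^'p::finite^'p \<Rightarrow> complex^'p^'p \<Rightarrow> complex^'p^'p \<Rightarrow> complex^'p^'p" where
  "mob_num a b Z = a ** Z + b"

definition mob :: "complex^'p::finite^'p \<Rightarrow> complex^'p^'p \<Rightarrow> complex^'p^'p \<Rightarrow> complex^'p^'p" where
  "mob a b Z = mob_num a b Z ** matrix_inv (mob_den a b Z)"

context
  fixes a b :: "complex^'p::finite^'p"
  assumes ab: "mob_pair a b"
begin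

lemma mob1: "adj a ** a = mat 1 + transpose b ** conj_mat b"
  and mob2: "adj a ** b = transpose b ** conj_mat a"
  and mob3: "transpose a ** conj_mat a = mat 1 + adj b ** b"
  and mob4: "transpose a ** conj_mat b = adj b ** a"
proof -
  show 1: "adj a ** a = mat 1 + transpose b ** conj_mat b" and 2: "adj a ** b = transpose b ** conj_mat a"
    using ab by (auto simp: mob_pair_def algebra_simps)
  have "conj_mat (adj a ** a) = conj_mat (mat 1 + transpose b ** conj_mat b)" using 1 by simp
  then show "transpose a ** conj_mat a = mat 1 + adj b ** b"
    by (simp add: conj_mat_mult conj_mat_add conj_adj conj_mat_transpose transpose_conj)
  have "conj_mat (adj a ** b) = conj_mat (transpose b ** conj_mat a)" using 2 by simp
  then show "transpose a ** conj_mat b = adj b ** a"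
    by (simp add: conj_mat_mult conj_adj conj_mat_transpose transpose_conj)
qed

text \<open>The same rules behind a left factor X, because \<open>matrix_ring\<close> brackets
  products to the left.\<close>

lemma mob_assoc:
  "X ** adj a ** a = X + X ** transpose b ** conj_mat b"
  "X ** adj a ** b = X ** transpose b ** conj_mat a"
  "X ** transpose a ** conj_mat a = X + X ** adj b ** b"
  "X ** transpose a ** conj_mat b = X ** adj b ** a"
  by (simp_all add: mob1 mob2 mob3 mob4 matrix_add_ldistrib flip: matrix_mul_assoc)

lemmas mob_simps = mob1 mob2 mob3 mob4 mob_assoc

text \<open>Invariance of the indefinite Hermitian form, evaluated on the column of Z and the
  identity. Invertibility of the denominator, contractivity of the image and the change of
  \<open>detZ\<close> all follow from it.\<close>

lemma mob_den_num:
  "adj (mob_den a b Z) ** mob_den a b Z - adj (mob_num a b Z) ** mob_num a b Z = mat 1 - adj Z ** Z"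
  by (simp add: mob_den_def mob_num_def adj_add adj_mult adj_conj matrix_ring mob_simps)

text \<open>Invariance of the symplectic form; this is what keeps the image symmetric.\<close>

lemma mob_den_num_symmetric:
  assumes "transpose Z = Z"
  shows "transpose (mob_den a b Z) ** mob_num a b Z = transpose (mob_num a b Z) ** mob_den a b Z"
  by (simp add: mob_den_def mob_num_def transpose_add matrix_transpose_mul transpose_conj assms matrix_ring mob_simps)

lemma norm_den_num:
  "(norm (mob_den a b Z *v x))\<^sup>2 - (norm (mob_num a b Z *v x))\<^sup>2 = (norm x)\<^sup>2 - (norm (Z *v x))\<^sup>2"
proof -
  have h: "herm ((adj A ** A) *v x) x = of_real ((norm (A *v x))\<^sup>2)" for A :: "complex^'p^'p"
    by (metis adj_adj herm_adj herm_self matrix_vector_mul_assoc)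
  have "herm ((adj (mob_den a b Z) ** mob_den a b Z - adj (mob_num a b Z) ** mob_num a b Z) *v x) x
      = herm ((mat 1 - adj Z ** Z) *v x) x"
    by (simp only: mob_den_num)
  then have "complex_of_real ((norm (mob_den a b Z *v x))\<^sup>2 - (norm (mob_num a b Z *v x))\<^sup>2)
     = of_real ((norm x)\<^sup>2 - (norm (Z *v x))\<^sup>2)"
    by (simp only: matrix_vector_mult_diff_rdistrib herm_diff_left h matrix_vector_mul_lid herm_self of_real_diff)
  then show ?thesis by (simp only: of_real_eq_iff)
qed

lemma det_mob_den:
  assumes "contr Z"
  shows "det (mob_den a b Z) \<noteq> 0"
  unfolding det_nonzero_iff_ker
proof (intro allI impI)
  fix x assume "mob_den a b Z *v x = 0"
  then have "(norm x)\<^sup>2 - (norm (Z *v x))\<^sup>2 = - (norm (mob_num a b Z *v x))\<^sup>2"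
    using norm_den_num[of Z x] by simp
  then have "(norm x)\<^sup>2 \<le> (norm (Z *v x))\<^sup>2" using zero_le_power2[of "norm (mob_num a b Z *v x)"] by linarith
  then show "x = 0" using assms unfolding contr_def
    by (meson norm_ge_zero not_le power2_le_imp_le power_strict_mono zero_less_numeral)
qed

lemma mob_eq: "contr Z \<Longrightarrow> mob a b Z ** mob_den a b Z = mob_num a b Z"
  unfolding mob_def by (simp add: matrix_inv_mult[OF det_mob_den] flip: matrix_mul_assoc)

lemma transpose_mob:
  assumes "transpose Z = Z" "contr Z"
  shows "transpose (mob a b Z) = mob a b Z"
proof -
  let ?D = "mob_den a b Z" and ?N = "mob_num a b Z" 
  have D: "?D ** matrix_inv ?D = mat 1" "matrix_inv ?D ** ?D = mat 1"
    using matrix_inv_mult[OF det_mob_den[OF assms(2)]] by auto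
  then have tD: "transpose (matrix_inv ?D) ** transpose ?D = mat 1"
    by (metis matrix_transpose_mul transpose_mat)
  have "transpose (mob a b Z) = transpose (matrix_inv ?D) ** (transpose ?N ** ?D) ** matrix_inv ?D"
    unfolding mob_def by (simp add: matrix_transpose_mul D flip: matrix_mul_assoc)
  also have "\<dots> = (transpose (matrix_inv ?D) ** transpose ?D) ** ?N ** matrix_inv ?D"
    by (simp add: mob_den_num_symmetric[OF assms(1), symmetric] matrix_mul_assoc)
  finally show ?thesis by (simp add: tD mob_def)
qed

lemma contr_mob:
  assumes "contr Z"
  shows "contr (mob a b Z)"
  unfolding contr_def
proof (intro allI impI)
  fix y :: "complex^'p" assume y: "y \<noteq> 0"
  define x where "x = matrix_inv (mob_den a b Z) *v y"
  have Dx: "mob_den a b Z *v x = y"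
    by (simp add: x_def matrix_vector_mul_assoc matrix_inv_mult[OF det_mob_den[OF assms]])
  have Nx: "mob_num a b Z *v x = mob a b Z *v y"
    by (simp add: x_def mob_def matrix_vector_mul_assoc)
  have "x \<noteq> 0" using Dx y by auto
  then have "norm (Z *v x) < norm x" using assms by (simp add: contr_def)
  then have "(norm (Z *v x))\<^sup>2 < (norm x)\<^sup>2" by (simp add: power_strict_mono)
  then have "(norm (mob a b Z *v y))\<^sup>2 < (norm y)\<^sup>2" using norm_den_num[of Z x] by (simp add: Dx Nx)
  then show "norm (mob a b Z *v y) < norm y" by (simp add: power2_less_imp_less)
qed

lemma mob_inverse:
  assumes "contr Z"
  shows "mob (adj a) (- transpose b) (mob a b Z) = Z"
proof -
  let ?D = "mob_den a b Z" and ?N = "mob_num a b Z" and ?W = "mob a b Z"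
  note WD = mob_eq[OF assms]
  note D = matrix_inv_mult[OF det_mob_den[OF assms]]
  have "mob_den (adj a) (- transpose b) ?W ** ?D = - (adj b ** (?W ** ?D)) + transpose a ** ?D"
    by (simp add: mob_den_def[of "adj a"] conj_adj conj_mat_minus conj_mat_transpose transpose_conj matrix_ring)
  also have "\<dots> = mat 1"
    unfolding WD by (simp add: mob_den_def mob_num_def matrix_ring mob_simps)
  finally have 1: "mob_den (adj a) (- transpose b) ?W ** ?D = mat 1" .
  then have i: "matrix_inv (mob_den (adj a) (- transpose b) ?W) = ?D" by (rule matrix_inv_unique)
  have "mob_num (adj a) (- transpose b) ?W ** ?D = adj a ** (?W ** ?D) - transpose b ** ?D"
    by (simp add: mob_num_def[of "adj a"] matrix_ring)
  also have "\<dots> = Z"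
    unfolding WD by (simp add: mob_den_def mob_num_def matrix_ring mob_simps)
  finally show ?thesis unfolding mob_def[of "adj a"] i .
qed

text \<open>With W the image of Z and D the denominator,
  \<open>adj D (I - adj W W) D = I - adj Z Z\<close>; the claim is its determinant, up to
  transposition.\<close>

lemma det_one_minus_mob:
  assumes "transpose Z = Z" "contr Z"
  shows "det (mat 1 - mob a b Z ** conj_mat (mob a b Z)) * det (mob_den a b Z) * cnj (det (mob_den a b Z))
    = det (mat 1 - Z ** conj_mat Z)"
proof -
  have t: "det (mat 1 - W ** conj_mat W) = det (mat 1 - adj W ** W)" if "transpose W = W" for W :: "complex^'p^'p"
  proof -
    have "transpose (mat 1 - W ** conj_mat W) = mat 1 - adj W ** W"
      by (simp add: transpose_diff matrix_transpose_mul transpose_conj that)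
    then show ?thesis by (metis det_transpose)
  qed
  let ?D = "mob_den a b Z" and ?W = "mob a b Z"
  have "adj ?D ** (mat 1 - adj ?W ** ?W) ** ?D = adj ?D ** ?D - adj (?W ** ?D) ** (?W ** ?D)"
    by (simp add: matrix_ring adj_mult)
  also have "\<dots> = mat 1 - adj Z ** Z" unfolding mob_eq[OF assms(2)] by (rule mob_den_num)
  finally have "det (adj ?D ** (mat 1 - adj ?W ** ?W) ** ?D) = det (mat 1 - adj Z ** Z)" by simp
  then show ?thesis
    unfolding t[OF assms(1)] t[OF transpose_mob[OF assms]] by (simp add: det_mul det_adj mult_ac)
qed

text \<open>The quotient rule gives \<open>(a - W conj(b)) V D^{-1}\<close>, and the left factor is
  the transposed inverse of D. So the derivative is a congruence, whose Jacobian is known.\<close>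

lemma mob_has_derivative:
  assumes "transpose Z = Z" "contr Z"
  shows "(mob a b has_derivative (\<lambda>V. transpose (matrix_inv (mob_den a b Z)) ** V ** matrix_inv (mob_den a b Z))) (at Z)"
proof -
  let ?D = "mob_den a b Z" and ?R = "matrix_inv (mob_den a b Z)" and ?W = "mob a b Z"
  note D = matrix_inv_mult[OF det_mob_den[OF assms(2)]]
  have l: "((\<lambda>Z. A ** Z) has_derivative (\<lambda>V. A ** V)) (at Z)" for A :: "complex^'p^'p"
    by (intro bounded_linear_imp_has_derivative bounded_bilinear.bounded_linear_right bounded_bilinear_matrix_mult)
  have 1: "(mob_den a b has_derivative (\<lambda>V. conj_mat b ** V)) (at Z)"
    unfolding mob_den_def[abs_def] using has_derivative_add[OF l has_derivative_const] by simp
  have 2: "(mob_num a b has_derivative (\<lambda>V. a ** V)) (at Z)"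
    unfolding mob_num_def[abs_def] using has_derivative_add[OF l has_derivative_const] by simp
  have 3: "((\<lambda>Z. matrix_inv (mob_den a b Z)) has_derivative (\<lambda>V. - (?R ** (conj_mat b ** V) ** ?R))) (at Z)"
    by (rule has_derivative_compose[OF 1 matrix_inv_has_derivative[OF det_mob_den[OF assms(2)]]])
  have T: "a - ?W ** conj_mat b = transpose ?R"
  proof -
    have "transpose ?D ** (a - ?W ** conj_mat b) = transpose ?D ** a - transpose (transpose ?W ** ?D) ** conj_mat b"
      by (simp add: matrix_ring matrix_transpose_mul transpose_mob[OF assms])
    also have "\<dots> = transpose ?D ** a - transpose (mob_num a b Z) ** conj_mat b"
      by (simp add: transpose_mob[OF assms] mob_eq[OF assms(2)])
    also have "\<dots> = mat 1"
      by (simp add: mob_den_def mob_num_def transpose_add matrix_transpose_mul transpose_conj assms(1) matrix_ring mob_simps)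
    finally have 4: "transpose ?D ** (a - ?W ** conj_mat b) = mat 1" .
    have "transpose ?R ** transpose ?D = mat 1" using D by (metis matrix_transpose_mul transpose_mat)
    then show ?thesis using 4 by (metis matrix_mul_assoc matrix_mul_lid matrix_mul_rid)
  qed
  have "(mob a b has_derivative (\<lambda>V. mob_num a b Z ** - (?R ** (conj_mat b ** V) ** ?R) + a ** V ** ?R)) (at Z)"
    unfolding mob_def[abs_def] by (rule has_derivative_matrix_mult[OF 2 3])
  moreover have "mob_num a b Z ** - (?R ** (conj_mat b ** V) ** ?R) + a ** V ** ?R = transpose ?R ** V ** ?R" for V
    unfolding T[symmetric] mob_def by (simp add: matrix_ring)
  ultimately show ?thesis by simp
qed

lemma det_mob_den_has_derivative:
  assumes "contr Z"
  shows "((\<lambda>Z. det (mob_den a b Z)) has_derivative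
    (\<lambda>V. det (mob_den a b Z) * trace (matrix_inv (mob_den a b Z) ** (conj_mat b ** V)))) (at Z)"
proof -
  have "((\<lambda>Z. conj_mat b ** Z) has_derivative (\<lambda>V. conj_mat b ** V)) (at Z)"
    by (intro bounded_linear_imp_has_derivative bounded_bilinear.bounded_linear_right bounded_bilinear_matrix_mult)
  then have 1: "(mob_den a b has_derivative (\<lambda>V. conj_mat b ** V)) (at Z)"
    unfolding mob_den_def[abs_def] using has_derivative_add[OF _ has_derivative_const] by fastforce
  show ?thesis
    by (rule has_derivative_compose[OF 1 det_has_derivative[OF matrix_inv_mult(1)[OF det_mob_den[OF assms]]]])
qed

end

lemma mob_inverse':
  assumes "mob_pair a b" "contr W"
  shows "mob a b (mob (adj a) (- transpose b) W) = W"
  using mob_inverse[OF mob_pair_inverse[OF assms(1)] assms(2)]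
  by (simp add: transpose_minus)

text \<open>Near x a continuous logarithm equals \<open>l x + Ln (\<delta> y / \<delta> x)\<close>:
  by continuity the imaginary part of \<open>l y - l x\<close> stays below 1, well within the strip
  where \<open>Ln\<close> inverts \<open>exp\<close>.\<close>

lemma continuous_log_has_derivative:
  fixes \<delta> l :: "'a::real_normed_vector \<Rightarrow> complex"
  assumes S: "open S" "x \<in> S" and l: "continuous_on S l" "\<And>y. y \<in> S \<Longrightarrow> \<delta> y = exp (l y)"
    and d: "(\<delta> has_derivative \<delta>') (at x)"
  shows "(l has_derivative (\<lambda>v. \<delta>' v / \<delta> x)) (at x)"
proof -
  have dx: "\<delta> x \<noteq> 0" using l S by simp
  have q: "((\<lambda>y. \<delta> y / \<delta> x) has_derivative (\<lambda>v. \<delta>' v / \<delta> x)) (at x)"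
    by (rule bounded_linear.has_derivative[OF bounded_linear_divide d])
  have "(Ln has_field_derivative inverse (\<delta> x / \<delta> x)) (at (\<delta> x / \<delta> x))"
    using dx by (intro has_field_derivative_Ln) auto
  then have "(Ln has_derivative (\<lambda>h. h)) (at (\<delta> x / \<delta> x))"
    using dx by (simp add: has_field_derivative_def fun_eq_iff[symmetric] lambda_one[symmetric])
  from has_derivative_compose[OF q this]
  have L: "((\<lambda>y. l x + Ln (\<delta> y / \<delta> x)) has_derivative (\<lambda>v. 0 + \<delta>' v / \<delta> x)) (at x)"
    by (intro has_derivative_add has_derivative_const)
  have "isCont l x" using l(1) S by (simp add: continuous_on_eq_continuous_at)
  then have "(\<lambda>y. Im (l y - l x)) \<midarrow>x\<rightarrow> Im (l x - l x)"
    by (intro tendsto_intros) (simp add: isCont_def)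
  then have "\<forall>\<^sub>F y in at x. dist (Im (l y - l x)) (Im (l x - l x)) < 1" by (rule tendstoD) simp
  moreover have "\<forall>\<^sub>F y in at x. y \<in> S" using S by (simp add: eventually_at_topological) blast
  ultimately have ev: "\<forall>\<^sub>F y in at x. l x + Ln (\<delta> y / \<delta> x) = l y"
  proof eventually_elim
    case (elim y)
    have "\<delta> y / \<delta> x = exp (l y - l x)" using elim l(2) S by (simp add: exp_diff)
    moreover have "Ln (exp (l y - l x)) = l y - l x"
      using elim pi_gt3 by (intro Ln_exp) (auto simp: dist_real_def abs_less_iff)
    ultimately show ?case by simp
  qed
  show ?thesis
    using has_derivative_transform_eventually[OF L ev] dx by simp
qed

subsection \<open>Complex differentiability\<close>

definition cdiff :: "(complex^'n::finite \<Rightarrow> complex) \<Rightarrow> complex^'n \<Rightarrow> bool" where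
  "cdiff f z \<longleftrightarrow> (\<exists>f'. (f has_derivative f') (at z) \<and> (\<forall>c v. f' (c *s v) = c * f' v))"

lemma holomorphic_cn_iff: "holomorphic_cn f D \<longleftrightarrow> (\<forall>z\<in>D. cdiff f z)"
  by (simp add: holomorphic_cn_def cdiff_def)

lemma cdiffI: "(f has_derivative f') (at z) \<Longrightarrow> (\<And>c v. f' (c *s v) = c * f' v) \<Longrightarrow> cdiff f z"
  unfolding cdiff_def by blast

lemma cdiff_const: "cdiff (\<lambda>_. c) z"
  by (rule cdiffI[OF has_derivative_const]) simp

lemma cdiff_mult:
  assumes "cdiff f z" "cdiff g z"
  shows "cdiff (\<lambda>x. f x * g x) z"
proof -
  obtain f' g' where "(f has_derivative f') (at z)" "\<forall>c v. f' (c *s v) = c * f' v"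
      "(g has_derivative g') (at z)" "\<forall>c v. g' (c *s v) = c * g' v"
    using assms unfolding cdiff_def by blast
  then show ?thesis
    by (intro cdiffI[OF has_derivative_mult]) (auto simp: algebra_simps)
qed

lemma cdiff_compose:
  assumes "cdiff f z" "(g has_field_derivative D) (at (f z))"
  shows "cdiff (\<lambda>x. g (f x)) z"
proof -
  obtain f' where f: "(f has_derivative f') (at z)" "\<forall>c v. f' (c *s v) = c * f' v"
    using assms unfolding cdiff_def by blast
  show ?thesis
    by (rule cdiffI[OF has_derivative_compose[OF f(1) assms(2)[unfolded has_field_derivative_def]]])
       (simp add: f(2))
qed

lemma cdiff_power: "cdiff f z \<Longrightarrow> cdiff (\<lambda>x. f x ^ n) z"
  by (rule cdiff_compose[where g = "\<lambda>x. x ^ n"]) (auto intro!: derivative_eq_intros)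

lemma cdiff_inverse: "cdiff f z \<Longrightarrow> f z \<noteq> 0 \<Longrightarrow> cdiff (\<lambda>x. inverse (f x)) z"
  by (rule cdiff_compose[where g = inverse]) (auto intro!: derivative_eq_intros)

lemma cdiff_map:
  assumes "(\<Phi> has_derivative \<Phi>') (at z)" "\<And>c v. \<Phi>' (c *s v) = c *s \<Phi>' v" "cdiff f (\<Phi> z)"
  shows "cdiff (\<lambda>x. f (\<Phi> x)) z"
proof -
  obtain f' where f: "(f has_derivative f') (at (\<Phi> z))" "\<forall>c v. f' (c *s v) = c * f' v"
    using assms(3) unfolding cdiff_def by blast
  show ?thesis
    by (rule cdiffI[OF has_derivative_compose[OF assms(1) f(1)]]) (simp add: f(2) assms(2))
qed

lemma cdiff_continuous: "cdiff f z \<Longrightarrow> continuous (at z) f"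
  unfolding cdiff_def using has_derivative_continuous by blast

lemma cdiff_cong: "cdiff f z \<Longrightarrow> open S \<Longrightarrow> z \<in> S \<Longrightarrow> (\<And>x. x \<in> S \<Longrightarrow> f x = g x) \<Longrightarrow> cdiff g z"
  unfolding cdiff_def using has_derivative_transform_within_open by metis

lemma holomorphic_cn_continuous: "holomorphic_cn f D \<Longrightarrow> continuous_on D f"
  unfolding holomorphic_cn_iff using cdiff_continuous continuous_at_imp_continuous_on by metis

subsection \<open>Transitivity up to \<open>X\<close>\<close>

lemma open_Y_II:
  assumes "K > 0"
  shows "open (Y_II K :: (complex^('p::finite uprod + 'r::finite)) set)"
proof -
  have c: "continuous_on dom0 (X_II K :: complex^('p uprod + 'r) \<Rightarrow> real)"
  proof -
    have "continuous_on dom0 (\<lambda>z::complex^('p uprod + 'r). - ln (detZ z))"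
      by (intro continuous_at_imp_continuous_on ballI) (rule has_derivative_continuous[OF ln_detZ_has_derivative])
    from continuous_on_divide[OF this continuous_on_const]
    have "continuous_on dom0 (\<lambda>z::complex^('p uprod + 'r). exp (- ln (detZ z) / K))"
      using assms by (intro continuous_on_exp) auto
    then have "continuous_on dom0 (\<lambda>z::complex^('p uprod + 'r). (norm (wpart z))\<^sup>2 * exp (- ln (detZ z) / K))"
      by (rule continuous_on_mult[rotated])
         (intro continuous_on_power continuous_on_norm linear_continuous_on bounded_linear_wpart)
    then show ?thesis by (rule continuous_on_eq) (simp add: X_II_eq hfun_def)
  qed
  have "(Y_II K :: (complex^('p uprod + 'r)) set) = {z \<in> dom0. X_II K z < 1}" using Y_II_iff[OF assms] by auto
  also have "\<dots> = dom0 \<inter> X_II K -` {..<1}" by auto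
  finally show ?thesis
    using continuous_open_preimage[OF c open_dom0, of "{..<1}"] by simp
qed

text \<open>In Z use a Moebius map that takes \<open>Zpart u\<close> to 0. It divides
  \<open>detZ\<close> by \<open>|det D|^2\<close>, D being its denominator, so multiplying w by a
  branch of \<open>det D ^ (-1/K)\<close> keeps X. J is the complex Jacobian determinant, and its
  modulus at u is determined by \<open>detZ = 1\<close> over \<open>Z = 0\<close>.\<close>

theorem Y_II_automorphism:
  fixes u :: "complex^('p::finite uprod + 'r::finite)"
  assumes K: "K > 0" and u: "u \<in> dom0"
  obtains \<Phi> :: "complex^('p uprod + 'r) \<Rightarrow> complex^('p uprod + 'r)" and \<Phi>' and J :: "complex^('p uprod + 'r) \<Rightarrow> complex"
  where "bij_betw \<Phi> (Y_II K) (Y_II K)"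
    "\<And>z. z \<in> Y_II K \<Longrightarrow> (\<Phi> has_derivative \<Phi>' z) (at z)"
    "\<And>z c v. z \<in> Y_II K \<Longrightarrow> \<Phi>' z (c *s v) = c *s \<Phi>' z v"
    "\<And>z. z \<in> Y_II K \<Longrightarrow> adet (\<Phi>' z) = (cmod (J z))\<^sup>2"
    "holomorphic_cn J (Y_II K)" "\<And>z. z \<in> Y_II K \<Longrightarrow> J z \<noteq> 0"
    "Zpart (\<Phi> u) = 0" "(norm (wpart (\<Phi> u)))\<^sup>2 = X_II K u"
    "(cmod (J u))\<^sup>2 = exp ((K * (real CARD('p) + 1) + real CARD('r)) * hfun K u)"
proof -
  define Z0 where "Z0 = Zpart u"
  have Z0t: "transpose Z0 = Z0" "adj Z0 = conj_mat Z0" "transpose (conj_mat Z0) = conj_mat Z0" "adj (conj_mat Z0) = Z0"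
    by (simp_all add: Z0_def adj_symmetric) (metis adj_symmetric transpose_Zpart transpose_conj adj_adj)+
  obtain A :: "complex^'p^'p" where A: "A ** MZ u ** adj A = mat 1" "matrix_inv (MZ u) = adj A ** A"
      "det A \<noteq> 0" "det (MZ u) = of_real (detZ u)" "detZ u = 1 / (cmod (det A))\<^sup>2"
    using MZ_factor[OF u] .
  define M where "M = MZ u"
  define R where "R = adj A ** A"
  have M: "M = mat 1 - Z0 ** conj_mat Z0" by (simp add: M_def MZ_def Z0_def)
  have RM: "R ** M = mat 1" "M ** R = mat 1"
    using matrix_inv_mult[OF det_MZ_nonzero[OF u]] by (simp_all add: R_def M_def A(2))
  have cR: "conj_mat R = transpose A ** conj_mat A" by (simp add: R_def conj_mat_mult conj_adj)
  \<comment> \<open>\<open>Z0\<close> intertwines M with its conjugate and therefore also their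
    inverses; the first two identities of \<open>mob_pair\<close> rest on this.\<close>
  have "M ** Z0 = Z0 ** conj_mat M"
    by (simp add: M conj_mat_diff conj_mat_mult matrix_ring)
  then have RZ: "R ** Z0 = Z0 ** conj_mat R"
  proof -
    have "conj_mat M ** conj_mat R = mat 1" using RM(2) by (metis conj_mat_mult conj_mat_one)
    then have "R ** Z0 = R ** (Z0 ** conj_mat M) ** conj_mat R" by (simp flip: matrix_mul_assoc)
    also have "\<dots> = Z0 ** conj_mat R"
      unfolding \<open>M ** Z0 = Z0 ** conj_mat M\<close>[symmetric] by (simp add: matrix_mul_assoc RM)
    finally show ?thesis .
  qed
  \<comment> \<open>The numerator becomes \<open>A (Z - Z0)\<close>, which vanishes at
    \<open>Z0\<close>; the normalisation of A makes the block matrix pseudo-unitary.\<close>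
  define a where "a = A"
  define b where "b = - (A ** Z0)"
  have ab: "mob_pair a b"
  proof -
    have "adj a ** a - transpose b ** conj_mat b = R - Z0 ** conj_mat R ** conj_mat Z0"
      by (simp add: a_def b_def R_def cR transpose_minus conj_mat_minus matrix_minus_left matrix_minus_right
          matrix_transpose_mul Z0t conj_mat_mult matrix_mul_assoc conj_adj)
    also have "\<dots> = R ** M" by (simp add: RZ[symmetric] M matrix_ring)
    finally have 1: "adj a ** a - transpose b ** conj_mat b = mat 1" by (simp add: RM)
    have "adj a ** b = - (R ** Z0)" by (simp add: a_def b_def R_def matrix_minus_right matrix_mul_assoc)
    also have "\<dots> = transpose b ** conj_mat a"
      unfolding RZ cR by (simp add: a_def b_def transpose_minus matrix_minus_left matrix_transpose_mul Z0t matrix_mul_assoc)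
    finally have 2: "adj a ** b = transpose b ** conj_mat a" .
    have 3: "a ** adj a - b ** adj b = mat 1"
      using A(1) by (simp add: a_def b_def M_def[symmetric] M adj_minus adj_mult Z0t matrix_ring)
    have 4: "a ** transpose b = b ** transpose a"
      by (simp add: a_def b_def transpose_minus matrix_transpose_mul Z0t matrix_ring)
    show ?thesis using 1 2 3 4 by (simp add: mob_pair_def)
  qed
  note dn = det_mob_den[OF ab]
  \<comment> \<open>The scaling of w needs a single-valued root of the nowhere vanishing
    determinant, hence a logarithm on the whole domain.\<close>
  have "contractible {Z :: complex^'p^'p. contr Z}" by (rule convex_imp_contractible[OF convex_contr])
  moreover have "continuous_on {Z. contr Z} (\<lambda>Z. det (mob_den a b Z))"
    by (intro continuous_at_imp_continuous_on ballI) (rule has_derivative_continuous[OF det_mob_den_has_derivative[OF ab]], simp)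
  ultimately obtain l where l: "continuous_on {Z. contr Z} l" "\<And>Z. Z \<in> {Z. contr Z} \<Longrightarrow> det (mob_den a b Z) = exp (l Z)"
    using continuous_logarithm_on_contractible[of "{Z. contr Z}" "\<lambda>Z. det (mob_den a b Z)"] dn by auto
  define R1 where "R1 Z = matrix_inv (mob_den a b Z)" for Z
  have l': "(l has_derivative (\<lambda>V. trace (R1 Z ** (conj_mat b ** V)))) (at Z)" if "contr Z" for Z
    using continuous_log_has_derivative[OF open_contr _ l det_mob_den_has_derivative[OF ab that]] that dn[OF that]
    by (simp add: R1_def)
  \<comment> \<open>The branch of \<open>det D ^ (-1/K)\<close> determined by the logarithm
    l.\<close>
  define lam where "lam Z = exp (- l Z / of_real K)" for Z
  have lam': "(lam has_derivative (\<lambda>V. lam Z * (- trace (R1 Z ** (conj_mat b ** V)) / of_real K))) (at Z)" if "contr Z" for Z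
  proof -
    have 1: "((\<lambda>Z. - l Z / of_real K) has_derivative (\<lambda>V. - trace (R1 Z ** (conj_mat b ** V)) / of_real K)) (at Z)"
      by (intro bounded_linear.has_derivative[OF bounded_linear_divide] has_derivative_minus l' that)
    show ?thesis unfolding lam_def[abs_def]
      by (rule has_derivative_compose[OF 1 DERIV_exp[unfolded has_field_derivative_def]])
  qed
  have lam0: "lam Z \<noteq> 0" for Z by (simp add: lam_def)
  define d where "d z = det (mob_den a b (Zpart z))" for z :: "complex^('p uprod + 'r)"
  have d_exp: "cmod (d z) = exp (Re (l (Zpart z)))" if "z \<in> dom0" for z
    using l(2)[of "Zpart z"] that by (simp add: d_def dom0_def)
  have cmod_lam: "cmod (lam Z) = exp (- Re (l Z) / K)" for Z
    by (simp add: lam_def Re_divide_of_real)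
  define \<Phi> where "\<Phi> z = mk (mob a b (Zpart z)) (lam (Zpart z) *s wpart z)" for z :: "complex^('p uprod + 'r)"
  define \<Phi>' where "\<Phi>' z v = mk (transpose (R1 (Zpart z)) ** Zpart v ** R1 (Zpart z))
      (lam (Zpart z) *s wpart v + (lam (Zpart z) * (- trace (R1 (Zpart z) ** (conj_mat b ** Zpart v)) / of_real K)) *s wpart z)"
    for z v :: "complex^('p uprod + 'r)"
  define J where "J z = lam (Zpart z) ^ CARD('r) * inverse (d z) ^ (CARD('p) + 1)" for z :: "complex^('p uprod + 'r)"
  have Yd: "z \<in> dom0" "contr (Zpart z)" if "z \<in> Y_II K" for z :: "complex^('p uprod + 'r)"
    using that Y_II_iff[OF K, of z] by (auto simp: dom0_def)
  have ZP: "Zpart (\<Phi> z) = mob a b (Zpart z)" if "z \<in> dom0" for z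
    unfolding \<Phi>_def using that by (intro Zpart_mk transpose_mob[OF ab]) (auto simp: dom0_def)
  have wP: "wpart (\<Phi> z) = lam (Zpart z) *s wpart z" for z by (simp add: \<Phi>_def)
  have dP: "\<Phi> z \<in> dom0" if "z \<in> dom0" for z
    using ZP[OF that] contr_mob[OF ab] that by (simp add: dom0_def)
  have detP: "detZ z = detZ (\<Phi> z) * (cmod (d z))\<^sup>2" if "z \<in> dom0" for z
  proof -
    have "det (MZ (\<Phi> z)) * d z * cnj (d z) = det (MZ z)"
      using det_one_minus_mob[OF ab transpose_Zpart, of z] that by (simp add: MZ_def ZP d_def dom0_def)
    then have "of_real (detZ (\<Phi> z) * (cmod (d z))\<^sup>2) = complex_of_real (detZ z)"
      using det_MZ[OF that] det_MZ[OF dP[OF that]] by (simp add: complex_norm_square mult.assoc del: of_real_power)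
    then show ?thesis by (simp only: of_real_eq_iff)
  qed
  have hP: "hfun K (\<Phi> z) = hfun K z + 2 * Re (l (Zpart z)) / K" if "z \<in> dom0" for z
  proof -
    have "ln (detZ z) = ln (detZ (\<Phi> z)) + 2 * Re (l (Zpart z))"
      unfolding detP[OF that] using detZ_pos[OF dP[OF that]] by (simp add: d_exp[OF that] ln_mult ln_realpow)
    then show ?thesis by (simp add: hfun_def diff_divide_distrib add_divide_distrib)
  qed
  have norm_scale: "norm (c *s x) = cmod c * norm x" for c and x :: "complex^'r"
    unfolding norm_vec_def L2_set_def by (simp add: norm_mult power_mult_distrib sum_distrib_left[symmetric] real_sqrt_mult)
  have XP: "X_II K (\<Phi> z) = X_II K z" if "z \<in> dom0" for z
  proof -
    \<comment> \<open>The scaling of \<open>|w|^2\<close> cancels the change of \<open>exp h\<close>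
      exactly.\<close>
    have "exp (- Re (l (Zpart z)) / K) ^ 2 * exp (2 * Re (l (Zpart z)) / K) = 1"
      by (simp flip: exp_of_nat_mult exp_add)
    then show ?thesis
      unfolding X_II_eq[OF that] X_II_eq[OF dP[OF that]] hP[OF that] wP norm_scale cmod_lam
      by (simp add: exp_add power_mult_distrib algebra_simps) 
  qed
  have PY: "\<Phi> z \<in> Y_II K" if "z \<in> Y_II K" for z
    using that XP[of z] dP[of z] by (simp add: Y_II_iff[OF K])
  have inj: "inj_on \<Phi> (Y_II K)"
  proof (rule inj_onI)
    fix x y assume xy: "x \<in> Y_II K" "y \<in> Y_II K" "\<Phi> x = \<Phi> y"
    then have "mob a b (Zpart x) = mob a b (Zpart y)" by (metis ZP Yd(1))
    then have Z: "Zpart x = Zpart y" using mob_inverse[OF ab] Yd xy by metis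
    have "lam (Zpart x) *s wpart x = lam (Zpart x) *s wpart y" using xy(3) wP Z by metis
    then have "wpart x = wpart y" using lam0 by (simp add: vec_eq_iff)
    with Z show "x = y" by (rule parts_eqI)
  qed
  have surj: "\<exists>z\<in>Y_II K. \<Phi> z = y" if y: "y \<in> Y_II K" for y
  proof -
    define Z where "Z = mob (adj a) (- transpose b) (Zpart y)"
    have Zc: "contr Z" "transpose Z = Z"
      unfolding Z_def using Yd[OF y] by (auto intro!: contr_mob transpose_mob mob_pair_inverse ab)
    define z :: "complex^('p uprod + 'r)" where "z = mk Z (inverse (lam Z) *s wpart y)"
    have zp: "Zpart z = Z" "wpart z = inverse (lam Z) *s wpart y" using Zc by (simp_all add: z_def)
    have zd: "z \<in> dom0" using Zc by (simp add: dom0_def zp)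
    have "\<Phi> z = y"
    proof (rule parts_eqI)
      show "Zpart (\<Phi> z) = Zpart y" using mob_inverse'[OF ab Yd(2)[OF y]] by (simp add: ZP[OF zd] zp Z_def)
      show "wpart (\<Phi> z) = wpart y" using lam0 by (simp add: wP zp vec_eq_iff)
    qed
    moreover have "z \<in> Y_II K" using XP[OF zd] y zd \<open>\<Phi> z = y\<close> by (simp add: Y_II_iff[OF K])
    ultimately show ?thesis by blast
  qed
  show ?thesis
  proof (rule that[of \<Phi> \<Phi>' J])
    show "bij_betw \<Phi> (Y_II K) (Y_II K)"
      unfolding bij_betw_def using inj PY surj by blast
  next
    fix z :: "complex^('p uprod + 'r)" assume z: "z \<in> Y_II K"
    note zc = Yd(2)[OF z]
    have zp: "(Zpart has_derivative Zpart) (at z)" "(wpart has_derivative wpart) (at z)"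
      by (intro bounded_linear_imp_has_derivative bounded_linear_Zpart bounded_linear_wpart)+
    have 1: "((\<lambda>z. mob a b (Zpart z)) has_derivative (\<lambda>v. transpose (R1 (Zpart z)) ** Zpart v ** R1 (Zpart z))) (at z)"
      unfolding R1_def by (rule has_derivative_compose[OF zp(1) mob_has_derivative[OF ab transpose_Zpart zc]])
    have 2: "((\<lambda>z. lam (Zpart z)) has_derivative (\<lambda>v. lam (Zpart z) * (- trace (R1 (Zpart z) ** (conj_mat b ** Zpart v)) / of_real K))) (at z)"
      by (rule has_derivative_compose[OF zp(1) lam'[OF zc]])
    have bb: "bounded_bilinear (\<lambda>c (x :: complex^'r). c *s x)"
    proof -
      have "bilinear (\<lambda>c (x :: complex^'r). c *s x)"
        unfolding bilinear_def by (auto intro!: linearI simp: vec_eq_iff algebra_simps)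
      then show ?thesis by (simp add: bilinear_conv_bounded_bilinear)
    qed
    have 3: "((\<lambda>z. lam (Zpart z) *s wpart z) has_derivative (\<lambda>v. lam (Zpart z) *s wpart v
        + (lam (Zpart z) * (- trace (R1 (Zpart z) ** (conj_mat b ** Zpart v)) / of_real K)) *s wpart z)) (at z)"
      by (rule bounded_bilinear.FDERIV[OF bb 2 zp(2)])
    show "(\<Phi> has_derivative \<Phi>' z) (at z)"
      unfolding \<Phi>_def[abs_def] \<Phi>'_def[abs_def]
      using bounded_linear.has_derivative[OF bounded_linear_mk has_derivative_Pair[OF 1 3]] by simp
    have pull: "B ** (mat c ** C) = mat c ** (B ** C)" for c and B C :: "complex^'p^'p"
      unfolding matrix_mul_assoc mat_commute[of B] ..
    have tr: "trace (mat c ** B) = c * trace B" for c and B :: "complex^'p^'p"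
      by (simp add: trace_def sum_distrib_left)
    show cl: "\<Phi>' z (c *s v) = c *s \<Phi>' z v" for c v
    proof -
      have i: "transpose (R1 (Zpart z)) ** Zpart (c *s v) ** R1 (Zpart z) = mat c ** (transpose (R1 (Zpart z)) ** Zpart v ** R1 (Zpart z))"
        by (simp only: Zpart_scale pull) (simp only: matrix_mul_assoc)
      have ii: "trace (R1 (Zpart z) ** (conj_mat b ** Zpart (c *s v))) = c * trace (R1 (Zpart z) ** (conj_mat b ** Zpart v))"
        by (simp only: Zpart_scale pull tr)
      show ?thesis
        unfolding \<Phi>'_def i ii mk_scale[symmetric]
        by (rule arg_cong[where f = "mk _"]) (simp add: vec_eq_iff algebra_simps)
    qed
    define N where "N v = (- trace (R1 (Zpart z) ** (conj_mat b ** Zpart v)) / of_real K) *s wpart z"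
      for v :: "complex^('p uprod + 'r)"
    define T where "T = transpose (R1 (Zpart z))"
    have Zmk0: "Zpart (mk 0 w :: complex^('p uprod + 'r)) = 0" for w :: "complex^'r"
      by (rule Zpart_mk) (simp add: vec_eq_iff transpose_def)
    have Tt: "transpose T = R1 (Zpart z)" by (simp add: T_def)
    \<comment> \<open>N carries the derivative of \<open>lam\<close>, by which a change of Z moves
      w. Split off as a shear it has Jacobian 1 and leaves a congruence in Z with a scaling of
      w.\<close>
    have fac: "\<Phi>' z = cong_map T (lam (Zpart z)) \<circ> (\<lambda>v. v + mk 0 (N v))"
    proof (rule ext)
      fix v :: "complex^('p uprod + 'r)"
      show "\<Phi>' z v = (cong_map T (lam (Zpart z)) \<circ> (\<lambda>v. v + mk 0 (N v))) v"
        unfolding o_def cong_map_def \<Phi>'_def Zpart_add wpart_add Zmk0 Tt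
        by (simp add: T_def N_def vec_eq_iff mk_def algebra_simps split: sum.split)
    qed
    have linN: "linear N"
    proof -
      have scd: "(r *\<^sub>R x) / c = r *\<^sub>R (x / c)" for r and x c :: complex
        by (simp add: scaleR_conv_of_real)
      have lint: "linear (\<lambda>v :: complex^('p uprod + 'r). trace (R1 (Zpart z) ** (conj_mat b ** Zpart v)))"
        by (rule linearI) (simp_all add: Zpart_add Zpart_scaleR matrix_add_ldistrib trace_add matrix_scaleR_right
            trace_def scaleR_sum_right sum.distrib)
      show ?thesis
        by (intro linearI)
           (simp_all add: N_def linear_add[OF lint] linear_cmul[OF lint] vec_eq_iff add_divide_distrib
              diff_divide_distrib scd algebra_simps)
    qed
    have N0: "N (mk 0 (wpart v)) = 0" for v
      by (simp add: N_def Zmk0 vec_eq_iff trace_def matrix_matrix_mult_def)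
    have lin2: "linear (\<lambda>v :: complex^('p uprod + 'r). v + mk 0 (N v))"
    proof -
      have "linear (\<lambda>w::complex^'r. mk (0 :: complex^'p^'p) w)"
        by (rule linearI) (auto simp: vec_eq_iff mk_def split: sum.split)
      from linear_compose_add[OF linear_id linear_compose[OF linN this]] show ?thesis by (simp add: o_def)
    qed
    have dT: "det T = inverse (d z)"
    proof -
      have "d z * det (R1 (Zpart z)) = 1"
        using matrix_inv_mult(1)[OF dn[OF zc]] by (metis R1_def d_def det_I det_mul)
      then show ?thesis by (simp add: T_def inverse_unique)
    qed
    have dz: "d z \<noteq> 0" using dn[OF zc] by (simp add: d_def)
    have "adet (\<Phi>' z) = cmod (det T) ^ (2 * (CARD('p) + 1)) * cmod (lam (Zpart z)) ^ (2 * CARD('r))"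
      unfolding fac using dz by (simp add: adet_comp[OF linear_cong_map lin2] adet_shear[OF linN N0] adet_cong_map dT)
    then show "adet (\<Phi>' z) = (cmod (J z))\<^sup>2"
      by (simp add: dT J_def norm_mult norm_power norm_inverse power_mult_distrib power_mult[symmetric] mult.commute del: power_Suc)
    show "J z \<noteq> 0" using dz lam0 by (simp add: J_def)
  next
    show "holomorphic_cn J (Y_II K)"
      unfolding holomorphic_cn_iff
    proof
      fix z :: "complex^('p uprod + 'r)" assume z: "z \<in> Y_II K"
      note zc = Yd(2)[OF z]
      have zp: "(Zpart has_derivative Zpart) (at z)"
        by (intro bounded_linear_imp_has_derivative bounded_linear_Zpart)
      have pull: "B ** (mat c ** C) = mat c ** (B ** C)" for c and B C :: "complex^'p^'p"
        unfolding matrix_mul_assoc mat_commute[of B] ..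
      have tr: "trace (mat c ** B) = c * trace B" for c and B :: "complex^'p^'p"
        by (simp add: trace_def sum_distrib_left)
      have 1: "cdiff (\<lambda>z. lam (Zpart z)) z"
        by (rule cdiffI[OF has_derivative_compose[OF zp lam'[OF zc]]]) (simp only: Zpart_scale pull tr, simp)
      have 2: "cdiff d z"
        unfolding d_def[abs_def]
        by (rule cdiffI[OF has_derivative_compose[OF zp det_mob_den_has_derivative[OF ab zc]]]) (simp only: Zpart_scale pull tr, simp)
      show "cdiff J z"
        unfolding J_def[abs_def] using dn[OF zc] by (intro cdiff_mult cdiff_power cdiff_inverse 1 2) (simp add: d_def)
    qed
  next
    have num0: "mob_num a b Z0 = 0" by (simp add: mob_num_def a_def b_def)
    then have "mob a b Z0 = 0" by (simp add: mob_def vec_eq_iff matrix_matrix_mult_def)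
    then show Z: "Zpart (\<Phi> u) = 0" using ZP[OF u] by (simp add: Z0_def)
    have "hfun K (\<Phi> u) = 0" by (simp add: hfun_def detZ_def Z vec_eq_iff conj_mat_def)
    then show "(norm (wpart (\<Phi> u)))\<^sup>2 = X_II K u"
      using XP[OF u] X_II_eq[OF dP[OF u], of K] by simp
    \<comment> \<open>Since h vanishes at the image point, \<open>|det D|^2\<close> at u is
      \<open>exp (- K h)\<close>. The factor \<open>lam ^ r\<close> of J then contributes r to the
      exponent, and the power of \<open>1 / det D\<close> contributes
      \<open>K (p + 1)\<close>.\<close>
    have l0: "2 * Re (l (Zpart u)) / K = - hfun K u" using hP[OF u] \<open>hfun K (\<Phi> u) = 0\<close> by linarith
    have "2 * Re (l (Zpart u)) = (2 * Re (l (Zpart u)) / K) * K" using assms(1) by simp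
    then have l1: "2 * Re (l (Zpart u)) = - K * hfun K u" unfolding l0 by (simp only: mult_minus_left mult.commute)
    have "(cmod (J u))\<^sup>2 = exp (- Re (l (Zpart u)) / K) ^ (2 * CARD('r)) * exp (- Re (l (Zpart u))) ^ (2 * (CARD('p) + 1))"
      unfolding J_def norm_mult norm_power norm_inverse d_exp[OF u] cmod_lam exp_minus[symmetric]
      by (simp add: power_mult_distrib power_mult[symmetric] mult.commute del: power_Suc)
    also have "\<dots> = exp (real CARD('r) * - (2 * Re (l (Zpart u)) / K) + (real CARD('p) + 1) * - (2 * Re (l (Zpart u))))"
      by (simp add: exp_of_nat_mult[symmetric] exp_add[symmetric] algebra_simps del: power_Suc)
    also have "\<dots> = exp ((K * (real CARD('p) + 1) + real CARD('r)) * hfun K u)"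
      using assms(1) unfolding l1 by (simp add: field_simps)
    finally show "(cmod (J u))\<^sup>2 = exp ((K * (real CARD('p) + 1) + real CARD('r)) * hfun K u)" .
  qed
qed

section \<open>Comparison of \<open>Y\<^sub>I\<^sub>I\<close> with ellipsoids\<close>

lemma norm_columns: "(norm (V :: complex^'m::finite^'n::finite))\<^sup>2 = (\<Sum>j\<in>UNIV. (norm (column j V))\<^sup>2)"
proof -
  have "(norm V)\<^sup>2 = (\<Sum>i\<in>UNIV. \<Sum>j\<in>UNIV. (cmod (V $ i $ j))\<^sup>2)"
    unfolding norm_vec_def L2_set_def by (simp add: sum_nonneg)
  also have "\<dots> = (\<Sum>j\<in>UNIV. \<Sum>i\<in>UNIV. (cmod (V $ i $ j))\<^sup>2)" by (rule sum.swap)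
  also have "\<dots> = (\<Sum>j\<in>UNIV. (norm (column j V))\<^sup>2)"
    unfolding norm_vec_def L2_set_def by (simp add: sum_nonneg column_def)
  finally show ?thesis .
qed

lemma column_mult: "column j (A ** V) = A *v column j V"
  by (simp add: vec_eq_iff column_def matrix_matrix_mult_def matrix_vector_mult_def)

text \<open>The inverse of \<open>MZ z\<close> lies above the identity and, for small Z, below twice
  the identity. With \<open>M v = x\<close> and \<open>H = Z conj(Z) v\<close> one has
  \<open>x = v - H\<close> and \<open>|A x|^2 = x . v\<close>. Contractivity gives
  \<open>|H|^2 <= H . v\<close>, hence \<open>|x|^2 <= x . v\<close>; smallness gives
  \<open>|H| <= |v| / 2\<close>, hence \<open>|v| <= 2 |x|\<close>. Matrices are treated column by
  column.\<close>

lemma inv_MZ_bounds: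
  fixes z :: "complex^('p::finite uprod + 'r::finite)"
  assumes z: "z \<in> dom0" and A: "matrix_inv (MZ z) = adj A ** A"
  shows "norm V \<le> norm (A ** V)"
    and "(norm (Zpart z))\<^sup>2 \<le> 1/2 \<Longrightarrow> (norm (A ** V))\<^sup>2 \<le> 2 * (norm V)\<^sup>2"
proof -
  let ?Z = "Zpart z"
  have zc: "contr ?Z" using z by (simp add: dom0_def)
  have vec: "(norm x)\<^sup>2 \<le> (norm (A *v x))\<^sup>2 \<and> ((norm ?Z)\<^sup>2 \<le> 1/2 \<longrightarrow> (norm (A *v x))\<^sup>2 \<le> 2 * (norm x)\<^sup>2)" for x
  proof -
    define v where "v = (adj A ** A) *v x"
    have x: "MZ z *v v = x"
      using matrix_inv_mult(1)[OF det_MZ_nonzero[OF z]] by (simp add: v_def A matrix_vector_mul_assoc)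
    define H where "H = ?Z *v (conj_mat ?Z *v v)"
    have xv: "x = v - H"
      unfolding x[symmetric] MZ_def H_def by (simp add: matrix_vector_mult_diff_rdistrib matrix_vector_mul_assoc)
    have "herm (A *v x) (A *v x) = herm x v"
      unfolding v_def by (simp add: herm_adj flip: matrix_vector_mul_assoc)
    then have Ax: "(norm (A *v x))\<^sup>2 = x \<bullet> v" by (metis Re_complex_of_real Re_herm herm_self)
    have "herm H v = herm (conj_mat ?Z *v v) (conj_mat ?Z *v v)"
      unfolding H_def by (simp add: herm_adj adj_symmetric)
    then have Hv: "H \<bullet> v = (norm (conj_mat ?Z *v v))\<^sup>2" by (metis Re_complex_of_real Re_herm herm_self)
    have HH: "(norm H)\<^sup>2 \<le> H \<bullet> v"
      unfolding Hv unfolding H_def by (rule power_mono[OF contr_le[OF zc]]) simp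
    have "(norm x)\<^sup>2 = x \<bullet> v - H \<bullet> v + (norm H)\<^sup>2"
      unfolding xv power2_norm_eq_inner by (simp add: inner_diff_left inner_diff_right inner_commute)
    then have 1: "(norm x)\<^sup>2 \<le> x \<bullet> v" using HH by simp
    have 2: "x \<bullet> v \<le> 2 * (norm x)\<^sup>2" if h: "(norm ?Z)\<^sup>2 \<le> 1/2"
    proof -
      have "norm H \<le> norm ?Z * (norm (conj_mat ?Z) * norm v)"
        unfolding H_def by (intro order_trans[OF norm_matrix_vector_le] mult_left_mono norm_matrix_vector_le) auto
      also have "norm (conj_mat ?Z) = norm ?Z" by (simp add: norm_vec_def)
      finally have "norm H \<le> (norm ?Z)\<^sup>2 * norm v" by (simp add: power2_eq_square mult.assoc)
      also have "\<dots> \<le> 1/2 * norm v" using h by (intro mult_right_mono) auto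
      finally have "norm H \<le> norm v / 2" by simp
      moreover have "norm v \<le> norm x + norm H"
        using norm_triangle_ineq[of x H] unfolding xv by simp
      ultimately have "norm v \<le> 2 * norm x" by simp
      then have "norm x * norm v \<le> norm x * (2 * norm x)" by (intro mult_left_mono) auto
      then show ?thesis using norm_cauchy_schwarz[of x v] by (simp add: power2_eq_square)
    qed
    show ?thesis using 1 2 Ax by simp
  qed
  have "(norm V)\<^sup>2 \<le> (norm (A ** V))\<^sup>2"
    unfolding norm_columns[of V] norm_columns[of "A ** V"] column_mult using vec by (intro sum_mono) auto
  then show "norm V \<le> norm (A ** V)" by (rule power2_le_imp_le) simp
  show "(norm (A ** V))\<^sup>2 \<le> 2 * (norm V)\<^sup>2" if "(norm ?Z)\<^sup>2 \<le> 1/2"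
    unfolding norm_columns[of V] norm_columns[of "A ** V"] column_mult sum_distrib_left
    using vec that by (intro sum_mono) auto
qed

section \<open>Growth of the log determinant along rays\<close>

lemma dlog_radial:
  assumes z: "z \<in> dom0" and A: "matrix_inv (MZ z) = adj A ** A" and zy: "Zpart z = t *\<^sub>R Zpart y"
  shows "dlog z y = 2 * t * (norm (A ** Zpart y))\<^sup>2"
proof -
  have ct: "conj_mat (Zpart z) = t *\<^sub>R conj_mat (Zpart y)" unfolding zy by (simp add: vec_eq_iff)
  have "trace (matrix_inv (MZ z) ** Zpart y ** conj_mat (Zpart y)) = trace (adj A ** (A ** Zpart y ** conj_mat (Zpart y)))"
    by (simp add: A matrix_mul_assoc)
  also have "\<dots> = trace ((A ** Zpart y) ** adj (A ** Zpart y))"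
    by (subst trace_mul_sym) (simp add: adj_mult adj_symmetric matrix_mul_assoc)
  finally have "trace (matrix_inv (MZ z) ** Zpart y ** conj_mat (Zpart y)) = of_real ((norm (A ** Zpart y))\<^sup>2)"
    by (simp only: trace_adj_self)
  moreover have "trace (r *\<^sub>R B) = r *\<^sub>R trace B" for r and B :: "complex^'a^'a"
    by (simp add: trace_def scaleR_sum_right)
  ultimately show ?thesis by (simp add: dlog_def ct matrix_scaleR_right)
qed

lemma dom0_scaleR:
  assumes "z \<in> dom0" "0 \<le> t" "t \<le> 1"
  shows "t *\<^sub>R z \<in> dom0"
proof -
  have "norm ((t *\<^sub>R Zpart z) *v x) < norm x" if "x \<noteq> 0" for x
  proof -
    have "norm ((t *\<^sub>R Zpart z) *v x) = t * norm (Zpart z *v x)"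
    proof -
      have "(t *\<^sub>R Zpart z) *v x = t *\<^sub>R (Zpart z *v x)"
        by (simp add: vec_eq_iff matrix_vector_mult_def scaleR_sum_right)
      then show ?thesis using assms by simp
    qed
    also have "\<dots> \<le> 1 * norm (Zpart z *v x)" using assms by (intro mult_right_mono) auto
    also have "\<dots> < norm x" using assms(1) that by (simp add: dom0_def contr_def)
    finally show ?thesis .
  qed
  then show ?thesis by (simp add: dom0_def Zpart_scaleR contr_def)
qed

lemma detZ_radial_derivative:
  assumes "z \<in> dom0" "0 \<le> t" "t \<le> 1"
  shows "((\<lambda>t. - ln (detZ (t *\<^sub>R z))) has_real_derivative dlog (t *\<^sub>R z) z) (at t)"
proof -
  have "((\<lambda>t. t *\<^sub>R z) has_derivative (\<lambda>s. s *\<^sub>R z)) (at t)" by (auto intro!: derivative_eq_intros)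
  from has_derivative_compose[OF this ln_detZ_has_derivative[OF dom0_scaleR[OF assms]]]
  have "((\<lambda>t. - ln (detZ (t *\<^sub>R z))) has_derivative (\<lambda>s. dlog (t *\<^sub>R z) (s *\<^sub>R z))) (at t)" .
  moreover have "dlog (t *\<^sub>R z) (s *\<^sub>R z) = dlog (t *\<^sub>R z) z * s" for s
    using linear_cmul[OF has_derivative_linear[OF ln_detZ_has_derivative[OF dom0_scaleR[OF assms]]], of s z] by simp
  ultimately show ?thesis by (simp add: has_field_derivative_def)
qed

lemma detZ_zero: "Zpart z = 0 \<Longrightarrow> detZ z = 1"
  by (simp add: detZ_def)

text \<open>Along the ray through z the derivative of \<open>- ln detZ\<close> is
  \<open>2 t |A Z|^2\<close>, at least \<open>2 t |Z|^2\<close> because the inverse of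
  \<open>MZ\<close> dominates the identity.\<close>

lemma ln_detZ_lower:
  fixes z :: "complex^('p::finite uprod + 'r::finite)"
  assumes z: "z \<in> dom0"
  shows "(norm (Zpart z))\<^sup>2 \<le> - ln (detZ z)"
proof -
  define f where "f t = - ln (detZ (t *\<^sub>R z)) - t\<^sup>2 * (norm (Zpart z))\<^sup>2" for t
  have "f 0 \<le> f 1"
  proof (rule DERIV_nonneg_imp_nondecreasing[of 0 1])
    fix t :: real assume t: "0 \<le> t" "t \<le> 1"
    obtain A :: "complex^'p^'p" where A: "matrix_inv (MZ (t *\<^sub>R z)) = adj A ** A" using MZ_factor[OF dom0_scaleR[OF z t]] .
    have "((\<lambda>t. t\<^sup>2 * c) has_real_derivative 2 * t * c) (at t)" for c :: real
      by (auto intro!: derivative_eq_intros)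
    from DERIV_diff[OF detZ_radial_derivative[OF z t] this]
    have "(f has_real_derivative dlog (t *\<^sub>R z) z - 2 * t * (norm (Zpart z))\<^sup>2) (at t)"
      unfolding f_def[abs_def] .
    moreover have "2 * t * (norm (Zpart z))\<^sup>2 \<le> dlog (t *\<^sub>R z) z"
      unfolding dlog_radial[OF dom0_scaleR[OF z t] A Zpart_scaleR]
      using t inv_MZ_bounds(1)[OF dom0_scaleR[OF z t] A] by (intro mult_left_mono power_mono) auto
    ultimately show "\<exists>y. (f has_real_derivative y) (at t) \<and> 0 \<le> y" by (intro exI conjI) auto
  qed simp
  then show ?thesis by (simp add: f_def detZ_zero)
qed

lemma ln_detZ_mono:
  fixes z :: "complex^('p::finite uprod + 'r::finite)"
  assumes z: "z \<in> dom0" and s: "0 \<le> s" "s \<le> 1"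
  shows "- ln (detZ (s *\<^sub>R z)) \<le> - ln (detZ z)"
proof -
  have "- ln (detZ (s *\<^sub>R z)) \<le> - ln (detZ (1 *\<^sub>R z))"
  proof (rule DERIV_nonneg_imp_nondecreasing[OF s(2)])
    fix t assume "s \<le> t" "t \<le> 1"
    with s have t: "0 \<le> t" "t \<le> 1" by auto
    obtain A :: "complex^'p^'p" where A: "matrix_inv (MZ (t *\<^sub>R z)) = adj A ** A" using MZ_factor[OF dom0_scaleR[OF z t]] .
    have "0 \<le> dlog (t *\<^sub>R z) z"
      unfolding dlog_radial[OF dom0_scaleR[OF z t] A Zpart_scaleR] using t by simp
    then show "\<exists>y. ((\<lambda>t. - ln (detZ (t *\<^sub>R z))) has_real_derivative y) (at t) \<and> 0 \<le> y"
      using detZ_radial_derivative[OF z t] by blast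
  qed
  then show ?thesis by simp
qed

text \<open>The same integration along the ray with the upper bound for the inverse, which is the
  source of the factor 2. The smallness of Z passes to the whole segment from 0 to z.\<close>

lemma ln_detZ_upper:
  fixes z :: "complex^('p::finite uprod + 'r::finite)"
  assumes z: "z \<in> dom0" and half: "(norm (Zpart z))\<^sup>2 \<le> 1/2"
  shows "- ln (detZ z) \<le> 2 * (norm (Zpart z))\<^sup>2"
proof -
  define f where "f t = - ln (detZ (t *\<^sub>R z)) - t\<^sup>2 * (2 * (norm (Zpart z))\<^sup>2)" for t
  have "f 1 \<le> f 0"
  proof (rule DERIV_nonpos_imp_nonincreasing[of 0 1])
    fix t :: real assume t: "0 \<le> t" "t \<le> 1"
    obtain A :: "complex^'p^'p" where A: "matrix_inv (MZ (t *\<^sub>R z)) = adj A ** A" using MZ_factor[OF dom0_scaleR[OF z t]] .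
    have "((\<lambda>t. t\<^sup>2 * c) has_real_derivative 2 * t * c) (at t)" for c :: real
      by (auto intro!: derivative_eq_intros)
    from DERIV_diff[OF detZ_radial_derivative[OF z t] this]
    have "(f has_real_derivative dlog (t *\<^sub>R z) z - 2 * t * (2 * (norm (Zpart z))\<^sup>2)) (at t)"
      unfolding f_def[abs_def] .
    moreover have "dlog (t *\<^sub>R z) z \<le> 2 * t * (2 * (norm (Zpart z))\<^sup>2)"
    proof -
      have "(norm (Zpart (t *\<^sub>R z)))\<^sup>2 \<le> 1 * (norm (Zpart z))\<^sup>2"
        unfolding Zpart_scaleR norm_scaleR power_mult_distrib using t by (intro mult_right_mono) (auto simp: power_le_one)
      also have "\<dots> \<le> 1/2" using half by simp
      finally have "(norm (Zpart (t *\<^sub>R z)))\<^sup>2 \<le> 1/2" .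
      then show ?thesis
        unfolding dlog_radial[OF dom0_scaleR[OF z t] A Zpart_scaleR]
        using t inv_MZ_bounds(2)[OF dom0_scaleR[OF z t] A] by (intro mult_left_mono) auto
    qed
    ultimately show "\<exists>y. (f has_real_derivative y) (at t) \<and> y \<le> 0" by (intro exI conjI) auto
  qed simp
  then show ?thesis by (simp add: f_def detZ_zero)
qed

section \<open>Inner and outer ellipsoids and the moments of the domain\<close>

definition ellipsoid :: "real \<Rightarrow> (complex^('p::finite uprod + 'r::finite)) set" where
  "ellipsoid \<kappa> = {z. \<kappa> * (norm (Zpart z))\<^sup>2 + (norm (wpart z))\<^sup>2 < 1}"

text \<open>With \<open>s = |Z|^2\<close> the chain is
  \<open>|w|^2 < exp (- s / K) <= 1 / (1 + s / K) = 1 - s / (K + s)\<close>. Columns of a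
  contraction have norm at most 1, so \<open>s <= p\<close>, which gives the constant
  \<open>1 / (K + p)\<close>.\<close>

lemma Y_II_subset_ellipsoid:
  assumes K: "K > 0"
  shows "(Y_II K :: (complex^('p::finite uprod + 'r::finite)) set) \<subseteq> ellipsoid (1 / (K + real CARD('p)))"
proof
  fix z :: "complex^('p uprod + 'r)" assume "z \<in> Y_II K"
  then have z: "z \<in> dom0" "X_II K z < 1" by (auto simp: Y_II_iff[OF K])
  let ?s = "(norm (Zpart z))\<^sup>2"
  have s: "?s \<le> real CARD('p)"
  proof -
    have "norm (column j (Zpart z)) \<le> 1" for j
    proof -
      have "column j (Zpart z) = Zpart z *v axis j 1"
        by (simp add: vec_eq_iff column_def matrix_vector_mult_def axis_def if_distrib cong: if_cong)
      moreover have "norm (axis j (1::complex) :: complex^'p) = 1" by simp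
      ultimately show ?thesis using contr_le[of "Zpart z" "axis j 1"] z(1) by (simp add: dom0_def)
    qed
    then have "(\<Sum>j\<in>UNIV. (norm (column j (Zpart z)))\<^sup>2) \<le> (\<Sum>j\<in>(UNIV::'p set). 1)"
      by (intro sum_mono) (simp add: power_le_one)
    then show ?thesis by (simp add: norm_columns)
  qed
  have h: "?s / K \<le> hfun K z"
    unfolding hfun_def using ln_detZ_lower[OF z(1)] K by (intro divide_right_mono) auto
  have "(norm (wpart z))\<^sup>2 * exp (?s / K) \<le> (norm (wpart z))\<^sup>2 * exp (hfun K z)"
    using h by (intro mult_left_mono) auto
  also have "\<dots> < 1" using z X_II_eq[OF z(1), of K] by simp
  finally have "(norm (wpart z))\<^sup>2 < 1 / exp (?s / K)" by (simp add: field_simps)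
  also have "\<dots> \<le> 1 / (1 + ?s / K)"
    using K by (intro divide_left_mono exp_ge_add_one_self mult_pos_pos) (auto intro!: add_pos_nonneg)
  also have "\<dots> = 1 - ?s / (K + ?s)"
  proof -
    have "K + ?s > 0" using K by (simp add: add_pos_nonneg)
    then show ?thesis using K by (simp add: field_simps)
  qed
  also have "\<dots> \<le> 1 - ?s / (K + real CARD('p))"
    using s K by (intro diff_left_mono divide_left_mono mult_pos_pos) (auto intro!: add_pos_nonneg)
  finally show "z \<in> ellipsoid (1 / (K + real CARD('p)))" by (simp add: ellipsoid_def)
qed

text \<open>The bound on the log determinant gives \<open>h <= 2 s / K <= 2 s\<close> with
  \<open>s = |Z|^2\<close>, the last step by \<open>K >= 1\<close>; then
  \<open>1 - 2 s <= exp (- 2 s)\<close>.\<close>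

lemma ellipsoid_subset_Y_II:
  assumes K: "K \<ge> 1"
  shows "(ellipsoid 2 :: (complex^('p::finite uprod + 'r::finite)) set) \<subseteq> Y_II K"
proof
  fix z :: "complex^('p uprod + 'r)" assume "z \<in> ellipsoid 2"
  let ?s = "(norm (Zpart z))\<^sup>2"
  have e: "2 * ?s + (norm (wpart z))\<^sup>2 < 1" using \<open>z \<in> ellipsoid 2\<close> by (simp add: ellipsoid_def)
  have s2: "2 * ?s < 1" using e zero_le_power2[of "norm (wpart z)"] by linarith
  then have "norm (Zpart z) < 1"
    using power2_less_imp_less[of "norm (Zpart z)" 1] by simp
  then have "contr (Zpart z)"
    unfolding contr_def
  proof (intro allI impI)
    fix x :: "complex^'p" assume "x \<noteq> 0"
    have "norm (Zpart z *v x) \<le> norm (Zpart z) * norm x" by (rule norm_matrix_vector_le)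
    also have "\<dots> < 1 * norm x" using \<open>norm (Zpart z) < 1\<close> \<open>x \<noteq> 0\<close> by (intro mult_strict_right_mono) auto
    finally show "norm (Zpart z *v x) < norm x" by simp
  qed
  then have z: "z \<in> dom0" by (simp add: dom0_def)
  have "- ln (detZ z) / K \<le> (2 * ?s) / K"
    using ln_detZ_upper[OF z] s2 K by (intro divide_right_mono) auto
  also have "\<dots> \<le> 2 * ?s" using K by (simp add: divide_le_eq mult_le_cancel_left1)
  finally have h: "hfun K z \<le> 2 * ?s" by (simp add: hfun_def)
  have "(norm (wpart z))\<^sup>2 * exp (hfun K z) < 1"
  proof -
    have "(norm (wpart z))\<^sup>2 < 1 - 2 * ?s" using e by simp
    also have "\<dots> \<le> exp (- (2 * ?s))" using exp_ge_add_one_self[of "- (2 * ?s)"] by simp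
    also have "\<dots> \<le> exp (- hfun K z)" using h by simp
    finally show ?thesis by (simp add: exp_minus field_simps)
  qed
  then show "z \<in> Y_II K" using z K X_II_eq[OF z, of K] by (simp add: Y_II_iff)
qed

lemma norm_parts_coord:
  fixes z :: "complex^('p::finite uprod + 'r::finite)"
  shows "(norm (Zpart z))\<^sup>2 = (\<Sum>a\<in>UNIV. (cmod (z $ Inl a))\<^sup>2)"
    and "(norm (wpart z))\<^sup>2 = (\<Sum>j\<in>UNIV. (cmod (z $ Inr j))\<^sup>2)"
proof -
  show w: "(norm (wpart z))\<^sup>2 = (\<Sum>j\<in>UNIV. (cmod (z $ Inr j))\<^sup>2)"
    unfolding norm_vec_def L2_set_def by (simp add: sum_nonneg)
  have "(norm z)\<^sup>2 = (\<Sum>i\<in>UNIV. (cmod (z $ i))\<^sup>2)"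
    unfolding norm_vec_def L2_set_def by (simp add: sum_nonneg)
  also have "\<dots> = (\<Sum>a\<in>UNIV. (cmod (z $ Inl a))\<^sup>2) + (\<Sum>j\<in>UNIV. (cmod (z $ Inr j))\<^sup>2)"
    unfolding UNIV_sum by (subst sum.union_disjoint) (auto simp: sum.reindex)
  finally show "(norm (Zpart z))\<^sup>2 = (\<Sum>a\<in>UNIV. (cmod (z $ Inl a))\<^sup>2)"
    using norm_parts[of z] w by simp
qed

text \<open>Only the Z coordinates are rescaled, so the weight in w is untouched and the factor is
  the same for every m. Hence inclusions between ellipsoids compare all moments at once.\<close>

lemma ellipsoid_moment:
  fixes j :: "'r::finite"
  assumes \<kappa>: "\<kappa> > 0"
  shows "(\<integral>\<^sup>+z. indicator (ellipsoid \<kappa>) z * ennreal (cmod (z $ Inr j) ^ (2 * m)) \<partial>(lborel :: (complex^('p::finite uprod + 'r)) measure))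
    = ennreal ((1 / \<kappa>) ^ CARD('p uprod)) * ball_moment (Inr j :: 'p uprod + 'r) m"
proof -
  define c where "c i = (case i of Inl a \<Rightarrow> 1 / sqrt \<kappa> | Inr j \<Rightarrow> 1)" for i :: "'p uprod + 'r"
  let ?L = "\<lambda>z::complex^('p uprod + 'r). \<chi> i. of_real (c i) * z $ i"
  let ?f = "\<lambda>z::complex^('p uprod + 'r). indicator (ellipsoid \<kappa>) z * ennreal (cmod (z $ Inr j) ^ (2 * m))"
  have "open (ellipsoid \<kappa> :: (complex^('p uprod + 'r)) set)"
    unfolding ellipsoid_def
    by (intro open_Collect_less continuous_intros linear_continuous_on bounded_linear_Zpart bounded_linear_wpart)
  then have [measurable]: "(ellipsoid \<kappa> :: (complex^('p uprod + 'r)) set) \<in> sets borel" by simp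
  have eq: "?L z \<in> ellipsoid \<kappa> \<longleftrightarrow> z \<in> ball 0 1" for z
  proof -
    have "\<kappa> * (norm (Zpart (?L z)))\<^sup>2 = (norm (Zpart z))\<^sup>2"
      unfolding norm_parts_coord using \<kappa>
      by (simp add: c_def norm_mult norm_divide power_mult_distrib power_divide sum_distrib_left)
    moreover have "(norm (wpart (?L z)))\<^sup>2 = (norm (wpart z))\<^sup>2"
      unfolding norm_parts_coord by (simp add: c_def)
    ultimately show ?thesis
      using norm_parts[of z] abs_square_less_1[of "norm z"] by (simp add: ellipsoid_def)
  qed
  have pr: "(\<Prod>i\<in>UNIV. (c i)\<^sup>2) = (1 / \<kappa>) ^ CARD('p uprod)"
    unfolding UNIV_sum using \<kappa>
    by (subst prod.union_disjoint) (auto simp: prod.reindex c_def power_divide)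
  have "(\<integral>\<^sup>+z. ?f z \<partial>lborel) = ennreal (\<Prod>i\<in>UNIV. (c i)\<^sup>2) * (\<integral>\<^sup>+z. ?f (?L z) \<partial>lborel)"
    by (rule nn_integral_diagonal) (use \<kappa> in \<open>auto simp: c_def split: sum.split\<close>)
  also have "(\<integral>\<^sup>+z. ?f (?L z) \<partial>lborel) = ball_moment (Inr j :: 'p uprod + 'r) m"
    unfolding ball_moment_def
    by (intro nn_integral_cong) (use eq in \<open>auto simp: indicator_def c_def\<close>)
  finally show ?thesis by (simp add: pr)
qed

text \<open>\<open>ball_moment_Suc\<close> and \<open>nbin_Suc\<close> are recursions with
  reciprocal ratios, so the product of the moment with \<open>nbin\<close> is constant, namely the
  volume of the ball.\<close>

lemma ball_moment_eq:
  fixes j :: "'n::finite"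
  obtains v where "v > 0" "\<And>m. ball_moment j m = ennreal (v / nbin CARD('n) m)"
proof -
  define v where "v = measure lborel (ball (0 :: complex^'n) 1)"
  have base: "ball_moment j 0 = ennreal v"
  proof -
    have "ball_moment j 0 = emeasure lborel (ball (0 :: complex^'n) 1)"
      unfolding ball_moment_def by simp
    also have "\<dots> = ennreal v"
      unfolding v_def using emeasure_bounded_finite[OF bounded_ball[of "0 :: complex^'n" 1]]
      by (intro emeasure_eq_ennreal_measure) simp
    finally show ?thesis .
  qed
  have v: "v > 0" unfolding v_def by (simp add: content_ball_pos)
  have "ball_moment j m = ennreal (v / nbin CARD('n) m)" for m
  proof (induction m)
    case 0
    show ?case using base by (simp add: nbin_def)
  next
    case (Suc m)
    have "ball_moment j (Suc m) = ennreal (real (Suc m)) * (ennreal (1 / real (Suc m)) * ball_moment j (Suc m))"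
    proof -
      have "ennreal (real (Suc m)) * ennreal (1 / real (Suc m)) = 1"
        by (simp add: ennreal_mult[symmetric] del: of_nat_Suc)
      then show ?thesis by (simp only: mult.assoc[symmetric] mult_1)
    qed
    also have "\<dots> = ennreal (real (Suc m)) * (ennreal (1 / real (m + CARD('n) + 1)) * ennreal (v / nbin CARD('n) m))"
      by (simp only: ball_moment_Suc Suc)
    also have "\<dots> = ennreal (real (Suc m) * (1 / real (m + CARD('n) + 1) * (v / nbin CARD('n) m)))"
      using v nbin_pos[of "CARD('n)" m] by (simp only: ennreal_mult[symmetric] divide_nonneg_pos less_imp_le of_nat_0_le_iff) (subst ennreal_mult; simp)
    also have "real (Suc m) * (1 / real (m + CARD('n) + 1) * (v / nbin CARD('n) m)) = v / nbin CARD('n) (Suc m)"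
    proof -
      have "nbin CARD('n) (Suc m) = real (m + CARD('n) + 1) * nbin CARD('n) m / real (Suc m)"
        using nbin_Suc[of m "CARD('n)"] by (simp add: field_simps del: of_nat_Suc)
      then show ?thesis by (simp del: of_nat_Suc)
    qed
    finally show ?case .
  qed
  with v show ?thesis by (rule that)
qed

text \<open>The type argument fixes the size p of the matrices, which the type of e does not
  reveal.\<close>

definition Y_moment :: "real \<Rightarrow> 'p::finite itself \<Rightarrow> complex^'r::finite \<Rightarrow> nat \<Rightarrow> real" where
  "Y_moment K _ e m = (LINT z:(Y_II K :: (complex^('p uprod + 'r)) set)|lborel. cmod (herm (wpart z) e) ^ (2 * m))"

lemma Y_moment_bounds:
  fixes j :: "'r::finite"
  assumes K: "K \<ge> 1" and open_Y: "open (Y_II K :: (complex^('p::finite uprod + 'r)) set)"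
  obtains \<gamma>1 \<gamma>2 where "\<gamma>1 > 0"
    "\<And>m. \<gamma>1 / nbin CARD('p uprod + 'r) m \<le> Y_moment K TYPE('p) (axis j 1) m"
    "\<And>m. Y_moment K TYPE('p) (axis j 1) m \<le> \<gamma>2 / nbin CARD('p uprod + 'r) m"
proof -
  let ?Y = "Y_II K :: (complex^('p uprod + 'r)) set"
  let ?N = "CARD('p uprod + 'r)"
  obtain v where v: "v > 0" "\<And>m. ball_moment (Inr j :: 'p uprod + 'r) m = ennreal (v / nbin ?N m)"
    using ball_moment_eq[where j = "Inr j :: 'p uprod + 'r"] by blast
  define \<kappa> where "\<kappa> = 1 / (K + real CARD('p))"
  have \<kappa>: "\<kappa> > 0" using K by (simp add: \<kappa>_def add_pos_nonneg)
  have [measurable]: "?Y \<in> sets borel" using open_Y by simp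
  let ?g = "\<lambda>m (z :: complex^('p uprod + 'r)). ennreal (cmod (z $ Inr j) ^ (2 * m))"
  let ?I = "\<lambda>m. \<integral>\<^sup>+z. indicator ?Y z * ?g m z \<partial>lborel"
  have e: "herm (wpart z) (axis j 1) = z $ Inr j" for z :: "complex^('p uprod + 'r)"
    by (simp add: herm_def axis_def if_distrib cong: if_cong)
  have lo: "ennreal ((1 / 2) ^ CARD('p uprod) * v / nbin ?N m) \<le> ?I m" for m
  proof -
    have "ennreal ((1 / 2) ^ CARD('p uprod) * v / nbin ?N m) = ennreal ((1/2) ^ CARD('p uprod)) * ball_moment (Inr j :: 'p uprod + 'r) m"
      unfolding v(2) using v(1) nbin_pos[of ?N m] by (subst ennreal_mult[symmetric]) auto
    also have "\<dots> = (\<integral>\<^sup>+z. indicator (ellipsoid 2) z * ?g m z \<partial>lborel)"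
      by (rule ellipsoid_moment[where \<kappa> = 2, symmetric]) simp
    also have "\<dots> \<le> ?I m"
      using ellipsoid_subset_Y_II[OF K, where ?'p = 'p and ?'r = 'r] by (intro nn_integral_mono mult_right_mono) (auto simp: indicator_def)
    finally show ?thesis .
  qed
  have hi: "?I m \<le> ennreal ((1 / \<kappa>) ^ CARD('p uprod) * v / nbin ?N m)" for m
  proof -
    have K0: "K > 0" using K by simp
    have "?I m \<le> (\<integral>\<^sup>+z. indicator (ellipsoid \<kappa>) z * ?g m z \<partial>lborel)"
      using Y_II_subset_ellipsoid[OF K0, where ?'p = 'p and ?'r = 'r]
      by (intro nn_integral_mono mult_right_mono) (auto simp: indicator_def \<kappa>_def)
    also have "\<dots> = ennreal ((1 / \<kappa>) ^ CARD('p uprod)) * ball_moment (Inr j :: 'p uprod + 'r) m"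
      by (rule ellipsoid_moment[OF \<kappa>])
    also have "\<dots> = ennreal ((1 / \<kappa>) ^ CARD('p uprod) * v / nbin ?N m)"
      unfolding v(2) using v(1) \<kappa> nbin_pos[of ?N m] by (subst ennreal_mult[symmetric]) auto
    finally show ?thesis .
  qed
  have mom: "Y_moment K TYPE('p) (axis j 1) m = enn2real (?I m)" for m
  proof -
    have "Y_moment K TYPE('p) (axis j 1) m = enn2real (\<integral>\<^sup>+z. ennreal (indicator ?Y z *\<^sub>R cmod (z $ Inr j) ^ (2 * m)) \<partial>lborel)"
      unfolding Y_moment_def set_lebesgue_integral_def e
    proof (rule integral_eq_nn_integral)
      have "(\<lambda>z :: complex^('p uprod + 'r). cmod (z $ Inr j) ^ (2 * m)) \<in> borel_measurable borel"
        by (intro borel_measurable_continuous_onI continuous_intros)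
      then show "(\<lambda>z. indicator ?Y z *\<^sub>R cmod (z $ Inr j) ^ (2 * m)) \<in> borel_measurable lborel" by simp
    qed simp
    also have "(\<integral>\<^sup>+z. ennreal (indicator ?Y z *\<^sub>R cmod (z $ Inr j) ^ (2 * m)) \<partial>lborel) = ?I m"
      by (intro nn_integral_cong) (auto simp: indicator_def)
    finally show ?thesis .
  qed
  show ?thesis
  proof (rule that[of "(1 / 2) ^ CARD('p uprod) * v" "(1 / \<kappa>) ^ CARD('p uprod) * v"])
    fix m
    have nn: "0 \<le> (1 / 2) ^ CARD('p uprod) * v / nbin ?N m" "0 \<le> (1 / \<kappa>) ^ CARD('p uprod) * v / nbin ?N m"
      using v(1) \<kappa> nbin_pos[of ?N m] by (auto intro!: divide_nonneg_pos)
    \<comment> \<open>\<open>enn2real\<close> sends infinity to 0, so the lower bound survives the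
      conversion only for finite values.\<close>
    have fin: "?I m < \<infinity>" using hi[of m] by (simp add: le_less_trans)
    show "(1 / 2) ^ CARD('p uprod) * v / nbin ?N m \<le> Y_moment K TYPE('p) (axis j 1) m"
      unfolding mom using enn2real_mono[OF lo[of m]] fin nn by simp
    show "Y_moment K TYPE('p) (axis j 1) m \<le> (1 / \<kappa>) ^ CARD('p uprod) * v / nbin ?N m"
      unfolding mom using enn2real_mono[OF hi[of m]] nn by simp
  qed (use v in simp)
qed

section \<open>The reproducing property over the fibre \<open>Z = 0\<close>\<close>

lemma lborel_isometry:
  fixes L :: "complex^'n::finite \<Rightarrow> complex^'n"
  assumes L: "linear L" "\<And>x. norm (L x) = norm x"
  shows "distr lborel borel L = lborel"
proof (rule measure_eqI)
  have m: "L \<in> borel_measurable borel"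
    by (intro borel_measurable_continuous_onI linear_continuous_on) (simp add: L flip: linear_conv_bounded_linear)
  have inj: "inj L" using L by (simp add: linear_injective_0 del: norm_eq_zero) (metis norm_eq_zero)
  then have bij: "bij L" using linear_injective_imp_surjective[OF L(1)] by (simp add: bij_def)
  fix B assume "B \<in> sets (distr lborel borel L)"
  then have B: "B \<in> sets borel" by simp
  have "emeasure lborel B = (\<integral>\<^sup>+y. indicator B y * indicator UNIV y \<partial>lborel)"
    using B by simp
  also have "\<dots> = (\<integral>\<^sup>+x. indicator B (L x) * ennreal 1 * indicator UNIV x \<partial>lborel)"
    by (rule nn_integral_change_of_variables[where g' = "\<lambda>_. L" and a = "\<lambda>_. 1"])
       (use L bij B in \<open>auto intro: linear_imp_has_derivative adet_isometry\<close>)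
  also have "\<dots> = (\<integral>\<^sup>+x. indicator (L -` B) x \<partial>lborel)"
    by (intro nn_integral_cong) (simp add: indicator_def)
  also have "\<dots> = emeasure lborel (L -` B)"
    using measurable_sets_borel[OF m B] by (intro nn_integral_indicator) simp
  also have "\<dots> = emeasure (distr lborel borel L) B"
    using B m by (simp add: emeasure_distr)
  finally show "emeasure (distr lborel borel L) B = emeasure lborel B" by simp
qed simp

text \<open>Each \<open>W t\<close> preserves Lebesgue measure and Y, so Fubini leaves the integral
  unchanged. Joint continuity makes the integrand measurable on the product.\<close>

lemma rotation_average:
  fixes W :: "real \<Rightarrow> complex^'n::finite \<Rightarrow> complex^'n" and h :: "complex^'n \<Rightarrow> complex"
  assumes Y: "open Y" and lin: "\<And>t. linear (W t)" and iso: "\<And>t x. norm (W t x) = norm x"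
    and contW: "continuous_on UNIV (\<lambda>x. W (fst x) (snd x))" and inv: "\<And>t z. W t z \<in> Y \<longleftrightarrow> z \<in> Y"
    and h: "continuous_on Y h" "set_integrable lborel Y h"
  shows "set_integrable lborel Y (\<lambda>z. LINT t:{0..1}|lborel. h (W t z))"
    and "(LINT z:Y|lborel. (LINT t:{0..1}|lborel. h (W t z))) = (LINT z:Y|lborel. h z)"
proof -
  define h0 where "h0 z = indicator Y z *\<^sub>R h z" for z
  have h0m: "h0 \<in> borel_measurable borel"
    unfolding h0_def[abs_def] using Y h(1) by (intro borel_measurable_continuous_on_indicator) auto
  have h0i: "integrable lborel h0" using h(2) by (simp add: set_integrable_def h0_def[abs_def])
  define F where "F x = indicator {0..1} (fst x) *\<^sub>R h0 (W (fst x) (snd x))" for x :: "real \<times> (complex^'n)"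
  have Wm: "W t \<in> borel_measurable borel" for t
    by (intro borel_measurable_continuous_onI linear_continuous_on) (simp add: lin flip: linear_conv_bounded_linear)
  have inv_int: "integrable lborel (\<lambda>z. g (W t z)) \<and> (\<integral>z. g (W t z) \<partial>lborel) = (\<integral>z. g z \<partial>lborel)"
    if "g \<in> borel_measurable borel" "integrable lborel g" for g :: "complex^'n \<Rightarrow> 'b::{banach,second_countable_topology}" and t
  proof -
    have Wl: "W t \<in> measurable lborel borel" using Wm by simp
    have "integrable (distr lborel borel (W t)) g" using that lborel_isometry[OF lin iso] by simp
    then have "integrable lborel (\<lambda>z. g (W t z))" using that Wl by (simp add: integrable_distr_eq)
    moreover have "(\<integral>z. g (W t z) \<partial>lborel) = (\<integral>z. g z \<partial>distr lborel borel (W t))"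
      using that(1) Wl by (rule integral_distr[symmetric, rotated])
    ultimately show ?thesis using lborel_isometry[OF lin iso] by simp
  qed
  have Fm: "F \<in> borel_measurable (lborel \<Otimes>\<^sub>M lborel)"
  proof -
    have "(\<lambda>x. W (fst x) (snd x)) \<in> borel_measurable (borel :: (real \<times> (complex^'n)) measure)"
      by (rule borel_measurable_continuous_onI[OF contW])
    then have 1: "(\<lambda>x. h0 (W (fst x) (snd x))) \<in> borel_measurable (borel :: (real \<times> (complex^'n)) measure)"
      by (rule measurable_compose) (rule h0m)
    have 2: "(\<lambda>x. indicator {0..1} (fst x) :: real) \<in> borel_measurable (borel :: (real \<times> (complex^'n)) measure)"
    proof -
      have "fst \<in> borel_measurable (borel :: (real \<times> (complex^'n)) measure)"
        by (intro borel_measurable_continuous_onI continuous_on_fst continuous_on_id)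
      then show ?thesis by (rule measurable_compose) simp
    qed
    show ?thesis unfolding F_def[abs_def] lborel_prod using borel_measurable_scaleR[OF 2 1] by simp
  qed
  have Fi: "integrable (lborel \<Otimes>\<^sub>M lborel) F"
  proof (rule lborel_pair.Fubini_integrable[OF Fm])
    have "(\<integral>z. norm (F (t, z)) \<partial>lborel) = indicator {0..1} t *\<^sub>R (\<integral>z. norm (h0 z) \<partial>lborel)" for t
    proof -
      have "(\<integral>z. norm (h0 (W t z)) \<partial>lborel) = (\<integral>z. norm (h0 z) \<partial>lborel)"
        using inv_int[of "\<lambda>z. norm (h0 z)" t] h0m h0i by simp
      then show ?thesis by (simp add: F_def indicator_def)
    qed
    then show "integrable lborel (\<lambda>t. \<integral>z. norm (F (t, z)) \<partial>lborel)" by simp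
    show "AE t in lborel. integrable lborel (\<lambda>z. F (t, z))"
      using inv_int[OF h0m h0i] by (simp add: F_def)
  qed
  then have Fi': "integrable (lborel \<Otimes>\<^sub>M lborel) (case_prod (\<lambda>t z. F (t, z)))" by simp
  have sl: "(\<integral>t. F (t, z) \<partial>lborel) = indicator Y z *\<^sub>R (LINT t:{0..1}|lborel. h (W t z))" for z
    by (simp add: F_def h0_def set_lebesgue_integral_def indicator_def inv)
  show "set_integrable lborel Y (\<lambda>z. LINT t:{0..1}|lborel. h (W t z))"
    unfolding set_integrable_def using lborel_pair.integrable_snd[OF Fi'] by (simp add: sl)
  have "(\<integral>z. (\<integral>t. F (t, z) \<partial>lborel) \<partial>lborel) = (\<integral>t. (\<integral>z. F (t, z) \<partial>lborel) \<partial>lborel)"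
    using lborel_pair.integral_fst[OF Fi'] lborel_pair.integral_snd[OF Fi'] by simp
  also have "\<dots> = (\<integral>t. indicator {0..1::real} t *\<^sub>R (\<integral>z. h0 z \<partial>lborel) \<partial>lborel)"
  proof -
    have "(\<integral>z. F (t, z) \<partial>lborel) = indicator {0..1} t *\<^sub>R (\<integral>z. h0 z \<partial>lborel)" for t
      using inv_int[OF h0m h0i, of t] by (simp add: F_def)
    then show ?thesis by (simp only:)
  qed
  also have "\<dots> = (\<integral>z. h0 z \<partial>lborel)"
  proof -
    have "(\<integral>t. indicator {0..1::real} t *\<^sub>R (\<integral>z. h0 z \<partial>lborel) \<partial>lborel)
        = (\<integral>t. indicator {0..1::real} t \<partial>lborel) *\<^sub>R (\<integral>z. h0 z \<partial>lborel)"
      by (rule integral_scaleR_left) simp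
    then show ?thesis by simp
  qed
  finally show "(LINT z:Y|lborel. (LINT t:{0..1}|lborel. h (W t z))) = (LINT z:Y|lborel. h z)"
    unfolding sl by (simp add: set_lebesgue_integral_def h0_def)
qed

text \<open>Cauchy's formula for the m-th derivative on the unit circle, where dividing by a point
  is multiplying by its conjugate. For \<open>m = 0\<close> it is the mean value property.\<close>

lemma circle_coefficient:
  assumes S: "open S" "cball 0 1 \<subseteq> S" and \<phi>: "\<phi> holomorphic_on S"
  shows "(LINT t:{0..1}|lborel. \<phi> (cis (2 * pi * t)) * cnj (cis (2 * pi * t)) ^ m) = (deriv ^^ m) \<phi> 0 / fact m"
proof -
  have c: "continuous_on (cball 0 1) \<phi>"
    using \<phi> S holomorphic_on_imp_continuous_on holomorphic_on_subset by metis
  have hol: "\<phi> holomorphic_on ball 0 1"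
    using \<phi> S holomorphic_on_subset ball_subset_cball by (metis order_trans)
  let ?f = "\<lambda>t. \<phi> (cis (2 * pi * t)) * cnj (cis (2 * pi * t)) ^ m"
  have cp: "circlepath 0 1 t = cis (2 * pi * t)" for t
    by (simp add: circlepath cis_conv_exp mult_ac)
  have "((\<lambda>u. \<phi> u / (u - 0) ^ Suc m) has_contour_integral ((2 * pi * \<i>) / fact m * (deriv ^^ m) \<phi> 0)) (circlepath 0 1)"
    by (rule Cauchy_has_contour_integral_higher_derivative_circlepath[OF c hol]) simp
  then have "((\<lambda>t. \<phi> (cis (2 * pi * t)) / cis (2 * pi * t) ^ Suc m * vector_derivative (circlepath 0 1) (at t within {0..1}))
      has_integral ((2 * pi * \<i>) / fact m * (deriv ^^ m) \<phi> 0)) {0..1}"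
    by (simp add: has_contour_integral_def cp)
  then have "((\<lambda>t. (2 * pi * \<i>) * ?f t) has_integral ((2 * pi * \<i>) / fact m * (deriv ^^ m) \<phi> 0)) {0..1}"
  proof (rule has_integral_eq[rotated])
    fix t :: real assume t: "t \<in> {0..1}"
    have v: "vector_derivative (circlepath 0 1) (at t within {0..1}) = 2 * pi * \<i> * cis (2 * pi * t)"
      using t by (simp add: vector_derivative_circlepath01 cis_conv_exp mult_ac)
    define E where "E = cis (2 * pi * t)"
    have i: "cnj E = inverse E" "E \<noteq> 0" by (simp_all add: E_def cis_cnj)
    show "\<phi> (cis (2 * pi * t)) / cis (2 * pi * t) ^ Suc m * vector_derivative (circlepath 0 1) (at t within {0..1})
        = (2 * pi * \<i>) * ?f t"
      unfolding v E_def[symmetric] i(1) using i(2) by (simp add: field_simps)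
  qed
  then have "((\<lambda>t. 1 / (2 * pi * \<i>) * ((2 * pi * \<i>) * ?f t)) has_integral 1 / (2 * pi * \<i>) * ((2 * pi * \<i>) / fact m * (deriv ^^ m) \<phi> 0)) {0..1}"
    by (rule has_integral_mult_right)
  then have hi: "(?f has_integral (deriv ^^ m) \<phi> 0 / fact m) {0..1}" by simp
  have "continuous_on {0..1} ?f"
    by (intro continuous_intros continuous_on_compose2[OF c]) auto
  then have "set_integrable lborel {0..1} ?f" by (rule borel_integrable_atLeastAtMost')
  then have "(LINT t:{0..1}|lborel. ?f t) = integral {0..1} ?f" by (simp add: set_borel_integral_eq_integral)
  then show ?thesis using hi by (simp add: integral_unique)
qed

lemma norm_mat_mult_vec: "norm ((mat c ** Z) *v x) = cmod c * norm (Z *v (x :: complex^'n::finite))"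
proof -
  have "(mat c ** Z) *v x = c *s (Z *v x)"
    by (simp add: vec_eq_iff matrix_vector_mult_def sum_distrib_left mult.assoc)
  then show ?thesis
    unfolding norm_vec_def L2_set_def
    by (simp add: norm_mult power_mult_distrib sum_distrib_left[symmetric] real_sqrt_mult)
qed

text \<open>\<open>detZ\<close> depends on c only through its modulus and \<open>- ln detZ\<close>
  increases along rays, so shrinking Z and w can only lower X. This keeps the discs on which
  Cauchy's formula is applied inside the domain.\<close>

lemma Y_II_shrink:
  fixes z z' :: "complex^('p::finite uprod + 'r::finite)"
  assumes K: "K > 0" and z: "z \<in> Y_II K" and c: "cmod c \<le> 1"
    and Z: "Zpart z' = mat c ** Zpart z" and w: "norm (wpart z') \<le> norm (wpart z)"
  shows "z' \<in> Y_II K"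
proof -
  have z0: "z \<in> dom0" "X_II K z < 1" using z by (auto simp: Y_II_iff[OF K])
  have "norm (Zpart z' *v x) < norm x" if "x \<noteq> 0" for x
  proof -
    have "norm (Zpart z' *v x) \<le> 1 * norm (Zpart z *v x)"
      unfolding Z norm_mat_mult_vec using c by (intro mult_right_mono) auto
    also have "\<dots> < norm x" using z0(1) that by (simp add: dom0_def contr_def)
    finally show ?thesis .
  qed
  then have d: "z' \<in> dom0" by (simp add: dom0_def contr_def)
  have "Zpart z' ** conj_mat (Zpart z') = Zpart (cmod c *\<^sub>R z) ** conj_mat (Zpart (cmod c *\<^sub>R z))"
  proof -
    have "Zpart z' ** conj_mat (Zpart z') = mat c ** ((Zpart z ** mat (cnj c)) ** conj_mat (Zpart z))"
      by (simp only: Z conj_mat_mult conj_mat_mat matrix_mul_assoc)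
    also have "\<dots> = mat c ** (mat (cnj c) ** (Zpart z ** conj_mat (Zpart z)))"
      unfolding mat_commute[of "Zpart z"] by (simp only: matrix_mul_assoc)
    also have "\<dots> = mat (of_real ((cmod c)\<^sup>2)) ** (Zpart z ** conj_mat (Zpart z))"
      by (simp add: vec_eq_iff complex_norm_square mult.assoc del: of_real_power)
    also have "\<dots> = Zpart (cmod c *\<^sub>R z) ** conj_mat (Zpart (cmod c *\<^sub>R z))"
    proof -
      have "conj_mat (r *\<^sub>R B) = r *\<^sub>R conj_mat B" for r and B :: "complex^'p^'p" by (simp add: vec_eq_iff)
      moreover have "mat (of_real s) ** B = s *\<^sub>R B" for s and B :: "complex^'p^'p"
        by (simp add: vec_eq_iff complex_eq_iff)
      ultimately show ?thesis
        unfolding Zpart_scaleR by (simp only: matrix_scaleR_left matrix_scaleR_right scaleR_scaleR power2_eq_square)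
    qed
    finally show ?thesis .
  qed
  then have "detZ z' = detZ (cmod c *\<^sub>R z)" by (simp add: detZ_def)
  then have "- ln (detZ z') \<le> - ln (detZ z)" using ln_detZ_mono[OF z0(1) _ c] by simp
  then have h: "hfun K z' \<le> hfun K z" using K unfolding hfun_def by (intro divide_right_mono) auto
  have "X_II K z' \<le> X_II K z"
    unfolding X_II_eq[OF d] X_II_eq[OF z0(1)] using w h by (intro mult_mono power_mono) auto
  then show ?thesis using d z0 by (simp add: Y_II_iff[OF K])
qed

lemma bounded_Y_II:
  assumes K: "K > 0"
  shows "bounded (Y_II K :: (complex^('p::finite uprod + 'r::finite)) set)"
proof -
  define \<kappa> where "\<kappa> = 1 / (K + real CARD('p))"
  have \<kappa>: "\<kappa> > 0" using K by (simp add: \<kappa>_def add_pos_nonneg)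
  have "norm z \<le> 1 / \<kappa> + 1 + 1" if "z \<in> Y_II K" for z :: "complex^('p uprod + 'r)"
  proof -
    have e: "\<kappa> * (norm (Zpart z))\<^sup>2 + (norm (wpart z))\<^sup>2 < 1"
      using that Y_II_subset_ellipsoid[OF K] by (auto simp: ellipsoid_def \<kappa>_def)
    have "\<kappa> * (norm (Zpart z))\<^sup>2 \<ge> 0" using \<kappa> by simp
    then have w: "(norm (wpart z))\<^sup>2 \<le> 1" using e by linarith
    have "\<kappa> * (norm (Zpart z))\<^sup>2 \<le> 1" using e zero_le_power2[of "norm (wpart z)"] by linarith
    then have "(norm (Zpart z))\<^sup>2 \<le> 1 / \<kappa>" using \<kappa> by (simp add: field_simps)
    then have n: "(norm z)\<^sup>2 \<le> 1 / \<kappa> + 1" unfolding norm_parts[of z] using w by simp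
    have "norm z \<le> (norm z)\<^sup>2 + 1"
    proof (cases "norm z \<le> 1")
      case False
      then have "norm z * 1 \<le> norm z * norm z" by (intro mult_left_mono) auto
      then show ?thesis by (simp add: power2_eq_square)
    qed (simp add: add_increasing)
    then show ?thesis using n by simp
  qed
  then show ?thesis unfolding bounded_iff by blast
qed

lemma emeasure_Y_II_finite: "K > 0 \<Longrightarrow> emeasure lborel (Y_II K :: (complex^('p::finite uprod + 'r::finite)) set) < \<infinity>"
  by (rule emeasure_bounded_finite[OF bounded_Y_II])

text \<open>The domain has finite volume and \<open>|f| <= |f|^2 + 1\<close>, so square integrable
  functions are integrable against bounded ones.\<close>

lemma bergman_space_integrable:
  fixes f :: "complex^('p::finite uprod + 'r::finite) \<Rightarrow> complex"
  assumes K: "K > 0" and f: "f \<in> bergman_space (Y_II K)" and g: "continuous_on (Y_II K) g" "\<And>z. z \<in> Y_II K \<Longrightarrow> cmod (g z) \<le> B"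
  shows "set_integrable lborel (Y_II K) (\<lambda>z. f z * g z)"
proof -
  let ?Y = "Y_II K :: (complex^('p uprod + 'r)) set"
  have Y: "?Y \<in> sets borel" by (intro borel_open open_Y_II K)
  have hol: "holomorphic_cn f ?Y" and sq: "set_integrable lborel ?Y (\<lambda>z. (cmod (f z))\<^sup>2)"
    using f by (auto simp: bergman_space_def)
  have m: "(\<lambda>z. indicator ?Y z *\<^sub>R (f z * g z)) \<in> borel_measurable lborel"
    using Y holomorphic_cn_continuous[OF hol] g(1)
    by (simp add: borel_measurable_continuous_on_indicator continuous_on_mult)
  have "integrable lborel (\<lambda>z. \<bar>B\<bar> *\<^sub>R (indicator ?Y z *\<^sub>R (cmod (f z))\<^sup>2) + \<bar>B\<bar> *\<^sub>R indicator ?Y z)"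
    using sq emeasure_Y_II_finite[OF K] Y
    by (intro Bochner_Integration.integrable_add integrable_scaleR_right) (auto simp: set_integrable_def)
  then show ?thesis
    unfolding set_integrable_def
  proof (rule Bochner_Integration.integrable_bound[OF _ m], intro AE_I2)
    fix z
    show "norm (indicator ?Y z *\<^sub>R (f z * g z)) \<le> norm (\<bar>B\<bar> *\<^sub>R (indicator ?Y z *\<^sub>R (cmod (f z))\<^sup>2) + \<bar>B\<bar> *\<^sub>R indicator ?Y z)"
    proof (cases "z \<in> ?Y")
      case True
      have "cmod (f z) \<le> (cmod (f z))\<^sup>2 + 1"
        using zero_le_power2[of "cmod (f z) - 1/2"] by (simp add: power2_eq_square algebra_simps)
      then have "cmod (f z) * cmod (g z) \<le> ((cmod (f z))\<^sup>2 + 1) * \<bar>B\<bar>"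
        using g(2)[OF True] by (intro mult_mono) auto
      then show ?thesis using True by (simp add: norm_mult algebra_simps)
    qed simp
  qed
qed

section \<open>Rotations about a complex line in the fibre over \<open>Z = 0\<close>\<close>

definition fibre_proj :: "complex^'r::finite \<Rightarrow> complex^('p::finite uprod + 'r) \<Rightarrow> complex^('p uprod + 'r)" where
  "fibre_proj e z = mk 0 (herm (wpart z) e *s e)"

lemma Zpart_mk_zero [simp]: "Zpart (mk 0 w :: complex^('p::finite uprod + 'r::finite)) = 0"
  by (rule Zpart_mk) (simp add: vec_eq_iff transpose_def)

lemma norm_vec_scale: "norm (c *s x) = cmod c * norm (x :: complex^'n::finite)"
  unfolding norm_vec_def L2_set_def by (simp add: norm_mult power_mult_distrib sum_distrib_left[symmetric] real_sqrt_mult)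

lemma norm_orthogonal_add:
  assumes "herm x y = 0"
  shows "(norm (x + y))\<^sup>2 = (norm x)\<^sup>2 + (norm y)\<^sup>2"
proof -
  have "x \<bullet> y = 0" using Re_herm[of x y] assms by simp
  then show ?thesis by (simp add: power2_norm_eq_inner inner_add_left inner_add_right inner_commute)
qed

lemma mk0_in_Y_II:
  assumes "K > 0" "norm w < 1"
  shows "(mk 0 w :: complex^('p::finite uprod + 'r::finite)) \<in> Y_II K"
proof -
  let ?z = "mk 0 w :: complex^('p uprod + 'r)"
  have d: "?z \<in> dom0" by (simp add: dom0_def contr_def)
  have "hfun K ?z = 0" by (simp add: hfun_def detZ_zero)
  then show ?thesis using assms d X_II_eq[OF d, of K] by (simp add: Y_II_iff abs_square_less_1)
qed

lemma norm_wpart_less: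
  fixes z :: "complex^('p::finite uprod + 'r::finite)"
  assumes "K > 0" "z \<in> Y_II K"
  shows "norm (wpart z) < 1"
proof -
  have "\<kappa> * (norm (Zpart z))\<^sup>2 + (norm (wpart z))\<^sup>2 < 1" if "\<kappa> = 1 / (K + real CARD('p))" for \<kappa>
    using assms Y_II_subset_ellipsoid[OF assms(1)] that by (auto simp: ellipsoid_def)
  moreover have "1 / (K + real CARD('p)) * (norm (Zpart z))\<^sup>2 \<ge> 0" using assms(1) by simp
  ultimately have "(norm (wpart z))\<^sup>2 < 1" by (smt (verit))
  then show ?thesis by (simp add: abs_square_less_1)
qed

context
  fixes K :: real and e :: "complex^'r::finite"
  assumes K: "K > 0" and e: "norm e = 1"
begin

lemma herm_ee: "herm e e = 1"
  using e by (simp add: herm_self)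

lemma herm_perp: "herm (w - herm w e *s e) e = 0"
  by (simp add: herm_diff_left herm_scale_left herm_ee)

lemma norm_split: "(norm w)\<^sup>2 = (cmod (herm w e))\<^sup>2 + (norm (w - herm w e *s e))\<^sup>2"
proof -
  have "herm (herm w e *s e) (w - herm w e *s e) = 0"
    using herm_perp[of w] herm_commute by (metis complex_cnj_zero herm_scale_left mult_zero_right)
  from norm_orthogonal_add[OF this] show ?thesis by (simp add: norm_vec_scale e power_mult_distrib)
qed

text \<open>Multiplies everything orthogonal to the line of e, the matrix part included, by c. For
  \<open>|c| = 1\<close> it is an isometry preserving the domain, and for \<open>c = 0\<close> it is
  \<open>fibre_proj e\<close>; the disc in c joins each point to its projection.\<close>

definition spin :: "complex \<Rightarrow> complex^('p::finite uprod + 'r) \<Rightarrow> complex^('p uprod + 'r)" where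
  "spin c z = fibre_proj e z + c *s (z - fibre_proj e z)"

lemma Zpart_spin: "Zpart (spin c z) = mat c ** Zpart z"
  by (simp add: spin_def fibre_proj_def Zpart_add Zpart_scale Zpart_diff)

lemma wpart_spin: "wpart (spin c z) = herm (wpart z) e *s e + c *s (wpart z - herm (wpart z) e *s e)"
  by (simp add: spin_def fibre_proj_def wpart_add wpart_scale wpart_diff)

lemma herm_spin: "herm (wpart (spin c z)) e = herm (wpart z) e"
  unfolding wpart_spin herm_add_left herm_scale_left herm_ee herm_perp by simp

lemma norm_wpart_spin: "(norm (wpart (spin c z)))\<^sup>2 = (cmod (herm (wpart z) e))\<^sup>2 + (cmod c * norm (wpart z - herm (wpart z) e *s e))\<^sup>2"
proof -
  have eq: "wpart (spin c z) - herm (wpart (spin c z)) e *s e = c *s (wpart z - herm (wpart z) e *s e)"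
    unfolding herm_spin by (simp add: wpart_spin)
  show ?thesis unfolding norm_split[of "wpart (spin c z)"] eq unfolding herm_spin norm_vec_scale ..
qed

lemma spin_in_Y_II:
  fixes z :: "complex^('p::finite uprod + 'r)"
  assumes "z \<in> Y_II K" "cmod c \<le> 1"
  shows "spin c z \<in> Y_II K"
proof (rule Y_II_shrink[OF K assms Zpart_spin])
  have "(cmod c * norm (wpart z - herm (wpart z) e *s e))\<^sup>2 \<le> (1 * norm (wpart z - herm (wpart z) e *s e))\<^sup>2"
    using assms by (intro power_mono mult_right_mono) auto
  then have "(norm (wpart (spin c z)))\<^sup>2 \<le> (norm (wpart z))\<^sup>2"
    unfolding norm_wpart_spin norm_split[of "wpart z"] by simp
  then show "norm (wpart (spin c z)) \<le> norm (wpart z)" by (rule power2_le_imp_le) simp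
qed

lemma spin_spin: "spin c (spin d z) = spin (c * d) z"
proof (rule parts_eqI)
  show "Zpart (spin c (spin d z)) = Zpart (spin (c * d) z)"
    by (simp add: Zpart_spin vec_eq_iff)
  show "wpart (spin c (spin d z)) = wpart (spin (c * d) z)"
    unfolding wpart_spin[of c "spin d z"] herm_spin unfolding wpart_spin by (simp add: vec_eq_iff)
qed

lemma spin_one: "spin 1 z = z"
  by (simp add: spin_def)

lemma linear_fibre_proj: "linear (fibre_proj e :: complex^('p::finite uprod + 'r) \<Rightarrow> _)"
  by (rule linearI; rule parts_eqI)
     (simp_all add: fibre_proj_def Zpart_add Zpart_scaleR wpart_add wpart_scaleR herm_add_left vec_eq_iff
       algebra_simps herm_def sum_distrib_left scaleR_sum_right sum_distrib_right sum.distrib)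

lemma linear_spin: "linear (spin c :: complex^('p::finite uprod + 'r) \<Rightarrow> _)"
  by (rule linearI) (simp_all add: spin_def linear_add[OF linear_fibre_proj] linear_cmul[OF linear_fibre_proj] vec_eq_iff algebra_simps)

lemma norm_spin:
  assumes "cmod c = 1"
  shows "norm (spin c z) = norm z"
proof -
  have "norm (mat c ** Z) = cmod c * norm Z" for Z :: "complex^'a^'a"
  proof -
    have "(norm (mat c ** Z))\<^sup>2 = (cmod c * norm Z)\<^sup>2"
      unfolding norm_vec_def L2_set_def power_mult_distrib
      by (simp add: sum_nonneg norm_mult power_mult_distrib sum_distrib_left)
    then show ?thesis by (simp add: power2_eq_iff_nonneg)
  qed
  then have "(norm (spin c z))\<^sup>2 = (norm z)\<^sup>2"
    unfolding norm_parts[of "spin c z"] norm_parts[of z] norm_wpart_spin norm_split[of "wpart z"]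
    using assms by (simp add: Zpart_spin)
  then show ?thesis by simp
qed

lemma continuous_spin: "continuous_on UNIV (\<lambda>x. spin (cis (2 * pi * fst x)) (snd x) :: complex^('p::finite uprod + 'r))"
proof -
  have bb: "bounded_bilinear (\<lambda>c (x :: complex^('p uprod + 'r)). c *s x)"
  proof -
    have "bilinear (\<lambda>c (x :: complex^('p uprod + 'r)). c *s x)"
      unfolding bilinear_def by (auto intro!: linearI simp: vec_eq_iff algebra_simps)
    then show ?thesis by (simp add: bilinear_conv_bounded_bilinear)
  qed
  have f: "continuous_on UNIV (\<lambda>x. fibre_proj e (snd x :: complex^('p uprod + 'r)))"
    by (rule continuous_on_compose2[OF linear_continuous_on[of "fibre_proj e" UNIV]])
       (auto intro!: continuous_intros simp: linear_fibre_proj simp flip: linear_conv_bounded_linear)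
  show ?thesis unfolding spin_def cis_conv_exp
    by (intro continuous_on_add f bounded_bilinear.continuous_on[OF bb] continuous_on_diff continuous_intros)
qed

lemma spin_iff:
  fixes z :: "complex^('p::finite uprod + 'r)"
  assumes c: "cmod c = 1"
  shows "spin c z \<in> Y_II K \<longleftrightarrow> z \<in> Y_II K"
proof
  assume "spin c z \<in> Y_II K"
  then have "spin (cnj c) (spin c z) \<in> Y_II K" using c by (intro spin_in_Y_II[of _ "cnj c"]) auto
  moreover have "cnj c * c = 1" using c by (simp add: complex_norm_square[symmetric] mult.commute)
  ultimately show "z \<in> Y_II K" by (simp add: spin_spin spin_one)
qed (rule spin_in_Y_II, use c in simp_all)

lemma cdiff_line:
  fixes f :: "complex^'n::finite \<Rightarrow> complex"
  assumes "cdiff f (u + s *s v)"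
  shows "(\<lambda>s. f (u + s *s v)) field_differentiable (at s)"
proof -
  obtain f' where f: "(f has_derivative f') (at (u + s *s v))" "\<forall>c v. f' (c *s v) = c * f' v"
    using assms unfolding cdiff_def by blast
  have "((\<lambda>s. s *s v) has_derivative (\<lambda>h. h *s v)) (at s)"
    by (rule linear_imp_has_derivative, rule linearI) (auto simp: vec_eq_iff algebra_simps)
  then have "((\<lambda>s. u + s *s v) has_derivative (\<lambda>h. h *s v)) (at s)"
    using has_derivative_add[OF has_derivative_const] by fastforce
  from has_derivative_compose[OF this f(1)]
  have "((\<lambda>s. f (u + s *s v)) has_derivative (\<lambda>h. f' (h *s v))) (at s)" .
  moreover have "(\<lambda>h. f' (h *s v)) = (*) (f' v)" using f(2) by (auto simp: fun_eq_iff mult.commute)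
  ultimately have "((\<lambda>s. f (u + s *s v)) has_field_derivative f' v) (at s)"
    by (simp add: has_field_derivative_def)
  then show ?thesis using field_differentiable_def by blast
qed

text \<open>On the closed unit disc of c the points \<open>spin c z\<close> stay in the domain, so
  the mean value property gives the value at the centre.\<close>

lemma spin_average:
  fixes f :: "complex^('p::finite uprod + 'r) \<Rightarrow> complex"
  assumes f: "holomorphic_cn f (Y_II K)" and z: "z \<in> Y_II K"
  shows "(LINT t:{0..1}|lborel. f (spin (cis (2 * pi * t)) z)) = f (fibre_proj e z)"
proof -
  let ?u = "fibre_proj e z" and ?v = "z - fibre_proj e z"
  define S where "S = {s. ?u + s *s ?v \<in> Y_II K}"
  have cont: "continuous_on UNIV (\<lambda>s. ?u + s *s ?v)"
  proof -
    have "linear (\<lambda>s. s *s ?v)" by (rule linearI) (auto simp: vec_eq_iff algebra_simps)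
    then show ?thesis by (intro continuous_intros linear_continuous_on) (simp add: linear_conv_bounded_linear)
  qed
  have "open S" unfolding S_def using open_vimage[OF open_Y_II[OF K] cont] by (simp add: vimage_def)
  moreover have "cball 0 1 \<subseteq> S"
    using spin_in_Y_II[OF z] by (auto simp: S_def spin_def)
  moreover have "(\<lambda>s. f (?u + s *s ?v)) holomorphic_on S"
    unfolding holomorphic_on_def
  proof
    fix s assume "s \<in> S"
    then have "?u + s *s ?v \<in> Y_II K" by (simp only: S_def mem_Collect_eq)
    then have "cdiff f (?u + s *s ?v)" using f unfolding holomorphic_cn_iff by (rule bspec[rotated])
    from cdiff_line[OF this] show "(\<lambda>s. f (?u + s *s ?v)) field_differentiable at s within S"
      by (rule field_differentiable_at_within)
  qed
  ultimately show ?thesis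
    using circle_coefficient[of S "\<lambda>s. f (?u + s *s ?v)" 0] by (simp add: spin_def)
qed

lemma herm_less_one:
  assumes "z \<in> Y_II K"
  shows "cmod (herm (wpart (z :: complex^('p::finite uprod + 'r))) e) < 1"
  using norm_herm_le[of "wpart z" e] norm_wpart_less[OF K assms] e by simp

lemma bounded_linear_herm: "bounded_linear (\<lambda>z :: complex^('p::finite uprod + 'r). herm (wpart z) e)"
  unfolding linear_conv_bounded_linear[symmetric]
  by (rule linearI) (simp_all add: wpart_add wpart_scaleR herm_def scaleR_sum_right distrib_right sum.distrib)

lemma continuous_herm_power: "continuous_on S (\<lambda>z :: complex^('p::finite uprod + 'r). cnj (herm (wpart z) e) ^ m)"
  by (intro continuous_intros linear_continuous_on bounded_linear_herm)

text \<open>The weight involves only the component of w along e, which \<open>spin\<close> fixes.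
  Averaging therefore replaces f by its values on the line and leaves the weight alone.\<close>

lemma
  fixes f :: "complex^('p::finite uprod + 'r) \<Rightarrow> complex"
  assumes f: "f \<in> bergman_space (Y_II K)"
  shows fibre_integral: "(LINT z:Y_II K|lborel. f z * cnj (herm (wpart z) e) ^ m)
      = (LINT z:Y_II K|lborel. f (fibre_proj e z) * cnj (herm (wpart z) e) ^ m)"
    and fibre_integrable: "set_integrable lborel (Y_II K) (\<lambda>z. f (fibre_proj e z) * cnj (herm (wpart z) e) ^ m)"
proof -
  let ?h = "\<lambda>z. f z * cnj (herm (wpart z) e) ^ m"
  have hol: "holomorphic_cn f (Y_II K)" using f by (simp add: bergman_space_def)
  have i: "set_integrable lborel (Y_II K) ?h"
  proof (rule bergman_space_integrable[OF K f continuous_herm_power, of _ 1])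
    fix z :: "complex^('p uprod + 'r)" assume "z \<in> Y_II K"
    from herm_less_one[OF this] show "cmod (cnj (herm (wpart z) e) ^ m) \<le> 1"
      by (simp add: norm_power power_le_one)
  qed
  have c: "continuous_on (Y_II K) ?h"
    by (intro continuous_on_mult holomorphic_cn_continuous hol continuous_herm_power)
  note avg = rotation_average[where W = "\<lambda>t. spin (cis (2 * pi * t))", OF open_Y_II[OF K] linear_spin norm_spin[OF norm_cis] continuous_spin spin_iff[OF norm_cis] c i]
  have eq: "(LINT t:{0..1}|lborel. ?h (spin (cis (2 * pi * t)) z)) = f (fibre_proj e z) * cnj (herm (wpart z) e) ^ m" if "z \<in> Y_II K" for z
    unfolding herm_spin spin_average[OF hol that, symmetric] by (rule set_integral_mult_left)
  have Ym: "Y_II K \<in> sets (lborel :: (complex^('p uprod + 'r)) measure)" by (simp add: open_Y_II[OF K])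
  show "(LINT z:Y_II K|lborel. ?h z) = (LINT z:Y_II K|lborel. f (fibre_proj e z) * cnj (herm (wpart z) e) ^ m)"
    unfolding avg(2)[symmetric] by (rule set_lebesgue_integral_cong[OF Ym]) (intro allI impI eq)
  show "set_integrable lborel (Y_II K) (\<lambda>z. f (fibre_proj e z) * cnj (herm (wpart z) e) ^ m)"
    using avg(1) by (rule set_integrable_cong[OF refl refl, THEN iffD1, rotated]) (simp only: eq)
qed

lemma Y_moment_eq: "complex_of_real (Y_moment K TYPE('p::finite) e m) =
  (LINT z:(Y_II K :: (complex^('p uprod + 'r)) set)|lborel. herm (wpart z) e ^ m * cnj (herm (wpart z) e) ^ m)"
proof -
  have "herm (wpart z) e ^ m * cnj (herm (wpart z) e) ^ m = of_real (cmod (herm (wpart z) e) ^ (2 * m))" for z :: "complex^('p uprod + 'r)"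
    unfolding power_mult_distrib[symmetric] power_mult of_real_power[of _ m] complex_norm_square ..
  then show ?thesis
    unfolding Y_moment_def set_lebesgue_integral_def integral_complex_of_real[symmetric]
    by (simp only: real_scaleR_def scaleR_conv_of_real of_real_mult)
qed

text \<open>A second average, now over rotations of the whole space. The weight picks out the m-th
  Taylor coefficient of f on the disc of multiples of e, and what remains to be integrated is the
  m-th moment.\<close>

lemma fibre_coefficient:
  fixes f :: "complex^('p::finite uprod + 'r) \<Rightarrow> complex"
  assumes f: "f \<in> bergman_space (Y_II K)"
  shows "(\<lambda>s. f (mk 0 (s *s e))) holomorphic_on ball 0 1"
    and "(LINT z:Y_II K|lborel. f z * cnj (herm (wpart z) e) ^ m)
      = (deriv ^^ m) (\<lambda>s. f (mk 0 (s *s e))) 0 / fact m * Y_moment K TYPE('p) e m"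
proof -
  let ?\<phi> = "\<lambda>s. f (mk 0 (s *s e))"
  have hol: "holomorphic_cn f (Y_II K)" using f by (simp add: bergman_space_def)
  have mks: "mk 0 (s *s e) = 0 + s *s (mk 0 e :: complex^('p uprod + 'r))" for s
    by (simp add: vec_eq_iff mk_def split: sum.split)
  have inY: "mk 0 (s *s e) \<in> (Y_II K :: (complex^('p uprod + 'r)) set)" if "cmod s < 1" for s
    using that by (intro mk0_in_Y_II K) (simp add: norm_vec_scale e)
  show hp: "?\<phi> holomorphic_on ball 0 1"
    unfolding holomorphic_on_def
  proof
    fix s :: complex assume "s \<in> ball 0 1"
    then have "cdiff f (0 + s *s mk 0 e)" using hol inY[of s] by (simp add: holomorphic_cn_iff mks)
    from cdiff_line[OF this] show "?\<phi> field_differentiable at s within ball 0 1"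
      unfolding mks by (rule field_differentiable_at_within)
  qed
  let ?h = "\<lambda>z :: complex^('p uprod + 'r). f (fibre_proj e z) * cnj (herm (wpart z) e) ^ m"
  define W where "W t z = cis (2 * pi * t) *s z" for t and z :: "complex^('p uprod + 'r)"
  have lin: "linear (W t)" for t by (rule linearI) (auto simp: W_def vec_eq_iff algebra_simps)
  have iso: "norm (W t x) = norm x" for t x by (simp add: W_def norm_vec_scale)
  have cont: "continuous_on UNIV (\<lambda>x. W (fst x) (snd x))"
  proof -
    have "bilinear (\<lambda>c (x :: complex^('p uprod + 'r)). c *s x)"
      unfolding bilinear_def by (auto intro!: linearI simp: vec_eq_iff algebra_simps)
    then have "bounded_bilinear (\<lambda>c (x :: complex^('p uprod + 'r)). c *s x)"
      by (simp add: bilinear_conv_bounded_bilinear)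
    note C = bounded_bilinear.continuous_on[OF this]
    show ?thesis unfolding W_def cis_conv_exp by (intro C continuous_intros)
  qed
  have sub: "W t z \<in> Y_II K" if "z \<in> Y_II K" for t z
    by (rule Y_II_shrink[OF K that, of "cis (2 * pi * t)"]) (simp_all add: W_def Zpart_scale wpart_scale norm_vec_scale)
  have inv: "W t z \<in> Y_II K \<longleftrightarrow> z \<in> Y_II K" for t z
  proof
    assume "W t z \<in> Y_II K"
    then have "W (- t) (W t z) \<in> Y_II K" by (rule sub)
    moreover have "W (- t) (W t z) = z" by (simp add: W_def vec_eq_iff cis_mult mult.assoc[symmetric])
    ultimately show "z \<in> Y_II K" by simp
  qed (rule sub)
  have ch: "continuous_on (Y_II K) ?h"
  proof (intro continuous_on_mult continuous_herm_power continuous_on_compose2[OF holomorphic_cn_continuous[OF hol]])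
    show "continuous_on (Y_II K) (fibre_proj e :: complex^('p uprod + 'r) \<Rightarrow> _)"
      by (rule linear_continuous_on) (simp add: linear_fibre_proj flip: linear_conv_bounded_linear)
    show "fibre_proj e ` Y_II K \<subseteq> (Y_II K :: (complex^('p uprod + 'r)) set)"
      unfolding fibre_proj_def using inY herm_less_one by auto
  qed
  note avg = rotation_average(2)[where W = W, OF open_Y_II[OF K] lin iso cont inv ch fibre_integrable[OF f]]
  define a where "a = (deriv ^^ m) ?\<phi> 0 / fact m"
  have eq: "(LINT t:{0..1}|lborel. ?h (W t z)) = a * (herm (wpart z) e ^ m * cnj (herm (wpart z) e) ^ m)" if z: "z \<in> Y_II K" for z
  proof -
    define \<xi> where "\<xi> = herm (wpart z) e"
    have \<xi>: "cmod \<xi> < 1" using herm_less_one[OF z] by (simp add: \<xi>_def)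
    \<comment> \<open>As \<open>|\<xi>| < 1\<close>, the rescaled function is holomorphic on a
      neighbourhood of the closed unit disc, and its m-th coefficient carries the factor
      \<open>\<xi> ^ m\<close>.\<close>
    define S where "S = (\<lambda>\<zeta>. \<zeta> * \<xi>) -` ball 0 1"
    have "open S" unfolding S_def by (intro open_vimage continuous_intros) auto
    have "cball 0 1 \<subseteq> S"
    proof
      fix \<zeta> :: complex assume "\<zeta> \<in> cball 0 1"
      then have "cmod \<zeta> * cmod \<xi> \<le> 1 * cmod \<xi>" by (intro mult_right_mono) auto
      then show "\<zeta> \<in> S" using \<xi> by (simp add: S_def norm_mult)
    qed
    have hS: "(\<lambda>\<zeta>. ?\<phi> (\<zeta> * \<xi>)) holomorphic_on S"
    proof -
      have "(\<lambda>\<zeta>. \<zeta> * \<xi>) holomorphic_on S" by (intro holomorphic_intros)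
      from holomorphic_on_compose_gen[OF this hp] show ?thesis by (simp add: o_def S_def image_vimage_eq)
    qed
    have d: "(deriv ^^ m) (\<lambda>\<zeta>. ?\<phi> (\<zeta> * \<xi>)) 0 = \<xi> ^ m * (deriv ^^ m) ?\<phi> 0"
      using higher_deriv_compose_linear[OF hp \<open>open S\<close> open_ball, of 0 \<xi> m]
      by (simp add: S_def mult.commute)
    have h: "?h (W t z) = (?\<phi> (cis (2 * pi * t) * \<xi>) * cnj (cis (2 * pi * t)) ^ m) * cnj \<xi> ^ m" for t
      by (simp add: W_def fibre_proj_def wpart_scale herm_scale_left \<xi>_def power_mult_distrib mult.assoc)
    have "(LINT t:{0..1}|lborel. ?h (W t z)) = (LINT t:{0..1}|lborel. ?\<phi> (cis (2 * pi * t) * \<xi>) * cnj (cis (2 * pi * t)) ^ m) * cnj \<xi> ^ m"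
      unfolding h by (rule set_integral_mult_left)
    also have "(LINT t:{0..1}|lborel. ?\<phi> (cis (2 * pi * t) * \<xi>) * cnj (cis (2 * pi * t)) ^ m) = a * \<xi> ^ m"
      using circle_coefficient[OF \<open>open S\<close> \<open>cball 0 1 \<subseteq> S\<close> hS, of m] d by (simp add: a_def)
    finally show ?thesis by (simp add: \<xi>_def mult.assoc)
  qed
  have "(LINT z:Y_II K|lborel. f z * cnj (herm (wpart z) e) ^ m) = (LINT z:Y_II K|lborel. (LINT t:{0..1}|lborel. ?h (W t z)))"
    using fibre_integral[OF f] avg by simp
  also have "\<dots> = (LINT z:(Y_II K :: (complex^('p uprod + 'r)) set)|lborel. a * (herm (wpart z) e ^ m * cnj (herm (wpart z) e) ^ m))"
    unfolding set_lebesgue_integral_def[of lborel "Y_II K"]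
    by (rule Bochner_Integration.integral_cong) (use eq in \<open>auto simp: indicator_def\<close>)
  also have "\<dots> = a * Y_moment K TYPE('p) e m"
    unfolding Y_moment_eq by (rule set_integral_mult_right)
  finally show "(LINT z:Y_II K|lborel. f z * cnj (herm (wpart z) e) ^ m)
      = (deriv ^^ m) ?\<phi> 0 / fact m * Y_moment K TYPE('p) e m" by (simp add: a_def)
qed

end

section \<open>Reproducing kernels and biholomorphisms\<close>

text \<open>The formula for nonnegative functions, applied to indicators, is an equality of
  measures; in this form it also carries integrability and vector-valued integrals.\<close>

lemma
  fixes g :: "complex^'n::finite \<Rightarrow> complex^'n" and h :: "complex^'n \<Rightarrow> 'b::{banach,second_countable_topology}"
  assumes D: "open D" "open D'" "bij_betw g D D'"
    and der: "\<And>x. x \<in> D \<Longrightarrow> (g has_derivative g' x) (at x)"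
    and a: "continuous_on D a" "\<And>x. x \<in> D \<Longrightarrow> adet (g' x) = a x"
    and h: "continuous_on D' h"
  shows integrable_change_of_variables:
      "set_integrable lborel D (\<lambda>x. a x *\<^sub>R h (g x)) \<longleftrightarrow> set_integrable lborel D' h"
    and integral_change_of_variables:
      "(LINT x:D|lborel. a x *\<^sub>R h (g x)) = (LINT y:D'|lborel. h y)"
proof -
  have Db: "D \<in> sets borel" "D' \<in> sets borel" using D by auto
  have cg: "continuous_on D g"
    using der D(1) by (meson continuous_at_imp_continuous_on has_derivative_continuous)
  have im: "g x \<in> D'" if "x \<in> D" for x using D(3) that by (auto simp: bij_betw_def)
  define g0 where "g0 x = indicator D x *\<^sub>R g x" for x
  define a0 where "a0 x = indicator D x *\<^sub>R a x" for x
  define h0 where "h0 y = indicator D' y *\<^sub>R h y" for y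
  have g0: "g0 \<in> borel_measurable borel" and a0: "a0 \<in> borel_measurable borel" and h0: "h0 \<in> borel_measurable borel"
    unfolding g0_def[abs_def] a0_def[abs_def] h0_def[abs_def]
    by (rule borel_measurable_continuous_on_indicator Db cg a(1) h)+
  have a_nonneg: "a x \<ge> 0" if "x \<in> D" for x using adet_nonneg[of "g' x"] a(2)[OF that] by simp
  then have nn: "a0 x \<ge> 0" for x by (simp add: a0_def indicator_def)
  have eq: "distr (density lborel (\<lambda>x. ennreal (a0 x))) borel g0 = density lborel (\<lambda>y. ennreal (indicator D' y))"
  proof (rule measure_eqI)
    fix B assume "B \<in> sets (distr (density lborel (\<lambda>x. ennreal (a0 x))) borel g0)"
    then have B: "B \<in> sets borel" by simp
    have "emeasure (density lborel (\<lambda>y. ennreal (indicator D' y))) B = (\<integral>\<^sup>+y. ennreal (indicator D' y) * indicator B y \<partial>lborel)"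
      using B Db by (intro emeasure_density) auto
    also have "\<dots> = (\<integral>\<^sup>+y. indicator B y * indicator D' y \<partial>lborel)"
      by (intro nn_integral_cong) (simp add: indicator_def)
    also have "\<dots> = (\<integral>\<^sup>+x. indicator B (g x) * ennreal (a x) * indicator D x \<partial>lborel)"
      using B by (intro nn_integral_change_of_variables[OF D der a]) auto
    also have "\<dots> = (\<integral>\<^sup>+x. ennreal (a0 x) * indicator (g0 -` B) x \<partial>lborel)"
      by (intro nn_integral_cong) (simp add: indicator_def a0_def g0_def)
    also have "\<dots> = emeasure (density lborel (\<lambda>x. ennreal (a0 x))) (g0 -` B)"
      using a0 measurable_sets_borel[OF g0 B] by (intro emeasure_density[symmetric]) auto
    also have "\<dots> = emeasure (distr (density lborel (\<lambda>x. ennreal (a0 x))) borel g0) B"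
      using B g0 by (simp add: emeasure_distr)
    finally show "emeasure (distr (density lborel (\<lambda>x. ennreal (a0 x))) borel g0) B = emeasure (density lborel (\<lambda>y. ennreal (indicator D' y))) B"
      by simp
  qed simp
  have g0': "g0 \<in> measurable (density lborel (\<lambda>x. ennreal (a0 x))) borel" using g0 by simp
  have h0g: "(\<lambda>x. h0 (g0 x)) \<in> borel_measurable lborel"
    using measurable_compose[OF g0 h0] by simp
  have i1: "indicator D x *\<^sub>R (a x *\<^sub>R h (g x)) = a0 x *\<^sub>R h0 (g0 x)" for x
    using im by (simp add: a0_def h0_def g0_def indicator_def)
  have i2: "indicator D' y *\<^sub>R h y = indicator D' y *\<^sub>R h0 y" for y
    by (simp add: h0_def indicator_def)
  have "integrable lborel (\<lambda>x. a0 x *\<^sub>R h0 (g0 x)) \<longleftrightarrow> integrable (density lborel (\<lambda>x. ennreal (a0 x))) (\<lambda>x. h0 (g0 x))"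
    using h0g a0 nn by (intro integrable_density[symmetric]) auto
  also have "\<dots> \<longleftrightarrow> integrable (distr (density lborel (\<lambda>x. ennreal (a0 x))) borel g0) h0"
    using g0' h0 by (rule integrable_distr_eq[symmetric])
  also have "\<dots> \<longleftrightarrow> integrable lborel (\<lambda>y. indicator D' y *\<^sub>R h0 y)"
    unfolding eq using h0 Db by (intro integrable_density) auto
  finally show "set_integrable lborel D (\<lambda>x. a x *\<^sub>R h (g x)) \<longleftrightarrow> set_integrable lborel D' h"
    unfolding set_integrable_def i1 i2 .
  have "(\<integral>x. a0 x *\<^sub>R h0 (g0 x) \<partial>lborel) = (\<integral>x. h0 (g0 x) \<partial>density lborel (\<lambda>x. ennreal (a0 x)))"
    using h0g a0 nn by (intro integral_density[symmetric]) auto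
  also have "\<dots> = (\<integral>y. h0 y \<partial>distr (density lborel (\<lambda>x. ennreal (a0 x))) borel g0)"
    using g0' h0 by (rule integral_distr[symmetric])
  also have "\<dots> = (\<integral>y. indicator D' y *\<^sub>R h0 y \<partial>lborel)"
    unfolding eq using h0 Db by (intro integral_density) auto
  finally show "(LINT x:D|lborel. a x *\<^sub>R h (g x)) = (LINT y:D'|lborel. h y)"
    unfolding set_lebesgue_integral_def i1 i2 .
qed

lemma adet_nonzero_right_inverse:
  fixes L :: "complex^'n::finite \<Rightarrow> complex^'n"
  assumes L: "linear L" "adet L \<noteq> 0"
  obtains M where "L \<circ> M = id" "M \<circ> L = id"
proof -
  let ?F = "flat \<circ> L \<circ> unflat"
  have "linear ?F" using L(1) by (intro linear_compose linear_flat linear_unflat)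
  then have inj: "inj ?F" using L(2) det_nz_iff_inj[of ?F] by (simp add: adet_def)
  have "inj L"
  proof (rule injI)
    fix x y assume "L x = L y"
    then have "?F (flat x) = ?F (flat y)" by simp
    then have "flat x = flat y" using inj by (rule injD[rotated])
    then show "x = y" by (metis unflat_flat)
  qed
  then obtain M where "\<forall>x. M (L x) = x" "\<forall>x. L (M x) = x"
    using linear_injective_isomorphism[OF L(1)] by blast
  then show ?thesis by (intro that) (auto simp: fun_eq_iff)
qed

text \<open>The derivative of the inverse map is the inverse of a complex-linear map, hence
  complex-linear itself.\<close>

lemma cdiff_inverse_map:
  fixes \<Phi> :: "complex^'n::finite \<Rightarrow> complex^'n"
  assumes S: "open S" "x \<in> S" and \<Phi>: "continuous_on S \<Phi>" "\<And>x. x \<in> S \<Longrightarrow> g (\<Phi> x) = x"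
    and d: "(\<Phi> has_derivative \<Phi>') (at x)" "\<And>c v. \<Phi>' (c *s v) = c *s \<Phi>' v" "adet \<Phi>' \<noteq> 0"
    and f: "cdiff f x"
  shows "cdiff (\<lambda>y. f (g y)) (\<Phi> x)"
proof -
  have lin: "linear \<Phi>'" using d(1) has_derivative_linear by blast
  obtain M where M: "\<Phi>' \<circ> M = id" "M \<circ> \<Phi>' = id" using adet_nonzero_right_inverse[OF lin d(3)] .
  have g: "(g has_derivative M) (at (\<Phi> x))"
    by (rule has_derivative_inverse_strong[OF S \<Phi> d(1) M(1)])
  have "M (c *s v) = c *s M v" for c v
    using d(2)[of c "M v"] M unfolding fun_eq_iff o_def id_def by metis
  moreover have "cdiff f (g (\<Phi> x))" using f \<Phi>(2) S(2) by simp
  ultimately show ?thesis by (rule cdiff_map[OF g])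
qed

text \<open>One section of the Bergman kernel, with u fixed. Treating the points separately allows a
  different automorphism for each of them.\<close>

definition reproduces :: "(complex^'n::finite) set \<Rightarrow> complex^'n \<Rightarrow> (complex^'n \<Rightarrow> complex) \<Rightarrow> bool" where
  "reproduces D u \<kappa> \<longleftrightarrow> \<kappa> \<in> bergman_space D \<and>
     (\<forall>f\<in>bergman_space D. f u = (LINT z:D|lborel. f z * cnj (\<kappa> z)))"

lemma cnj_LINT: "cnj (LINT z:D|M. f z) = (LINT z:D|M. cnj (f z))"
proof -
  have "indicator D x *\<^sub>R cnj (f x) = cnj (indicator D x *\<^sub>R f x)" for x by simp
  then show ?thesis unfolding set_lebesgue_integral_def by (simp only: Bochner_Integration.integral_cnj)
qed

text \<open>Each function is evaluated by the reproducing property of the other. Uniqueness of the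
  kernel follows from this.\<close>

lemma reproduces_symmetric:
  assumes "reproduces D u \<kappa>" "reproduces D v \<kappa>'"
  shows "\<kappa>' u = cnj (\<kappa> v)"
proof -
  have "\<kappa> v = (LINT z:D|lborel. \<kappa> z * cnj (\<kappa>' z))" "\<kappa>' u = (LINT z:D|lborel. \<kappa>' z * cnj (\<kappa> z))"
    using assms unfolding reproduces_def by blast+
  then show ?thesis by (simp add: cnj_LINT mult.commute)
qed

lemma is_bergman_kernel_reproduces:
  "is_bergman_kernel D k \<longleftrightarrow> (\<forall>u\<in>D. reproduces D u (\<lambda>z. k z u)) \<and> (\<forall>z u. z \<notin> D \<or> u \<notin> D \<longrightarrow> k z u = 0)"
  unfolding is_bergman_kernel_def reproduces_def ..

lemma is_bergman_kernel_unique: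
  assumes k: "is_bergman_kernel D k" and k': "is_bergman_kernel D k'"
  shows "k = k'"
proof (intro ext)
  fix z u
  show "k z u = k' z u"
  proof (cases "z \<in> D \<and> u \<in> D")
    case True
    then have "reproduces D u (\<lambda>z. k z u)" "reproduces D u (\<lambda>z. k' z u)" "reproduces D z (\<lambda>w. k' w z)"
      using k k' by (auto simp: is_bergman_kernel_reproduces)
    then have "k' u z = cnj (k z u)" "k' u z = cnj (k' z u)"
      using reproduces_symmetric[of D u "\<lambda>z. k z u" z "\<lambda>w. k' w z"]
        reproduces_symmetric[of D u "\<lambda>z. k' z u" z "\<lambda>w. k' w z"] by auto
    then show ?thesis by simp
  next
    case False
    then show ?thesis using k k' unfolding is_bergman_kernel_reproduces by metis
  qed
qed

lemma reproduces_cong: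
  fixes D :: "(complex^'n::finite) set"
  assumes D: "open D" and r: "reproduces D u \<kappa>" and eq: "\<And>z. z \<in> D \<Longrightarrow> \<kappa>' z = \<kappa> z"
  shows "reproduces D u \<kappa>'"
proof -
  have Dm: "D \<in> sets lborel" using D by simp
  have "\<kappa>' \<in> bergman_space D"
    using r eq cdiff_cong[OF _ D] set_integrable_cong[OF refl refl, of D "\<lambda>z. (cmod (\<kappa>' z))\<^sup>2" "\<lambda>z. (cmod (\<kappa> z))\<^sup>2" lborel]
    unfolding reproduces_def bergman_space_def holomorphic_cn_iff mem_Collect_eq by (metis (no_types, lifting))
  moreover have "(LINT z:D|lborel. f z * cnj (\<kappa>' z)) = (LINT z:D|lborel. f z * cnj (\<kappa> z))" for f
    by (rule set_lebesgue_integral_cong[OF Dm]) (simp add: eq)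
  ultimately show ?thesis using r by (simp add: reproduces_def)
qed

text \<open>Sections chosen independently at the points of D assemble to a kernel, and uniqueness
  identifies it with the one selected by \<open>THE\<close>.\<close>

lemma bergman_kernel_diagonal:
  fixes D :: "(complex^'n::finite) set"
  assumes D: "open D" and r: "\<And>u. u \<in> D \<Longrightarrow> reproduces D u (\<kappa> u)" and u: "u \<in> D"
  shows "bergman_kernel D u u = \<kappa> u u"
proof -
  define k where "k z u = (if z \<in> D \<and> u \<in> D then \<kappa> u z else 0)" for z u
  have "is_bergman_kernel D k"
    unfolding is_bergman_kernel_reproduces by (auto simp: k_def intro!: reproduces_cong[OF D r])
  then have "bergman_kernel D = k"
    unfolding bergman_kernel_def
    by (intro the_equality[of "is_bergman_kernel D"]) (auto intro: is_bergman_kernel_unique)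
  then show ?thesis using u by (simp add: k_def)
qed

text \<open>The transformation law of the kernel. Composing \<open>f / J\<close> with the inverse of
  \<Phi> preserves the Bergman space and its inner product, because \<open>|J|^2\<close> is the real
  Jacobian; the reproducing property at \<open>\<Phi> u\<close> is applied to the resulting
  function.\<close>

lemma reproduces_transport:
  fixes \<Phi> :: "complex^'n::finite \<Rightarrow> complex^'n"
  assumes D: "open D" and \<Phi>: "bij_betw \<Phi> D D"
    and d: "\<And>z. z \<in> D \<Longrightarrow> (\<Phi> has_derivative \<Phi>' z) (at z)" "\<And>z c v. z \<in> D \<Longrightarrow> \<Phi>' z (c *s v) = c *s \<Phi>' z v"
    and J: "\<And>z. z \<in> D \<Longrightarrow> adet (\<Phi>' z) = (cmod (J z))\<^sup>2" "holomorphic_cn J D" "\<And>z. z \<in> D \<Longrightarrow> J z \<noteq> 0"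
    and u: "u \<in> D" and r: "reproduces D (\<Phi> u) \<kappa>"
  shows "reproduces D u (\<lambda>z. J z * \<kappa> (\<Phi> z) * cnj (J u))"
proof -
  have Dm: "D \<in> sets lborel" using D by simp
  have im: "\<Phi> z \<in> D" if "z \<in> D" for z using \<Phi> that by (auto simp: bij_betw_def)
  have c\<Phi>: "continuous_on D \<Phi>"
    using d(1) D by (meson continuous_at_imp_continuous_on has_derivative_continuous)
  have cJ: "continuous_on D (\<lambda>z. (cmod (J z))\<^sup>2)"
    by (intro continuous_intros holomorphic_cn_continuous J(2))
  define g where "g = inv_into D \<Phi>"
  have g\<Phi>: "g (\<Phi> z) = z" if "z \<in> D" for z using \<Phi> that by (simp add: g_def bij_betw_inv_into_left)
  have \<Phi>g: "\<Phi> (g z) = z" "g z \<in> D" if "z \<in> D" for z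
    using \<Phi> that bij_betw_inv_into[OF \<Phi>] by (auto simp: g_def bij_betw_inv_into_right bij_betw_def)
  have compose: "holomorphic_cn (\<lambda>z. f (\<Phi> z)) D" if "holomorphic_cn f D" for f
    unfolding holomorphic_cn_iff
  proof
    fix z assume z: "z \<in> D"
    show "cdiff (\<lambda>z. f (\<Phi> z)) z"
      by (rule cdiff_map[OF d(1)[OF z] d(2)[OF z]]) (use that im[OF z] in \<open>simp add: holomorphic_cn_iff\<close>)
  qed
  have compose_inv: "holomorphic_cn (\<lambda>z. f (g z)) D" if "holomorphic_cn f D" for f
    unfolding holomorphic_cn_iff
  proof
    fix z assume z: "z \<in> D"
    let ?x = "g z"
    have x: "?x \<in> D" "\<Phi> ?x = z" using \<Phi>g[OF z] by auto
    have "adet (\<Phi>' ?x) \<noteq> 0" using J(1,3) x by simp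
    moreover have "cdiff f ?x" using that x by (simp add: holomorphic_cn_iff)
    ultimately have "cdiff (\<lambda>y. f (g y)) (\<Phi> ?x)"
      using cdiff_inverse_map[OF D x(1) c\<Phi> g\<Phi> d(1)[OF x(1)] d(2)[OF x(1)]] by simp
    then show "cdiff (\<lambda>y. f (g y)) z" by (simp add: x)
  qed
  have \<kappa>: "holomorphic_cn \<kappa> D" "set_integrable lborel D (\<lambda>z. (cmod (\<kappa> z))\<^sup>2)"
    using r by (auto simp: reproduces_def bergman_space_def)
  let ?\<kappa>' = "\<lambda>z. J z * \<kappa> (\<Phi> z) * cnj (J u)"
  have "holomorphic_cn ?\<kappa>' D"
    using J(2) compose[OF \<kappa>(1)] unfolding holomorphic_cn_iff by (auto intro!: cdiff_mult cdiff_const)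
  moreover have "set_integrable lborel D (\<lambda>z. (cmod (?\<kappa>' z))\<^sup>2)"
  proof -
    have "set_integrable lborel D (\<lambda>z. (cmod (J z))\<^sup>2 *\<^sub>R (cmod (\<kappa> (\<Phi> z)))\<^sup>2)"
      using \<kappa>(2) by (subst integrable_change_of_variables[OF D D \<Phi> d(1) cJ J(1)])
        (auto intro!: continuous_intros holomorphic_cn_continuous \<kappa>(1))
    then have "set_integrable lborel D (\<lambda>z. (cmod (J z))\<^sup>2 *\<^sub>R (cmod (\<kappa> (\<Phi> z)))\<^sup>2 * (cmod (J u))\<^sup>2)"
      by (rule set_integrable_mult_left)
    then show ?thesis by (simp add: norm_mult power_mult_distrib)
  qed
  ultimately have mem: "?\<kappa>' \<in> bergman_space D" by (simp add: bergman_space_def)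
  have "f u = (LINT z:D|lborel. f z * cnj (?\<kappa>' z))" if f: "f \<in> bergman_space D" for f
  proof -
    have fh: "holomorphic_cn f D" "set_integrable lborel D (\<lambda>z. (cmod (f z))\<^sup>2)"
      using f by (auto simp: bergman_space_def)
    define F where "F z = f (g z) * inverse (J (g z))" for z
    have Fh: "holomorphic_cn F D"
      using compose_inv[OF fh(1)] compose_inv[OF J(2)] J(3) \<Phi>g(2)
      unfolding F_def[abs_def] holomorphic_cn_iff by (auto intro!: cdiff_mult cdiff_inverse)
    have F\<Phi>: "F (\<Phi> z) = f z / J z" if "z \<in> D" for z using g\<Phi>[OF that] by (simp add: F_def divide_inverse)
    have "set_integrable lborel D (\<lambda>z. (cmod (J z))\<^sup>2 *\<^sub>R (cmod (F (\<Phi> z)))\<^sup>2)"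
      using fh(2) by (rule set_integrable_cong[OF refl refl, THEN iffD1, rotated])
        (simp add: F\<Phi> J(3) norm_divide power_divide)
    then have "set_integrable lborel D (\<lambda>z. (cmod (F z))\<^sup>2)"
      by (subst (asm) integrable_change_of_variables[OF D D \<Phi> d(1) cJ J(1)])
        (auto intro!: continuous_intros holomorphic_cn_continuous Fh)
    then have "F \<in> bergman_space D" using Fh by (simp add: bergman_space_def)
    then have "f u / J u = (LINT z:D|lborel. F z * cnj (\<kappa> z))" using r F\<Phi>[OF u] by (simp add: reproduces_def)
    also have "\<dots> = (LINT z:D|lborel. (cmod (J z))\<^sup>2 *\<^sub>R (F (\<Phi> z) * cnj (\<kappa> (\<Phi> z))))"
      by (rule integral_change_of_variables[OF D D \<Phi> d(1) cJ J(1), symmetric])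
        (assumption | rule continuous_on_mult continuous_on_cnj holomorphic_cn_continuous[OF Fh] holomorphic_cn_continuous[OF \<kappa>(1)])+
    also have "\<dots> = (LINT z:D|lborel. f z * cnj (J z * \<kappa> (\<Phi> z)))"
    proof (intro set_lebesgue_integral_cong[OF Dm] allI impI)
      fix z assume z: "z \<in> D"
      have "(cmod (J z))\<^sup>2 *\<^sub>R (F (\<Phi> z) * cnj (\<kappa> (\<Phi> z))) = (J z * cnj (J z)) * (f z / J z) * cnj (\<kappa> (\<Phi> z))"
        unfolding F\<Phi>[OF z] scaleR_conv_of_real complex_norm_square by simp
      then show "(cmod (J z))\<^sup>2 *\<^sub>R (F (\<Phi> z) * cnj (\<kappa> (\<Phi> z))) = f z * cnj (J z * \<kappa> (\<Phi> z))"
        using J(3)[OF z] by simp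
    qed
    finally have "f u = J u * (LINT z:D|lborel. f z * cnj (J z * \<kappa> (\<Phi> z)))" using J(3)[OF u] by (simp add: field_simps)
    also have "\<dots> = (LINT z:D|lborel. J u * (f z * cnj (J z * \<kappa> (\<Phi> z))))" by simp
    also have "\<dots> = (LINT z:D|lborel. f z * cnj (?\<kappa>' z))" by (simp add: mult_ac)
    finally show ?thesis .
  qed
  with mem show ?thesis by (simp add: reproduces_def)
qed

section \<open>The Bergman kernel of \<open>Y\<^sub>I\<^sub>I\<close>\<close>

lemma bounded_bergman_space:
  fixes f :: "complex^('p::finite uprod + 'r::finite) \<Rightarrow> complex"
  assumes K: "K > 0" and f: "holomorphic_cn f (Y_II K)" and B: "\<And>z. z \<in> Y_II K \<Longrightarrow> cmod (f z) \<le> B"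
  shows "f \<in> bergman_space (Y_II K)"
proof -
  let ?Y = "Y_II K :: (complex^('p uprod + 'r)) set"
  have Y: "?Y \<in> sets borel" by (intro borel_open open_Y_II K)
  have "integrable lborel (indicator ?Y :: _ \<Rightarrow> real)"
    using emeasure_Y_II_finite[OF K] Y by (intro integrable_real_indicator) auto
  then have "set_integrable lborel ?Y (\<lambda>z. B\<^sup>2)" by (simp add: set_integrable_def)
  then have "set_integrable lborel ?Y (\<lambda>z. (cmod (f z))\<^sup>2)"
  proof (rule set_integrable_bound)
    show "set_borel_measurable lborel ?Y (\<lambda>z. (cmod (f z))\<^sup>2)"
      unfolding set_borel_measurable_def using Y holomorphic_cn_continuous[OF f]
      by (simp add: borel_measurable_continuous_on_indicator continuous_on_power continuous_on_norm del: real_scaleR_def)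
    show "AE z in lborel. z \<in> ?Y \<longrightarrow> norm ((cmod (f z))\<^sup>2) \<le> norm (B\<^sup>2)"
      using B by (auto intro!: AE_I2 power_mono)
  qed
  then show ?thesis using f by (simp add: bergman_space_def)
qed

lemma cdiff_herm: "cdiff (\<lambda>z :: complex^('p::finite uprod + 'r::finite). herm (wpart z) w) z"
proof (rule cdiffI)
  have "linear (\<lambda>z :: complex^('p uprod + 'r). herm (wpart z) w)"
    by (rule linearI) (simp_all add: wpart_add wpart_scaleR herm_def scaleR_sum_right distrib_right sum.distrib)
  then show "((\<lambda>z :: complex^('p uprod + 'r). herm (wpart z) w) has_derivative (\<lambda>z. herm (wpart z) w)) (at z)"
    by (rule linear_imp_has_derivative)
qed (simp add: wpart_scale herm_scale_left)

text \<open>The integral of \<open><w,e'>^m\<close> against the conjugate of \<open><w,e>^m\<close>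
  is evaluated by \<open>fibre_coefficient\<close> along e and, after conjugation, along
  \<open>e'\<close>. The common factor \<open><e,e'>^m\<close> may be cancelled when it is
  nonzero.\<close>

lemma Y_moment_eq_of_herm:
  fixes e e' :: "complex^'r::finite"
  assumes K: "K > 0" and e: "norm e = 1" "norm e' = 1" and h: "herm e e' \<noteq> 0"
  shows "Y_moment K TYPE('p::finite) e m = Y_moment K TYPE('p) e' m"
proof -
  let ?Y = "Y_II K :: (complex^('p uprod + 'r)) set"
  have *: "(LINT z:?Y|lborel. herm (wpart z) b ^ m * cnj (herm (wpart z) a) ^ m) = herm a b ^ m * Y_moment K TYPE('p) a m"
    if ab: "norm a = 1" "norm b = 1" for a b :: "complex^'r"
  proof -
    have "(\<lambda>z. herm (wpart z) b ^ m) \<in> bergman_space ?Y"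
    proof (rule bounded_bergman_space[OF K, of _ 1])
      show "holomorphic_cn (\<lambda>z. herm (wpart z) b ^ m) ?Y"
        unfolding holomorphic_cn_iff by (intro ballI cdiff_power cdiff_herm)
      fix z assume "z \<in> ?Y"
      from herm_less_one[OF K ab(2) this] show "cmod (herm (wpart z) b ^ m) \<le> 1"
        by (simp add: norm_power power_le_one)
    qed
    note fc = fibre_coefficient(2)[OF K ab(1) this, of m]
    \<comment> \<open>The Taylor coefficient of the monomial is read off from its circle integral,
      whose integrand is constant.\<close>
    have "(deriv ^^ m) (\<lambda>s. (s * herm a b) ^ m) 0 / fact m = herm a b ^ m"
    proof -
      have c: "(cis (2 * pi * t) * herm a b) ^ m * cnj (cis (2 * pi * t)) ^ m = herm a b ^ m" for t
      proof -
        have "cis (2 * pi * t) ^ m * cnj (cis (2 * pi * t)) ^ m = 1"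
          by (simp add: cis_cnj cis_mult flip: power_mult_distrib)
        then show ?thesis by (simp add: power_mult_distrib)
      qed
      have "(LINT t:{0..1}|lborel. (cis (2 * pi * t) * herm a b) ^ m * cnj (cis (2 * pi * t)) ^ m) = herm a b ^ m"
        unfolding c by (simp add: set_integral_const)
      then show ?thesis
        using circle_coefficient[of UNIV "\<lambda>s. (s * herm a b) ^ m" m] by (simp add: holomorphic_intros)
    qed
    then show ?thesis using fc by (simp add: herm_scale_left)
  qed
  have "cnj (LINT z:?Y|lborel. herm (wpart z) e' ^ m * cnj (herm (wpart z) e) ^ m)
      = (LINT z:?Y|lborel. herm (wpart z) e ^ m * cnj (herm (wpart z) e') ^ m)"
    unfolding cnj_LINT by (simp add: mult.commute)
  then have "cnj (herm e e') ^ m * Y_moment K TYPE('p) e m = herm e' e ^ m * Y_moment K TYPE('p) e' m"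
    unfolding *[OF e] *[OF e(2) e(1)] by simp
  then have "complex_of_real (Y_moment K TYPE('p) e m) = complex_of_real (Y_moment K TYPE('p) e' m)"
    using h by (simp add: herm_commute[of e' e])
  then show ?thesis by (simp only: of_real_eq_iff)
qed

lemma Y_moment_unit:
  fixes e e' :: "complex^'r::finite"
  assumes K: "K > 0" and e: "norm e = 1" "norm e' = 1"
  shows "Y_moment K TYPE('p::finite) e m = Y_moment K TYPE('p) e' m"
proof (cases "herm e e' = 0")
  case True
  \<comment> \<open>For orthogonal vectors the normalised sum is orthogonal to neither, so the
    comparison passes through it.\<close>
  define b where "b = of_real (1 / sqrt 2) *s (e + e')"
  have "(norm (e + e'))\<^sup>2 = 2" using norm_orthogonal_add[OF True] e by simp
  then have "norm (e + e') = sqrt 2" by (metis norm_ge_zero real_sqrt_unique)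
  then have b: "norm b = 1" unfolding b_def norm_vec_scale by (simp add: norm_divide)
  have T': "herm e' e = 0" using True herm_commute[of e' e] by simp
  have "herm e b \<noteq> 0" "herm b e' \<noteq> 0"
    unfolding b_def herm_commute[of e "_ *s _"] herm_scale_left herm_add_left using True T' e by (auto simp: herm_self)
  then show ?thesis using Y_moment_eq_of_herm[OF K e(1) b, where 'p = 'p] Y_moment_eq_of_herm[OF K b e(2), where 'p = 'p] by simp
qed (rule Y_moment_eq_of_herm[OF assms])

text \<open>The series at complex arguments: \<open>psum\<close> gives the kernel on the diagonal
  only, while the reproducing function takes complex values off it.\<close>

definition cF :: "(nat \<Rightarrow> real) \<Rightarrow> complex \<Rightarrow> complex" where
  "cF c s = (\<Sum>m. of_real (c m) * s ^ m)"

context comparable_series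
begin

lemma summable_cF: "cmod s < 1 \<Longrightarrow> summable (\<lambda>m. norm (of_real (c m) * s ^ m))"
  using summable_c[of "cmod s"] c_pos by (simp add: norm_mult norm_power less_imp_le)

lemma cF_of_real: "0 \<le> x \<Longrightarrow> x < 1 \<Longrightarrow> cF c (of_real x) = of_real (psum c x)"
  unfolding cF_def psum_def using suminf_of_real[OF summable_c[of x], where 'a = complex] by simp

lemma cF_deriv: "cmod s < 1 \<Longrightarrow> (cF c has_field_derivative (\<Sum>m. diffs (\<lambda>m. of_real (c m)) m * s ^ m)) (at s)"
  unfolding cF_def[abs_def] by (rule termdiffs_strong'[of 1]) (auto intro: summable_norm_cancel summable_cF)

lemma cmod_cF_le: "cmod s \<le> x \<Longrightarrow> x < 1 \<Longrightarrow> cmod (cF c s) \<le> psum c x"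
proof -
  assume s: "cmod s \<le> x" "x < 1"
  have "cmod (cF c s) \<le> (\<Sum>m. norm (of_real (c m) * s ^ m))"
    unfolding cF_def using s by (intro summable_norm summable_cF) auto
  also have "\<dots> \<le> psum c x"
    unfolding psum_def
  proof (rule suminf_le)
    show "norm (of_real (c m) * s ^ m) \<le> c m * x ^ m" for m
      using c_pos[of m] s by (simp add: norm_mult norm_power mult_left_mono power_mono)
  qed (use s order_trans[OF norm_ge_zero s(1)] in \<open>auto intro!: summable_cF summable_c\<close>)
  finally show ?thesis .
qed

end

text \<open>Expand the kernel in powers of the Hermitian product and integrate term by term. Since c
  m is the reciprocal moment, the m-th term becomes the m-th Taylor term of f along the line through
  w, and the sum is the value of f.\<close>

lemma reproduces_base:
  fixes w :: "complex^'r::finite"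
  assumes K: "K > 0" and c: "comparable_series c N \<alpha> \<beta>"
    and M: "\<And>m e :: complex^'r. norm e = 1 \<Longrightarrow> c m * Y_moment K TYPE('p::finite) e m = 1"
    and w: "norm w < 1"
  shows "reproduces (Y_II K) (mk 0 w :: complex^('p uprod + 'r)) (\<lambda>z. cF c (herm (wpart z) w))"
proof -
  interpret comparable_series c N \<alpha> \<beta> by (rule c)
  let ?Y = "Y_II K :: (complex^('p uprod + 'r)) set"
  have Y: "?Y \<in> sets borel" by (intro borel_open open_Y_II K)
  define t where "t = norm w"
  have t: "0 \<le> t" "t < 1" using w by (auto simp: t_def)
  \<comment> \<open>The direction of w; if w vanishes, any unit vector serves.\<close>
  obtain e where e: "norm e = 1" "w = of_real t *s e"
  proof (cases "w = 0")
    case True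
    show ?thesis by (rule that[of "axis undefined 1"]) (use True in \<open>auto simp: t_def norm_eq_sqrt_inner inner_axis_axis\<close>)
  next
    case False
    then show ?thesis by (intro that[of "of_real (1 / t) *s w"]) (auto simp: t_def norm_vec_scale norm_divide vec_eq_iff)
  qed
  have hw: "herm (wpart z) w = of_real t * herm (wpart z) e" for z :: "complex^('p uprod + 'r)"
    unfolding e(2) herm_scale_right by simp
  have small: "cmod (herm (wpart z) w) \<le> t" if "z \<in> ?Y" for z
    using herm_less_one[OF K e(1) that] t mult_left_le[of "cmod (herm (wpart z) e)" t] by (simp add: hw norm_mult)
  have "(\<lambda>z. cF c (herm (wpart z) w)) \<in> bergman_space ?Y"
  proof (rule bounded_bergman_space[OF K])
    show "holomorphic_cn (\<lambda>z. cF c (herm (wpart z) w)) ?Y"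
      unfolding holomorphic_cn_iff
      using small t by (intro ballI cdiff_compose[OF cdiff_herm cF_deriv]) (meson le_less_trans)
    show "cmod (cF c (herm (wpart z) w)) \<le> psum c t" if "z \<in> ?Y" for z
      using small[OF that] t(2) by (rule cmod_cF_le)
  qed
  moreover have "f (mk 0 w) = (LINT z:?Y|lborel. f z * cnj (cF c (herm (wpart z) w)))" if f: "f \<in> bergman_space ?Y" for f
  proof -
    define \<phi> where "\<phi> s = f (mk 0 (s *s e))" for s
    define F where "F m z = indicator ?Y z *\<^sub>R (f z * cnj (of_real (c m) * herm (wpart z) w ^ m))" for m z
    have Feq: "F m z = (of_real (c m * t ^ m)) * (indicator ?Y z *\<^sub>R (f z * cnj (herm (wpart z) e) ^ m))" for m z
      by (simp add: F_def hw power_mult_distrib mult_ac scaleR_conv_of_real)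
    have int: "integrable lborel (\<lambda>z. indicator ?Y z *\<^sub>R (f z * cnj (herm (wpart z) e) ^ m))" for m
    proof -
      have "set_integrable lborel ?Y (\<lambda>z. f z * cnj (herm (wpart z) e) ^ m)"
      proof (rule bergman_space_integrable[OF K f continuous_herm_power[OF K e(1)], where B = 1])
        fix z assume "z \<in> ?Y"
        from herm_less_one[OF K e(1) this] show "cmod (cnj (herm (wpart z) e) ^ m) \<le> 1"
          by (simp add: norm_power power_le_one)
      qed
      then show ?thesis by (simp add: set_integrable_def)
    qed
    have Fi: "integrable lborel (F m)" for m
      unfolding Feq[abs_def] by (rule integrable_mult_right) (rule int)
    have f1: "integrable lborel (\<lambda>z. norm (indicator ?Y z *\<^sub>R f z))" using int[of 0] by (intro integrable_norm) simp
    have Fle: "norm (F m z) \<le> c m * t ^ m * norm (indicator ?Y z *\<^sub>R f z)" for m z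
    proof (cases "z \<in> ?Y")
      case True
      have "cmod (herm (wpart z) w) ^ m \<le> t ^ m" using small[OF True] by (rule power_mono) simp
      then have "c m * cmod (f z) * cmod (herm (wpart z) w) ^ m \<le> c m * cmod (f z) * t ^ m"
        using c_pos[of m] by (intro mult_left_mono) auto
      then show ?thesis using True c_pos[of m] by (simp add: F_def norm_mult norm_power mult_ac)
    qed (simp add: F_def)
    have sc: "summable (\<lambda>m. c m * t ^ m)" using t by (intro summable_c) simp
    \<comment> \<open>The terms are dominated by \<open>c m * t ^ m\<close> times
      \<open>|f|\<close>, and this series converges because \<open>t < 1\<close>.\<close>
    have sums1: "(\<lambda>m. integral\<^sup>L lborel (F m)) sums (\<integral>z. (\<Sum>m. F m z) \<partial>lborel)"
    proof (rule sums_integral[OF Fi])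
      show "AE z in lborel. summable (\<lambda>m. norm (F m z))"
        by (intro AE_I2 summable_comparison_test'[OF summable_mult2[OF sc]]) (use Fle in auto)
      show "summable (\<lambda>m. \<integral>z. norm (F m z) \<partial>lborel)"
      proof (rule summable_comparison_test'[OF summable_mult2[OF sc]])
        fix m :: nat
        have "(\<integral>z. norm (F m z) \<partial>lborel) \<le> (\<integral>z. c m * t ^ m * norm (indicator ?Y z *\<^sub>R f z) \<partial>lborel)"
          using Fle by (intro integral_mono integrable_norm Fi integrable_mult_right f1)
        then show "norm (\<integral>z. norm (F m z) \<partial>lborel) \<le> c m * t ^ m * (\<integral>z. norm (indicator ?Y z *\<^sub>R f z) \<partial>lborel)"
          by simp
      qed
    qed
    have "integral\<^sup>L lborel (F m) = (deriv ^^ m) \<phi> 0 / fact m * (of_real t - 0) ^ m" for m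
    proof -
      have "integral\<^sup>L lborel (F m) = of_real (c m * t ^ m) * (LINT z:?Y|lborel. f z * cnj (herm (wpart z) e) ^ m)"
        unfolding Feq[abs_def] set_lebesgue_integral_def by (rule integral_mult_right_zero)
      also have "\<dots> = of_real (c m * t ^ m) * ((deriv ^^ m) \<phi> 0 / fact m * Y_moment K TYPE('p) e m)"
        unfolding fibre_coefficient(2)[OF K e(1) f] \<phi>_def[abs_def] ..
      also have "\<dots> = (deriv ^^ m) \<phi> 0 / fact m * of_real (t ^ m) * of_real (c m * Y_moment K TYPE('p) e m)"
        by simp
      finally show ?thesis unfolding M[OF e(1)] by simp
    qed
    moreover have "(\<lambda>m. (deriv ^^ m) \<phi> 0 / fact m * (of_real t - 0) ^ m) sums \<phi> (of_real t)"
      using fibre_coefficient(1)[OF K e(1) f] t unfolding \<phi>_def[abs_def, symmetric]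
      by (intro holomorphic_power_series) auto
    ultimately have "\<phi> (of_real t) = (\<integral>z. (\<Sum>m. F m z) \<partial>lborel)"
      using sums1 by (simp add: sums_unique2)
    moreover have "(\<Sum>m. F m z) = indicator ?Y z *\<^sub>R (f z * cnj (cF c (herm (wpart z) w)))" for z
    proof (cases "z \<in> ?Y")
      case True
      have "cmod (herm (wpart z) w) < 1" using small[OF True] t by simp
      from summable_sums[OF summable_norm_cancel[OF summable_cF[OF this]]]
      have "(\<lambda>m. f z * cnj (of_real (c m) * herm (wpart z) w ^ m)) sums (f z * cnj (cF c (herm (wpart z) w)))"
        unfolding cF_def[symmetric] by (intro sums_mult) (simp only: sums_cnj)
      then show ?thesis using True by (simp add: F_def sums_iff)
    qed (simp add: F_def)
    ultimately show ?thesis by (simp add: \<phi>_def e(2) set_lebesgue_integral_def)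
  qed
  ultimately show ?thesis by (simp add: reproduces_def)
qed

text \<open>An automorphism adapted to u moves u over \<open>Z = 0\<close>, and transporting back
  contributes \<open>|J u|^2\<close>. The kernel is evaluated on the diagonal, which is what the
  potential of the metric uses.\<close>

lemma Y_II_kernel_diagonal:
  fixes u :: "complex^('p::finite uprod + 'r::finite)"
  assumes K: "K > 0" and c: "comparable_series c N \<alpha> \<beta>"
    and M: "\<And>m e :: complex^'r. norm e = 1 \<Longrightarrow> c m * Y_moment K TYPE('p) e m = 1"
    and u: "u \<in> Y_II K"
  shows "bergman_kernel (Y_II K) u u
    = of_real (exp ((K * (real CARD('p) + 1) + real CARD('r)) * hfun K u) * psum c (X_II K u))"
proof -
  let ?Y = "Y_II K :: (complex^('p uprod + 'r)) set"
  let ?D = "\<lambda>u :: complex^('p uprod + 'r). complex_of_real (exp ((K * (real CARD('p) + 1) + real CARD('r)) * hfun K u) * psum c (X_II K u))"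
  interpret comparable_series c N \<alpha> \<beta> by (rule c)
  have "\<exists>\<kappa>. reproduces ?Y u \<kappa> \<and> \<kappa> u = ?D u" if u: "u \<in> ?Y" for u
  proof -
    have u0: "u \<in> dom0" and X: "X_II K u < 1" using u by (auto simp: Y_II_iff[OF K])
    obtain \<Phi> :: "complex^('p uprod + 'r) \<Rightarrow> complex^('p uprod + 'r)" and \<Phi>' and J :: "complex^('p uprod + 'r) \<Rightarrow> complex"
      where \<Phi>: "bij_betw \<Phi> ?Y ?Y" "\<And>z. z \<in> ?Y \<Longrightarrow> (\<Phi> has_derivative \<Phi>' z) (at z)"
        "\<And>z c v. z \<in> ?Y \<Longrightarrow> \<Phi>' z (c *s v) = c *s \<Phi>' z v"
        "\<And>z. z \<in> ?Y \<Longrightarrow> adet (\<Phi>' z) = (cmod (J z))\<^sup>2"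
        "holomorphic_cn J ?Y" "\<And>z. z \<in> ?Y \<Longrightarrow> J z \<noteq> 0"
        and b: "Zpart (\<Phi> u) = 0" "(norm (wpart (\<Phi> u)))\<^sup>2 = X_II K u"
        and J: "(cmod (J u))\<^sup>2 = exp ((K * (real CARD('p) + 1) + real CARD('r)) * hfun K u)"
      by (rule Y_II_automorphism[OF K u0]) blast
    define w where "w = wpart (\<Phi> u)"
    have base: "\<Phi> u = mk 0 w"
      by (rule parts_eqI) (simp_all add: b w_def wpart_mk)
    have "(norm w)\<^sup>2 < 1" using b(2) X by (simp add: w_def)
    then have w: "norm w < 1" by (simp add: abs_square_less_1)
    have "reproduces ?Y (\<Phi> u) (\<lambda>z. cF c (herm (wpart z) w))"
      unfolding base by (rule reproduces_base[OF K c M w])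
    from reproduces_transport[OF open_Y_II[OF K] \<Phi> u this]
    have "reproduces ?Y u (\<lambda>z. J z * cF c (herm (wpart (\<Phi> z)) w) * cnj (J u))" .
    moreover have "J u * cF c (herm (wpart (\<Phi> u)) w) * cnj (J u) = ?D u"
    proof -
      have "cF c (herm (wpart (\<Phi> u)) w) = of_real (psum c (X_II K u))"
        unfolding w_def herm_self b(2) using X by (intro cF_of_real) (metis b(2) zero_le_power2)
      then have "J u * cF c (herm (wpart (\<Phi> u)) w) * cnj (J u) = (J u * cnj (J u)) * of_real (psum c (X_II K u))"
        by simp
      then show ?thesis unfolding complex_norm_square[symmetric] J by simp
    qed
    ultimately show ?thesis by blast
  qed
  then obtain \<kappa> where "\<And>u. u \<in> ?Y \<Longrightarrow> reproduces ?Y u (\<kappa> u) \<and> \<kappa> u u = ?D u" by metis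
  then show ?thesis using bergman_kernel_diagonal[OF open_Y_II[OF K], of \<kappa> u] u by simp
qed

text \<open>The coefficients are reciprocal moments, so the upper bound on the moments yields the
  lower constant and conversely. Independence of direction lets one sequence serve all unit
  vectors.\<close>

lemma comparable_moments:
  assumes K: "K \<ge> 1"
  obtains c \<alpha> \<beta> where "comparable_series c CARD('p::finite uprod + 'r::finite) \<alpha> \<beta>"
    "\<And>m e :: complex^'r. norm e = 1 \<Longrightarrow> c m * Y_moment K TYPE('p) e m = 1"
proof -
  let ?N = "CARD('p uprod + 'r)"
  have K0: "K > 0" using K by simp
  define Ym where "Ym m = Y_moment K TYPE('p) (axis undefined 1 :: complex^'r) m" for m
  obtain \<gamma>1 \<gamma>2 where \<gamma>: "\<gamma>1 > 0" "\<And>m. \<gamma>1 / nbin ?N m \<le> Ym m" "\<And>m. Ym m \<le> \<gamma>2 / nbin ?N m"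
    using Y_moment_bounds[OF K open_Y_II[OF K0], of undefined] unfolding Ym_def by metis
  have n: "nbin ?N m > 0" for m by (rule nbin_pos)
  have pos: "Ym m > 0" for m using \<gamma>(1) \<gamma>(2)[of m] n[of m] by (meson divide_pos_pos less_le_trans)
  have \<gamma>2: "\<gamma>2 > 0" using less_le_trans[OF pos \<gamma>(3)[of 0]] n[of 0] by (simp add: zero_less_divide_iff)
  show ?thesis
  proof (rule that)
    show "comparable_series (\<lambda>m. 1 / Ym m) ?N (1 / \<gamma>2) (1 / \<gamma>1)"
    proof
      show "1 / \<gamma>2 > 0" using \<gamma>2 by simp
      show "1 / \<gamma>2 * nbin ?N m \<le> 1 / Ym m" for m
        using \<gamma>(3)[of m] pos[of m] n[of m] \<gamma>2 by (simp add: field_simps)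
      show "1 / Ym m \<le> 1 / \<gamma>1 * nbin ?N m" for m
        using \<gamma>(2)[of m] pos[of m] n[of m] \<gamma>(1) by (simp add: field_simps)
    qed
    have a1: "norm (axis undefined 1 :: complex^'r) = 1" by (simp add: norm_eq_sqrt_inner inner_axis_axis)
    show "1 / Ym m * Y_moment K TYPE('p) e m = 1" if "norm e = 1" for m and e :: "complex^'r"
      unfolding Ym_def Y_moment_unit[OF K0 that a1] using pos[of m] by (simp add: Ym_def)
  qed
qed

section \<open>Equivalence of the metrics\<close>

text \<open>\<open>levi_form\<close> with \<open>C = 1\<close> and
  \<open>G(x) = - ln (1 - x)\<close>; the power of K in the potential is its additive
  constant.\<close>

lemma E_II_levi:
  fixes z v :: "complex^('p::finite uprod + 'r::finite)"
  assumes K: "K > 0" and z: "z \<in> Y_II K"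
  defines "x \<equiv> X_II K z"
  shows "E_II K z v = 1 * (levi_q z v / K)
      + 1 / (1 - x) * (exp (hfun K z) * ((norm (levi_om K z v))\<^sup>2 + (norm (wpart z))\<^sup>2 * (levi_q z v / K)))
      + 1 / (1 - x)\<^sup>2 * ((exp (hfun K z))\<^sup>2 * (cmod (herm (levi_om K z v) (wpart z)))\<^sup>2)"
proof -
  define C0 where "C0 = K powr ((real CARD('r) - real (dimN CARD('r) CARD('p))) / (1 + real (dimN CARD('r) CARD('p))))"
  have C0: "C0 > 0" using K by (simp add: C0_def)
  have g: "g_II K u = 1 * hfun K u + (- ln (1 - X_II K u)) + ln C0" if "u \<in> Y_II K" for u :: "complex^('p uprod + 'r)"
  proof -
    have u: "u \<in> dom0" "X_II K u < 1" using that by (auto simp: Y_II_iff[OF K])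
    have d: "detZ u powr (- 1 / K) = exp (hfun K u)"
      using detZ_pos[OF u(1)] by (simp add: powr_def hfun_def)
    show ?thesis
      unfolding g_II_def C0_def[symmetric] d using u(2) C0 by (simp add: ln_mult ln_div)
  qed
  show ?thesis
    unfolding E_II_def x_def
  proof (rule levi_form[OF open_Y_II[OF K] _ z K g])
    show "Y_II K \<subseteq> (dom0 :: (complex^('p uprod + 'r)) set)" by (auto simp: Y_II_iff[OF K])
    show "((\<lambda>x. - ln (1 - x)) has_real_derivative 1 / (1 - X_II K u)) (at (X_II K u))"
      if "u \<in> Y_II K" for u :: "complex^('p uprod + 'r)"
      using that by (auto simp: Y_II_iff[OF K] intro!: derivative_eq_intros)
    show "((\<lambda>x. 1 / (1 - x)) has_real_derivative 1 / (1 - X_II K z)\<^sup>2) (at (X_II K z))"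
      using z by (auto simp: Y_II_iff[OF K] power2_eq_square intro!: derivative_eq_intros)
  qed
qed

lemma (in comparable_series) B_II_levi:
  fixes z v :: "complex^('p::finite uprod + 'r::finite)"
  assumes K: "K > 0" and M: "\<And>m e :: complex^'r. norm e = 1 \<Longrightarrow> c m * Y_moment K TYPE('p) e m = 1"
    and z: "z \<in> Y_II K"
  defines "x \<equiv> X_II K z"
  shows "B_II K z v = (K * (real CARD('p) + 1) + real CARD('r)) * (levi_q z v / K)
      + G1 x * (exp (hfun K z) * ((norm (levi_om K z v))\<^sup>2 + (norm (wpart z))\<^sup>2 * (levi_q z v / K)))
      + G2 x * ((exp (hfun K z))\<^sup>2 * (cmod (herm (levi_om K z v) (wpart z)))\<^sup>2)"
proof -
  have X: "0 \<le> X_II K u" "X_II K u < 1" if "u \<in> Y_II K" for u :: "complex^('p uprod + 'r)"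
    using that by (auto simp: Y_II_iff[OF K] X_II_eq)
  have g: "ln (Re (bergman_kernel (Y_II K) u u))
      = (K * (real CARD('p) + 1) + real CARD('r)) * hfun K u + ln (psum c (X_II K u)) + 0"
    if "u \<in> Y_II K" for u :: "complex^('p uprod + 'r)"
  proof -
    have "bergman_kernel (Y_II K) u u
        = of_real (exp ((K * (real CARD('p) + 1) + real CARD('r)) * hfun K u) * psum c (X_II K u))"
      by (rule Y_II_kernel_diagonal[OF K comparable_series_axioms _ that]) (rule M)
    then show ?thesis using psum_pos[OF X[OF that]] by (simp add: ln_mult)
  qed
  show ?thesis
    unfolding B_II_def bergman_metric_def x_def
  proof (rule levi_form[OF open_Y_II[OF K] _ z K g])
    show "Y_II K \<subseteq> (dom0 :: (complex^('p uprod + 'r)) set)" by (auto simp: Y_II_iff[OF K])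
  qed (auto intro: ln_psum_deriv G1_deriv X z)
qed

text \<open>If the Levi form of h vanishes on v, then v has no matrix part; \<open>levi_om\<close>
  then reduces to the w part, which cannot vanish as well.\<close>

lemma E_II_pos:
  fixes z v :: "complex^('p::finite uprod + 'r::finite)"
  assumes K: "K > 0" and z: "z \<in> Y_II K" and v: "v \<noteq> 0"
  shows "E_II K z v > 0"
proof -
  have z0: "z \<in> dom0" "X_II K z < 1" using z by (auto simp: Y_II_iff[OF K])
  define q where "q = levi_q z v / K"
  have q: "q \<ge> 0" using levi_q_nonneg[OF z0(1)] K by (simp add: q_def)
  define A where "A = 1 / (1 - X_II K z) * (exp (hfun K z) * ((norm (levi_om K z v))\<^sup>2 + (norm (wpart z))\<^sup>2 * q))"
  have A: "A \<ge> 0" using z0(2) q by (simp add: A_def)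
  have "E_II K z v \<ge> q + A"
    unfolding E_II_levi[OF K z] A_def q_def by simp
  moreover have "q + A > 0"
  proof (cases "q = 0")
    case True
    then have "Zpart v = 0" using levi_q_zero[OF z0(1)] K by (simp add: q_def)
    then have "levi_om K z v = wpart v" by (simp add: levi_om_def dlog_def Zpart_scale trace_def)
    moreover have "wpart v \<noteq> 0" using v \<open>Zpart v = 0\<close> parts_eqI[of v 0] by auto
    ultimately have "A > 0" using z0(2) True by (simp add: A_def)
    then show ?thesis using q by simp
  qed (use q A in simp)
  ultimately show ?thesis by linarith
qed

theorem mainTheorem3:
  fixes K :: real
  assumes "CARD('p::finite) > 1"
    and "CARD('r::finite) \<ge> 1"
    and "K = real CARD('p) / 2 + 1 / (real CARD('p) + 1)"
  shows "\<exists>a b :: real. a \<ge> b \<and> b > 0 \<and>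
           (\<forall>z \<in> (Y_II K :: (complex^('p uprod + 'r)) set). \<forall>v. v \<noteq> 0 \<longrightarrow>
              b \<le> B_II K z v / E_II K z v \<and> B_II K z v / E_II K z v \<le> a)"
proof -
  \<comment> \<open>\<open>p >= 2\<close> gives \<open>p / 2 >= 1\<close>; the inner ellipsoid
    depends on this.\<close>
  have K: "K \<ge> 1" using assms(1,3) by (simp add: add_increasing2)
  then have K0: "K > 0" by simp
  let ?N = "CARD('p uprod + 'r)"
  obtain c \<alpha> \<beta> where cs: "comparable_series c ?N \<alpha> \<beta>"
    and M: "\<And>m e :: complex^'r. norm e = 1 \<Longrightarrow> c m * Y_moment K TYPE('p) e m = 1"
    using comparable_moments[OF K, where 'p = 'p and 'r = 'r] by blast
  interpret comparable_series c ?N \<alpha> \<beta> by (rule cs)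
  define C where "C = K * (real CARD('p) + 1) + real CARD('r)"
  define \<rho> \<sigma> where "\<rho> = \<alpha> / \<beta> * real (?N + 1)" and "\<sigma> = \<beta> / \<alpha> * real (?N + 1)"
  \<comment> \<open>C compares the coefficients of the Levi form of h, which is 1 for the
    Einstein-Kaehler metric; \<rho> and \<sigma> bound both \<open>G'\<close> and
    \<open>G' + x G''\<close> relative to that metric.\<close>
  define b a where "b = min C \<rho>" and "a = max C \<sigma>"
  have C: "C > 0" using K0 by (simp add: C_def add_pos_nonneg)
  have b: "b > 0" "b \<le> C" "b \<le> \<rho>" using \<alpha> \<beta> C by (auto simp: b_def \<rho>_def)
  have a: "a > 0" "C \<le> a" "\<sigma> \<le> a" using C by (auto simp: a_def)
  have main: "b * E_II K z v \<le> B_II K z v \<and> 1 / a * B_II K z v \<le> E_II K z v"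
    if z: "z \<in> Y_II K" for z v :: "complex^('p uprod + 'r)"
  proof -
    have z0: "z \<in> dom0" using z by (simp add: Y_II_iff[OF K0])
    define x where "x = X_II K z"
    have x: "0 \<le> x" "x < 1" "x = (norm (wpart z))\<^sup>2 * exp (hfun K z)"
      using z z0 by (auto simp: x_def Y_II_iff[OF K0] X_II_eq)
    have q: "levi_q z v / K \<ge> 0" using levi_q_nonneg[OF z0] K0 by simp
    have \<tau>: "(cmod (herm (levi_om K z v) (wpart z)))\<^sup>2 \<le> (norm (levi_om K z v))\<^sup>2 * (norm (wpart z))\<^sup>2"
      using norm_herm_le[of "levi_om K z v" "wpart z"] by (simp add: power_mono flip: power_mult_distrib)
    \<comment> \<open>The value of \<open>G' + x G''\<close> for
      \<open>G(x) = - ln (1 - x)\<close>.\<close>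
    have sq: "1 / (1 - x) + x * (1 / (1 - x)\<^sup>2) = 1 / (1 - x)\<^sup>2"
      using x(2) by (simp add: divide_simps power2_eq_square)
    have n: "0 \<le> 1 / (1 - x)" "0 \<le> 1 / (1 - x)\<^sup>2" using x(2) by auto
    have B: "B_II K z v = C * (levi_q z v / K)
      + G1 x * (exp (hfun K z) * ((norm (levi_om K z v))\<^sup>2 + (norm (wpart z))\<^sup>2 * (levi_q z v / K)))
      + G2 x * ((exp (hfun K z))\<^sup>2 * (cmod (herm (levi_om K z v) (wpart z)))\<^sup>2)"
      unfolding C_def x_def by (rule B_II_levi[OF K0 _ z]) (rule M)
    note bounds = G1_bounds[OF x(1,2), folded \<rho>_def \<sigma>_def] and var = variance_bounds[OF _ x(2), folded \<rho>_def \<sigma>_def]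
    have "b * E_II K z v \<le> B_II K z v"
      unfolding E_II_levi[OF K0 z] B x_def[symmetric]
    proof (rule levi_compare[OF q _ _ _ \<tau>])
      show "b * 1 \<le> C" using b by simp
      show "b * (1 / (1 - x)) \<le> G1 x" by (rule order_trans[OF mult_right_mono[OF b(3) n(1)] bounds(1)])
      assume "(norm (wpart z))\<^sup>2 > 0"
      then have "0 < x" by (simp add: x(3))
      then show "b * (1 / (1 - x) + (norm (wpart z))\<^sup>2 * exp (hfun K z) * (1 / (1 - x)\<^sup>2))
          \<le> G1 x + (norm (wpart z))\<^sup>2 * exp (hfun K z) * G2 x"
        unfolding x(3)[symmetric] sq by (intro order_trans[OF mult_right_mono[OF b(3) n(2)] var(1)])
    qed auto
    \<comment> \<open>The same termwise comparison with the roles of the metrics exchanged, hence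
      the factor \<open>1 / a\<close>.\<close>
    moreover have "1 / a * B_II K z v \<le> E_II K z v"
      unfolding E_II_levi[OF K0 z] B x_def[symmetric]
    proof (rule levi_compare[OF q _ _ _ \<tau>])
      show "1 / a * C \<le> 1" using a by simp
      have "G1 x \<le> a * (1 / (1 - x))" by (rule order_trans[OF bounds(2) mult_right_mono[OF a(3) n(1)]])
      then show "1 / a * G1 x \<le> 1 / (1 - x)" using a(1) by (simp add: field_simps)
      assume "(norm (wpart z))\<^sup>2 > 0"
      then have "0 < x" by (simp add: x(3))
      then have "G1 x + x * G2 x \<le> a * (1 / (1 - x)\<^sup>2)" by (intro order_trans[OF var(2) mult_right_mono[OF a(3) n(2)]])
      then show "1 / a * (G1 x + (norm (wpart z))\<^sup>2 * exp (hfun K z) * G2 x)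
          \<le> 1 / (1 - x) + (norm (wpart z))\<^sup>2 * exp (hfun K z) * (1 / (1 - x)\<^sup>2)"
        unfolding x(3)[symmetric] sq using a(1) by (simp add: field_simps)
    qed auto
    ultimately show ?thesis ..
  qed
  show ?thesis
  proof (intro exI conjI ballI allI impI)
    show "b \<le> a" using a b by simp
    show "b > 0" by (rule b(1))
    fix z v :: "complex^('p uprod + 'r)"
    assume z: "z \<in> Y_II K" and v: "v \<noteq> 0"
    note E = E_II_pos[OF K0 z v]
    show "b \<le> B_II K z v / E_II K z v" using main[OF z, of v] E by (simp add: pos_le_divide_eq)
    show "B_II K z v / E_II K z v \<le> a" using main[OF z, of v] E a(1) by (simp add: field_simps)
  qed
qed

end
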